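(* Let $M$ be a Riemannian manifold whose injectivity radius is bigger than a positive number $c$. Suppose there is a stochastic dynamical system $(X,A)$ on $M$ with $C^2$ coefficients which is strongly $1$-complete. Then the first homotopy group $\pi_1(M)$ vanishes if for each compact set $K\subset M$ $$\lim_{t\to\infty}\ \sup_{x\in K}E|T_xF_t|=0 .$$
   Context: A stochastic dynamical system $(X,A)$ is the Stratonovich equation $dx_t=X(x_t)\circ dB_t+A(x_t)\,dt$, with $B_t$ an $\mathbb R^m$-valued Brownian motion on a filtered probability space satisfying the usual conditions, $X(x):\mathbb R^m\to T_xM$ linear for each $x$, and $A$ a vector field. $F_t(x)$ is the maximal solution from $x$ with explosion time $\xi(x)$, taken in the version of a partial flow (almost surely $\{x:t<\xi(x,\omega)\}$ is open and $F_t(\cdot,\omega)$ is a $C^1$ diffeomorphism of it onto an open subset of $M$, continuously in $t$). $T_xF_t:T_xM\to T_{F_t(x)}M$ is the derivative flow; $v_t=T_xF_t(v)$ solves $Dv_t=\nabla X(v_t)\circ dB_t+\nabla A(v_t)\,dt$, $v_0=v$. For $K$ compact, $\xi^K=\inf_{x\in K}\xi(x)$. The system is strongly $1$-complete if $\xi^K=\infty$ a.s. for every $K$ that is the image of a smooth singular $1$-simplex (smooth meaning extending smoothly over an open neighbourhood of the standard simplex). *)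

theory Defs
  imports "HOL-Probability.Probability" "HOL-Algebra.Elementary_Groups"
begin

section \<open>Manifolds and maps of class C^k\<close>

text \<open>
  For a finite-dimensional domain and open \<open>S\<close>, continuity of all iterated directional derivatives
  is the usual C^k condition; \<open>k = \<infinity>\<close> means smooth.
\<close>

primrec C_nat_on ::
  "nat \<Rightarrow> 'a::real_normed_vector set \<Rightarrow> ('a \<Rightarrow> 'b::real_normed_vector) \<Rightarrow> bool" where
  "C_nat_on 0 S f \<longleftrightarrow> continuous_on S f"
| "C_nat_on (Suc k) S f \<longleftrightarrow>
     (\<forall>x\<in>S. f differentiable (at x)) \<and> (\<forall>v. C_nat_on k S (\<lambda>x. frechet_derivative f (at x) v))"

definition Ck_on ::
  "enat \<Rightarrow> 'a::real_normed_vector set \<Rightarrow> ('a \<Rightarrow> 'b::real_normed_vector) \<Rightarrow> bool" where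
  "Ck_on k S f \<longleftrightarrow> (\<forall>n. enat n \<le> k \<longrightarrow> C_nat_on n S f)"

text \<open>
  A chart is a domain together with a map that is relevant only on that domain. The manifold is the
  whole type \<open>'m\<close>, its dimension is \<open>DIM('e)\<close>.
\<close>

type_synonym ('m, 'e) chart = "'m set \<times> ('m \<Rightarrow> 'e)"

abbreviation cdom :: "('m, 'e) chart \<Rightarrow> 'm set" where "cdom c \<equiv> fst c"
abbreviation cmap :: "('m, 'e) chart \<Rightarrow> 'm \<Rightarrow> 'e" where "cmap c \<equiv> snd c"
abbreviation cran :: "('m, 'e) chart \<Rightarrow> 'e set" where "cran c \<equiv> cmap c ` cdom c"
abbreviation cinv :: "('m, 'e) chart \<Rightarrow> 'e \<Rightarrow> 'm" where "cinv c \<equiv> inv_into (cdom c) (cmap c)"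

definition smooth_atlas ::
  "('m::{t2_space,second_countable_topology}, 'e::euclidean_space) chart set \<Rightarrow> bool" where
  "smooth_atlas \<A> \<longleftrightarrow>
     (\<Union>c\<in>\<A>. cdom c) = UNIV \<and>
     (\<forall>c\<in>\<A>. open (cdom c) \<and> open (cran c) \<and> homeomorphism (cdom c) (cran c) (cmap c) (cinv c)) \<and>
     (\<forall>c\<in>\<A>. \<forall>d\<in>\<A>. Ck_on \<infinity> (cmap c ` (cdom c \<inter> cdom d)) (cmap d \<circ> cinv c))"

definition Ck_map ::
  "enat \<Rightarrow> ('m::topological_space, 'e::euclidean_space) chart set \<Rightarrow>
    ('n::topological_space, 'f::euclidean_space) chart set \<Rightarrow> 'm set \<Rightarrow> ('m \<Rightarrow> 'n) \<Rightarrow> bool" where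
  "Ck_map k \<A> \<B> S f \<longleftrightarrow> continuous_on S f \<and>
     (\<forall>c\<in>\<A>. \<forall>d\<in>\<B>. Ck_on k (cmap c ` (S \<inter> cdom c \<inter> f -` cdom d)) (cmap d \<circ> f \<circ> cinv c))"

definition Ck_diffeo_onto_open_image ::
  "enat \<Rightarrow> ('m::topological_space, 'e::euclidean_space) chart set \<Rightarrow>
    ('n::topological_space, 'f::euclidean_space) chart set \<Rightarrow> 'm set \<Rightarrow> ('m \<Rightarrow> 'n) \<Rightarrow> bool" where
  "Ck_diffeo_onto_open_image k \<A> \<B> S f \<longleftrightarrow>
     open S \<and> open (f ` S) \<and> inj_on f S \<and>
     Ck_map k \<A> \<B> S f \<and> Ck_map k \<B> \<A> (f ` S) (inv_into S f)"

definition euclidean_atlas :: "('e::euclidean_space, 'e) chart set" where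
  "euclidean_atlas = {(UNIV, id)}"


section \<open>Tangent vectors\<close>

text \<open>
  A tangent vector at \<open>x\<close> is the family of its components in all charts around \<open>x\<close>, subject to the
  contravariant transformation rule. The value 0 in the irrelevant charts makes the family unique.
\<close>

type_synonym ('m, 'e) tvec = "('m, 'e) chart \<Rightarrow> 'e"

definition tangent_space ::
  "('m, 'e::euclidean_space) chart set \<Rightarrow> 'm \<Rightarrow> ('m, 'e) tvec set" where
  "tangent_space \<A> x = {v.
     (\<forall>c. \<not> (c \<in> \<A> \<and> x \<in> cdom c) \<longrightarrow> v c = 0) \<and>
     (\<forall>c\<in>\<A>. \<forall>d\<in>\<A>. x \<in> cdom c \<inter> cdom d \<longrightarrow>
        v d = frechet_derivative (cmap d \<circ> cinv c) (at (cmap c x)) (v c))}"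

text \<open>The tangent vector at \<open>x\<close> whose component in the chart \<open>c\<close> is \<open>u\<close>.\<close>

definition tvec_of ::
  "('m, 'e::euclidean_space) chart set \<Rightarrow> ('m, 'e) chart \<Rightarrow> 'm \<Rightarrow> 'e \<Rightarrow> ('m, 'e) tvec" where
  "tvec_of \<A> c x u = (\<lambda>d. if d \<in> \<A> \<and> x \<in> cdom d
     then frechet_derivative (cmap d \<circ> cinv c) (at (cmap c x)) u else 0)"

definition chart_at :: "('m, 'e) chart set \<Rightarrow> 'm \<Rightarrow> ('m, 'e) chart" where
  "chart_at \<A> x = (SOME c. c \<in> \<A> \<and> x \<in> cdom c)"

text \<open>
  \<open>derive_along \<A> x v f\<close> is \<open>df(v)\<close>, and \<open>tangent_map \<A> f x\<close> is \<open>T\<^sub>x f\<close>; by the transformation rule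
  neither depends on the chart chosen around \<open>x\<close>.
\<close>

definition derive_along ::
  "('m, 'e::euclidean_space) chart set \<Rightarrow> 'm \<Rightarrow> ('m, 'e) tvec \<Rightarrow> ('m \<Rightarrow> real) \<Rightarrow> real" where
  "derive_along \<A> x v f =
     (let c = chart_at \<A> x in frechet_derivative (f \<circ> cinv c) (at (cmap c x)) (v c))"

definition tangent_map ::
  "('m, 'e::euclidean_space) chart set \<Rightarrow> ('m \<Rightarrow> 'm) \<Rightarrow> 'm \<Rightarrow> ('m, 'e) tvec \<Rightarrow> ('m, 'e) tvec" where
  "tangent_map \<A> f x v = (let c = chart_at \<A> x in
     (\<lambda>d. if d \<in> \<A> \<and> f x \<in> cdom d
        then frechet_derivative (cmap d \<circ> f \<circ> cinv c) (at (cmap c x)) (v c) else 0))"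

definition Ck_vector_field ::
  "enat \<Rightarrow> ('m, 'e::euclidean_space) chart set \<Rightarrow> ('m \<Rightarrow> ('m, 'e) tvec) \<Rightarrow> bool" where
  "Ck_vector_field k \<A> V \<longleftrightarrow>
     (\<forall>x. V x \<in> tangent_space \<A> x) \<and> (\<forall>c\<in>\<A>. Ck_on k (cran c) (\<lambda>y. V (cinv c y) c))"


section \<open>Riemannian metrics, exponential map, injectivity radius\<close>

text \<open>The matrix of the metric in the chart \<open>c\<close>, as a bilinear form.\<close>

definition metric_coord ::
  "('m, 'e::euclidean_space) chart set \<Rightarrow> ('m \<Rightarrow> ('m, 'e) tvec \<Rightarrow> ('m, 'e) tvec \<Rightarrow> real) \<Rightarrow>
    ('m, 'e) chart \<Rightarrow> 'e \<Rightarrow> 'e \<Rightarrow> 'e \<Rightarrow> real" where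
  "metric_coord \<A> g c y u v = g (cinv c y) (tvec_of \<A> c (cinv c y) u) (tvec_of \<A> c (cinv c y) v)"

definition riemannian_metric ::
  "('m, 'e::euclidean_space) chart set \<Rightarrow> ('m \<Rightarrow> ('m, 'e) tvec \<Rightarrow> ('m, 'e) tvec \<Rightarrow> real) \<Rightarrow> bool" where
  "riemannian_metric \<A> g \<longleftrightarrow>
     (\<forall>x. \<forall>u\<in>tangent_space \<A> x. \<forall>v\<in>tangent_space \<A> x.
        g x u v = g x v u \<and> (u \<noteq> (\<lambda>_. 0) \<longrightarrow> 0 < g x u u) \<and>
        (\<forall>w\<in>tangent_space \<A> x. \<forall>a b.
           g x (\<lambda>c. a *\<^sub>R u c + b *\<^sub>R v c) w = a * g x u w + b * g x v w)) \<and>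
     (\<forall>c\<in>\<A>. \<forall>u v. Ck_on \<infinity> (cran c) (\<lambda>y. metric_coord \<A> g c y u v))"

text \<open>
  The Christoffel symbols \<open>\<Gamma>(u, v)\<close> of the Levi-Civita connection in the chart \<open>c\<close>, i.e.\ the covariant
  derivative of the constant coordinate field \<open>v\<close> along \<open>u\<close>, by Koszul's formula for commuting fields.
\<close>

definition christoffel ::
  "('m, 'e::euclidean_space) chart set \<Rightarrow> ('m \<Rightarrow> ('m, 'e) tvec \<Rightarrow> ('m, 'e) tvec \<Rightarrow> real) \<Rightarrow>
    ('m, 'e) chart \<Rightarrow> 'e \<Rightarrow> 'e \<Rightarrow> 'e \<Rightarrow> 'e" where
  "christoffel \<A> g c y u v =
     (let G = metric_coord \<A> g c; D = (\<lambda>a b d. frechet_derivative (\<lambda>z. G z b d) (at y) a) in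
      THE z. \<forall>w. G y z w = (D u v w + D v u w - D w u v) / 2)"

definition velocity ::
  "('m, 'e::euclidean_space) chart set \<Rightarrow> real set \<Rightarrow> (real \<Rightarrow> 'm) \<Rightarrow> real \<Rightarrow> ('m, 'e) tvec" where
  "velocity \<A> J \<gamma> t = (\<lambda>c. if c \<in> \<A> \<and> \<gamma> t \<in> cdom c
     then vector_derivative (cmap c \<circ> \<gamma>) (at t within J) else 0)"

definition geodesic_on ::
  "('m::topological_space, 'e::euclidean_space) chart set \<Rightarrow>
    ('m \<Rightarrow> ('m, 'e) tvec \<Rightarrow> ('m, 'e) tvec \<Rightarrow> real) \<Rightarrow> real set \<Rightarrow> (real \<Rightarrow> 'm) \<Rightarrow> bool" where
  "geodesic_on \<A> g J \<gamma> \<longleftrightarrow> continuous_on J \<gamma> \<and>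
     (\<forall>t\<in>J. \<forall>c\<in>\<A>. \<gamma> t \<in> cdom c \<longrightarrow>
        (let q = cmap c \<circ> \<gamma>; q' = (\<lambda>s. vector_derivative q (at s within J)) in
         q differentiable (at t within J) \<and>
         (q' has_vector_derivative - christoffel \<A> g c (q t) (q' t) (q' t)) (at t within J)))"

definition geodesic_from ::
  "('m::topological_space, 'e::euclidean_space) chart set \<Rightarrow>
    ('m \<Rightarrow> ('m, 'e) tvec \<Rightarrow> ('m, 'e) tvec \<Rightarrow> real) \<Rightarrow> 'm \<Rightarrow> ('m, 'e) tvec \<Rightarrow> (real \<Rightarrow> 'm) \<Rightarrow> bool" where
  "geodesic_from \<A> g x v \<gamma> \<longleftrightarrow>
     geodesic_on \<A> g {0..1} \<gamma> \<and> \<gamma> 0 = x \<and> velocity \<A> {0..1} \<gamma> 0 = v"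

definition exp_domain ::
  "('m::topological_space, 'e::euclidean_space) chart set \<Rightarrow>
    ('m \<Rightarrow> ('m, 'e) tvec \<Rightarrow> ('m, 'e) tvec \<Rightarrow> real) \<Rightarrow> 'm \<Rightarrow> ('m, 'e) tvec set" where
  "exp_domain \<A> g x = {v \<in> tangent_space \<A> x. \<exists>\<gamma>. geodesic_from \<A> g x v \<gamma>}"

definition exp_map ::
  "('m::topological_space, 'e::euclidean_space) chart set \<Rightarrow>
    ('m \<Rightarrow> ('m, 'e) tvec \<Rightarrow> ('m, 'e) tvec \<Rightarrow> real) \<Rightarrow> 'm \<Rightarrow> ('m, 'e) tvec \<Rightarrow> 'm" where
  "exp_map \<A> g x v = (THE y. \<exists>\<gamma>. geodesic_from \<A> g x v \<gamma> \<and> \<gamma> 1 = y)"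

text \<open>
  The supremum of the \<open>r\<close> such that \<open>exp\<^sub>x\<close> is a smooth diffeomorphism of the open \<open>r\<close>-ball of the
  tangent space at \<open>x\<close> onto an open set. Smoothness on the tangent space is expressed through the
  linear isomorphism \<open>tvec_of \<A> c x\<close> from \<open>'e\<close> given by any chart around \<open>x\<close>.
\<close>

definition injectivity_radius_at ::
  "('m::topological_space, 'e::euclidean_space) chart set \<Rightarrow>
    ('m \<Rightarrow> ('m, 'e) tvec \<Rightarrow> ('m, 'e) tvec \<Rightarrow> real) \<Rightarrow> 'm \<Rightarrow> ereal" where
  "injectivity_radius_at \<A> g x = Sup {ereal r | r. 0 < r \<and>
     {v \<in> tangent_space \<A> x. sqrt (g x v v) < r} \<subseteq> exp_domain \<A> g x \<and>
     (\<forall>c\<in>\<A>. x \<in> cdom c \<longrightarrow>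
        Ck_diffeo_onto_open_image \<infinity> euclidean_atlas \<A>
          {u. sqrt (g x (tvec_of \<A> c x u) (tvec_of \<A> c x u)) < r}
          (\<lambda>u. exp_map \<A> g x (tvec_of \<A> c x u)))}"

definition injectivity_radius ::
  "('m::topological_space, 'e::euclidean_space) chart set \<Rightarrow>
    ('m \<Rightarrow> ('m, 'e) tvec \<Rightarrow> ('m, 'e) tvec \<Rightarrow> real) \<Rightarrow> ereal" where
  "injectivity_radius \<A> g = (INF x. injectivity_radius_at \<A> g x)"

definition tangent_op_norm ::
  "('m, 'e::euclidean_space) chart set \<Rightarrow> ('m \<Rightarrow> ('m, 'e) tvec \<Rightarrow> ('m, 'e) tvec \<Rightarrow> real) \<Rightarrow>
    'm \<Rightarrow> 'm \<Rightarrow> (('m, 'e) tvec \<Rightarrow> ('m, 'e) tvec) \<Rightarrow> ennreal" where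
  "tangent_op_norm \<A> g x y T =
     (SUP v\<in>{v \<in> tangent_space \<A> x. sqrt (g x v v) \<le> 1}. ennreal (sqrt (g y (T v) (T v))))"


section \<open>Brownian motion and Stratonovich integrals\<close>

text \<open>
  Time runs through \<open>t \<ge> 0\<close>. The library notion of a filtration is indexed by the whole type; the
  sigma-algebras with negative index play no role.
\<close>

definition usual_filtration :: "'w measure \<Rightarrow> (real \<Rightarrow> 'w measure) \<Rightarrow> bool" where
  "usual_filtration P \<F> \<longleftrightarrow>
     prob_space P \<and> complete_measure P \<and> filtration (space P) \<F> \<and>
     (\<forall>t. subalgebra P (\<F> t)) \<and> null_sets P \<subseteq> sets (\<F> 0) \<and>
     (\<forall>t\<ge>0. sets (\<F> t) = (\<Inter>s\<in>{t<..}. sets (\<F> s)))"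

definition brownian_motion ::
  "'w measure \<Rightarrow> (real \<Rightarrow> 'w measure) \<Rightarrow> (real \<Rightarrow> 'w \<Rightarrow> 'b::euclidean_space) \<Rightarrow> bool" where
  "brownian_motion P \<F> B \<longleftrightarrow>
     (AE \<omega> in P. B 0 \<omega> = 0) \<and> (AE \<omega> in P. continuous_on {0..} (\<lambda>t. B t \<omega>)) \<and>
     (\<forall>t\<ge>0. B t \<in> borel_measurable (\<F> t)) \<and>
     (\<forall>s\<ge>0. \<forall>t>s.
        prob_space.indep_set P (sets (\<F> s))
          {(\<lambda>\<omega>. B t \<omega> - B s \<omega>) -` S \<inter> space P | S. S \<in> sets borel} \<and>
        prob_space.indep_vars P (\<lambda>_. borel) (\<lambda>e \<omega>. (B t \<omega> - B s \<omega>) \<bullet> e) Basis \<and>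
        (\<forall>e\<in>Basis. distributed P lborel (\<lambda>\<omega>. (B t \<omega> - B s \<omega>) \<bullet> e)
                      (normal_density 0 (sqrt (t - s)))))"

definition partition_of :: "real \<Rightarrow> real list \<Rightarrow> bool" where
  "partition_of t D \<longleftrightarrow> D \<noteq> [] \<and> sorted D \<and> hd D = 0 \<and> last D = t"

definition trapezoidal_sum ::
  "(real \<Rightarrow> 'w \<Rightarrow> real) \<Rightarrow> (real \<Rightarrow> 'w \<Rightarrow> real) \<Rightarrow> real list \<Rightarrow> 'w \<Rightarrow> real" where
  "trapezoidal_sum Y W D \<omega> =
     (\<Sum>i<length D - 1. (Y (D ! i) \<omega> + Y (D ! Suc i) \<omega>) / 2 * (W (D ! Suc i) \<omega> - W (D ! i) \<omega>))"

text \<open>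
  Following Kunita, \<open>I = \<integral>\<^sub>0\<^sup>t Y \<circ> dW\<close> means that the trapezoidal sums converge to \<open>I\<close> in probability
  as the mesh of the partition tends to 0.
\<close>

definition stratonovich_integral ::
  "'w measure \<Rightarrow> (real \<Rightarrow> 'w \<Rightarrow> real) \<Rightarrow> (real \<Rightarrow> 'w \<Rightarrow> real) \<Rightarrow> real \<Rightarrow> ('w \<Rightarrow> real) \<Rightarrow> bool" where
  "stratonovich_integral P Y W t I \<longleftrightarrow>
     I \<in> borel_measurable P \<and>
     (\<forall>s\<in>{0..t}. Y s \<in> borel_measurable P \<and> W s \<in> borel_measurable P) \<and>
     (\<forall>\<epsilon>>0. \<exists>\<delta>>0. \<forall>D. partition_of t D \<and> (\<forall>i<length D - 1. D ! Suc i - D ! i < \<delta>) \<longrightarrow>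
        measure P {\<omega> \<in> space P. \<bar>trapezoidal_sum Y W D \<omega> - I \<omega>\<bar> > \<epsilon>} < \<epsilon>)"


section \<open>Stochastic dynamical systems and their flows\<close>

definition C2_sds ::
  "('m, 'e::euclidean_space) chart set \<Rightarrow> ('m \<Rightarrow> 'b::euclidean_space \<Rightarrow> ('m, 'e) tvec) \<Rightarrow>
    ('m \<Rightarrow> ('m, 'e) tvec) \<Rightarrow> bool" where
  "C2_sds \<A> X A \<longleftrightarrow>
     (\<forall>e. Ck_vector_field 2 \<A> (\<lambda>x. X x e)) \<and> (\<forall>x c. linear (\<lambda>e. X x e c)) \<and>
     Ck_vector_field 2 \<A> A"

text \<open>
  \<open>y\<close> is meaningful only before the explosion time \<open>\<zeta>\<close>. The equation
  \<open>dy = X(y) \<circ> dB + A(y) dt\<close> is tested on smooth functions of compact support, which are extended by 0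
  to the cemetery state in which \<open>y\<close> is thought to rest from time \<open>\<zeta>\<close> on. Maximality is the requirement
  that \<open>y\<close> leaves every compact set as \<open>t\<close> increases to a finite \<open>\<zeta>\<close>; it also makes these extensions
  continuous in time.
\<close>

definition maximal_solution ::
  "('m::topological_space, 'e::euclidean_space) chart set \<Rightarrow>
    'w measure \<Rightarrow> (real \<Rightarrow> 'w measure) \<Rightarrow> (real \<Rightarrow> 'w \<Rightarrow> 'b::euclidean_space) \<Rightarrow>
    ('m \<Rightarrow> 'b \<Rightarrow> ('m, 'e) tvec) \<Rightarrow> ('m \<Rightarrow> ('m, 'e) tvec) \<Rightarrow>
    'm \<Rightarrow> (real \<Rightarrow> 'w \<Rightarrow> 'm) \<Rightarrow> ('w \<Rightarrow> ereal) \<Rightarrow> bool" where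
  "maximal_solution \<A> P \<F> B X A x y \<zeta> \<longleftrightarrow>
     (AE \<omega> in P. 0 < \<zeta> \<omega> \<and> y 0 \<omega> = x \<and>
        continuous_on {t. 0 \<le> t \<and> ereal t < \<zeta> \<omega>} (\<lambda>t. y t \<omega>) \<and>
        (\<zeta> \<omega> < \<infinity> \<longrightarrow> (\<forall>K. compact K \<longrightarrow> (\<forall>\<^sub>F t in at_left (real_of_ereal (\<zeta> \<omega>)). y t \<omega> \<notin> K)))) \<and>
     (\<forall>t\<ge>0. \<forall>U. open U \<longrightarrow> {\<omega> \<in> space P. ereal t < \<zeta> \<omega> \<and> y t \<omega> \<in> U} \<in> sets (\<F> t)) \<and>
     (\<forall>f K. Ck_map \<infinity> \<A> euclidean_atlas UNIV f \<and> compact K \<and> (\<forall>z. z \<notin> K \<longrightarrow> f z = 0) \<longrightarrow>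
        (let ext = (\<lambda>(h :: 'm \<Rightarrow> real) s \<omega>. if ereal s < \<zeta> \<omega> then h (y s \<omega>) else 0) in
         \<forall>t\<ge>0. \<exists>I.
           (\<forall>e\<in>Basis. stratonovich_integral P (ext (\<lambda>z. derive_along \<A> z (X z e) f))
                         (\<lambda>s \<omega>. B s \<omega> \<bullet> e) t (I e)) \<and>
           (AE \<omega> in P. ext f t \<omega> = f x + (\<Sum>e\<in>Basis. I e \<omega>)
                         + integral {0..t} (\<lambda>s. ext (\<lambda>z. derive_along \<A> z (A z) f) s \<omega>))))"

text \<open>
  The last conjunct is continuity of \<open>s \<mapsto> F s \<sqdot> \<omega>\<close> from \<open>[0,t]\<close> into the C^1 maps on the open set
  \<open>{x. t < \<xi> x \<omega>}\<close> with the topology of locally uniform convergence of the map and its first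
  derivative, written as joint continuity of both in time and space.
\<close>

definition partial_C1_flow ::
  "('m::topological_space, 'e::euclidean_space) chart set \<Rightarrow>
    'w measure \<Rightarrow> (real \<Rightarrow> 'm \<Rightarrow> 'w \<Rightarrow> 'm) \<Rightarrow> ('m \<Rightarrow> 'w \<Rightarrow> ereal) \<Rightarrow> bool" where
  "partial_C1_flow \<A> P F \<xi> \<longleftrightarrow> (AE \<omega> in P.
     (\<forall>x. 0 < \<xi> x \<omega> \<and> F 0 x \<omega> = x) \<and>
     (\<forall>t\<ge>0. Ck_diffeo_onto_open_image 1 \<A> \<A> {x. ereal t < \<xi> x \<omega>} (\<lambda>x. F t x \<omega>)) \<and>
     continuous_on {(s, x). 0 \<le> s \<and> ereal s < \<xi> x \<omega>} (\<lambda>(s, x). F s x \<omega>) \<and>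
     (\<forall>c\<in>\<A>. \<forall>d\<in>\<A>. \<forall>u.
        continuous_on
          {(s, z). 0 \<le> s \<and> z \<in> cran c \<and> ereal s < \<xi> (cinv c z) \<omega> \<and> F s (cinv c z) \<omega> \<in> cdom d}
          (\<lambda>(s, z). frechet_derivative (cmap d \<circ> (\<lambda>x. F s x \<omega>) \<circ> cinv c) (at z) u)))"

definition solution_flow ::
  "('m::topological_space, 'e::euclidean_space) chart set \<Rightarrow>
    'w measure \<Rightarrow> (real \<Rightarrow> 'w measure) \<Rightarrow> (real \<Rightarrow> 'w \<Rightarrow> 'b::euclidean_space) \<Rightarrow>
    ('m \<Rightarrow> 'b \<Rightarrow> ('m, 'e) tvec) \<Rightarrow> ('m \<Rightarrow> ('m, 'e) tvec) \<Rightarrow>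
    (real \<Rightarrow> 'm \<Rightarrow> 'w \<Rightarrow> 'm) \<Rightarrow> ('m \<Rightarrow> 'w \<Rightarrow> ereal) \<Rightarrow> bool" where
  "solution_flow \<A> P \<F> B X A F \<xi> \<longleftrightarrow>
     (\<forall>x. maximal_solution \<A> P \<F> B X A x (\<lambda>t. F t x) (\<xi> x)) \<and> partial_C1_flow \<A> P F \<xi>"

text \<open>The standard 1-simplex is identified with \<open>[0,1]\<close>.\<close>

definition smooth_1_simplex_image ::
  "('m::topological_space, 'e::euclidean_space) chart set \<Rightarrow> 'm set \<Rightarrow> bool" where
  "smooth_1_simplex_image \<A> K \<longleftrightarrow>
     (\<exists>(U :: real set) \<sigma>. open U \<and> {0..1} \<subseteq> U \<and> Ck_map \<infinity> euclidean_atlas \<A> U \<sigma> \<and> K = \<sigma> ` {0..1})"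

definition strongly_1_complete ::
  "('m::topological_space, 'e::euclidean_space) chart set \<Rightarrow> 'w measure \<Rightarrow>
    ('m \<Rightarrow> 'w \<Rightarrow> ereal) \<Rightarrow> bool" where
  "strongly_1_complete \<A> P \<xi> \<longleftrightarrow>
     (\<forall>K. smooth_1_simplex_image \<A> K \<longrightarrow> (AE \<omega> in P. (INF x\<in>K. \<xi> x \<omega>) = \<infinity>))"

text \<open>\<open>E|T\<^sub>x F\<^sub>t|\<close>, the expectation being taken over the event \<open>t < \<xi> x\<close> on which the norm is defined.\<close>

definition expected_derivative_norm ::
  "('m, 'e::euclidean_space) chart set \<Rightarrow> ('m \<Rightarrow> ('m, 'e) tvec \<Rightarrow> ('m, 'e) tvec \<Rightarrow> real) \<Rightarrow>
    'w measure \<Rightarrow> (real \<Rightarrow> 'm \<Rightarrow> 'w \<Rightarrow> 'm) \<Rightarrow> ('m \<Rightarrow> 'w \<Rightarrow> ereal) \<Rightarrow> real \<Rightarrow> 'm \<Rightarrow> ennreal" where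
  "expected_derivative_norm \<A> g P F \<xi> t x =
     (\<integral>\<^sup>+ \<omega>. (if ereal t < \<xi> x \<omega>
              then tangent_op_norm \<A> g x (F t x \<omega>) (tangent_map \<A> (\<lambda>z. F t z \<omega>) x) else 0) \<partial>P)"


section \<open>The fundamental group\<close>

definition loop_homotopy :: "((real \<Rightarrow> 'm::topological_space) \<times> (real \<Rightarrow> 'm)) set" where
  "loop_homotopy = {(p, q). homotopic_paths UNIV p q}"

definition fundamental_group :: "'m::topological_space \<Rightarrow> (real \<Rightarrow> 'm) set monoid" where
  "fundamental_group x =
     \<lparr>carrier = {p. path p \<and> pathstart p = x \<and> pathfinish p = x} // loop_homotopy,
      monoid.mult = (\<lambda>a b. loop_homotopy `` {p +++ q | p q. p \<in> a \<and> q \<in> b}),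
      one = loop_homotopy `` {\<lambda>_. x}\<rparr>"

end

theory Submission
  imports Defs
begin

text \<open>
  A loop is homotopic to a piecewise smooth one, and by strong 1-completeness the flow \<open>F\<^sub>t\<close> carries that loop
  by a free homotopy, almost surely, to a loop of length at most \<open>\<integral> |TF\<^sub>t| |\<sigma>'|\<close>. The expectation of this length
  tends to 0, so for some \<open>t\<close> and \<open>\<omega>\<close> the length is smaller than \<open>c\<close>. By the Gauss lemma a curve shorter than
  the injectivity radius does not leave the normal ball about its starting point. The transported loop therefore
  lies in the diffeomorphic image of a star-shaped set and can be contracted.
\<close>

section \<open>Calculus of maps of class C^k\<close>

text \<open>The transported loop may drift to infinity as t grows, so no compactness argument
  controls the geometry near it; a bound on the injectivity radius that holds at all points is what
  makes a small length sufficient. One time and one sample point are enough, so the mean enters only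
  through the fact that a random variable with mean below c takes values below c. No Riemannian
  distance is set up: shortness of a piecewise smooth curve is expressed by how far it can advance
  inside normal balls (\<open>confined\<close>), a property that adds up along concatenations. Three
  obstacles shape the rest. The exponential map is a definite description, so identifying its radial
  lines with geodesics rests on a uniqueness theorem for geodesics. The length is an integral over
  the parameter of a random speed; Riemann sums and Fatou's lemma take the place of joint
  measurability in parameter and sample point. The contraction moves the base point, so a free null
  homotopy has to be converted into one with fixed end points.\<close>

lemma Ck_on_imp_C_nat_on: "Ck_on k S f \<Longrightarrow> enat n \<le> k \<Longrightarrow> C_nat_on n S f"
  by (simp add: Ck_on_def)

text \<open>Openness of S lets equality on S pass to the derivatives, which are those of total
  functions. By this device a derivative computed by hand replaces the formal one in the inductions
  below.\<close>

lemma C_nat_on_cong: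
  assumes "open S" "\<And>x. x \<in> S \<Longrightarrow> f x = g x" "C_nat_on n S f"
  shows "C_nat_on n S g"
  using assms(2,3)
proof (induction n arbitrary: f g)
  case 0
  then show ?case by (auto cong: continuous_on_cong)
next
  case (Suc n)
  have d: "(g has_derivative frechet_derivative f (at x)) (at x)" if "x \<in> S" for x
    using Suc.prems that has_derivative_transform_within_open[OF _ \<open>open S\<close> that, of f _ UNIV g]
    by (auto simp: frechet_derivative_works)
  have "frechet_derivative f (at x) v = frechet_derivative g (at x) v" if "x \<in> S" for x v
    using frechet_derivative_at[OF d[OF that]] by simp
  then have "C_nat_on n S (\<lambda>x. frechet_derivative g (at x) v)" for v
    using Suc.IH[of "\<lambda>x. frechet_derivative f (at x) v"] Suc.prems by auto
  with d show ?case by (auto simp: differentiable_def)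
qed

lemma C_nat_on_subset: "C_nat_on n T f \<Longrightarrow> S \<subseteq> T \<Longrightarrow> C_nat_on n S f"
  by (induction n arbitrary: f) (auto intro: continuous_on_subset)

lemma C_nat_on_SucD: "C_nat_on (Suc n) S f \<Longrightarrow> C_nat_on n S f"
proof (induction n arbitrary: f)
  case 0
  then show ?case
    using differentiable_imp_continuous_within differentiable_at_withinI
    by (simp add: continuous_on_eq_continuous_within) blast
next
  case (Suc n)
  then show ?case by (metis C_nat_on.simps(2))
qed

lemma C_nat_on_mono: "C_nat_on n S f \<Longrightarrow> m \<le> n \<Longrightarrow> C_nat_on m S f"
  by (induction n) (use C_nat_on_SucD le_Suc_eq in blast)+

lemma C_nat_on_has_derivative:
  assumes "C_nat_on (Suc n) S f" "x \<in> S"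
  shows "(f has_derivative frechet_derivative f (at x)) (at x)"
  using assms by (auto simp: frechet_derivative_works)

lemma frechet_derivative_eqI:
  "(f has_derivative f') (at x) \<Longrightarrow> frechet_derivative f (at x) v = f' v"
  using frechet_derivative_at by metis

text \<open>The inner derivative is constant, so the induction hypothesis applies to the derivative
  in the fixed direction \<open>A v\<close> and no higher chain rule arises. Straight segments in
  charts are smooth of every order for this reason.\<close>

lemma C_nat_on_compose_affine:
  assumes "open S" "bounded_linear A" "C_nat_on n S f"
  shows "C_nat_on n ((\<lambda>x. A x + b) -` S) (\<lambda>x. f (A x + b))"
  using assms(3)
proof (induction n arbitrary: f)
  case 0
  then show ?case
    by (auto intro!: continuous_on_compose2[of S f] continuous_intros
        bounded_linear.continuous_on[OF assms(2)])
next
  case (Suc n)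
  let ?T = "(\<lambda>x. A x + b) -` S"
  have cA: "continuous_on UNIV (\<lambda>x. A x + b)"
    by (intro continuous_intros bounded_linear.continuous_on[OF assms(2)])
  have oT: "open ?T"
    using assms(1) cA open_vimage by blast
  have d: "((\<lambda>x. f (A x + b)) has_derivative (\<lambda>v. frechet_derivative f (at (A x + b)) (A v))) (at x)"
    if "x \<in> ?T" for x
  proof -
    have "((\<lambda>x. A x + b) has_derivative A) (at x)"
      by (auto intro!: derivative_eq_intros bounded_linear_imp_has_derivative assms(2))
    then show ?thesis
      using C_nat_on_has_derivative[OF Suc.prems, of "A x + b"] that
      by (auto intro: has_derivative_compose)
  qed
  have "C_nat_on n ?T (\<lambda>x. frechet_derivative (\<lambda>x. f (A x + b)) (at x) v)" for v
    by (rule C_nat_on_cong[OF oT _ Suc.IH[of "\<lambda>y. frechet_derivative f (at y) (A v)"]])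
       (use Suc.prems frechet_derivative_eqI[OF d] in auto)
  with d show ?case by (auto simp: differentiable_def)
qed

lemma C_nat_on_bounded_linear_image:
  assumes "open S" "bounded_linear L" "C_nat_on n S f"
  shows "C_nat_on n S (\<lambda>x. L (f x))"
  using assms(3)
proof (induction n arbitrary: f)
  case 0
  then show ?case by (auto intro!: bounded_linear.continuous_on[OF assms(2)])
next
  case (Suc n)
  have d: "((\<lambda>x. L (f x)) has_derivative (\<lambda>v. L (frechet_derivative f (at x) v))) (at x)"
    if "x \<in> S" for x
    using C_nat_on_has_derivative[OF Suc.prems that] bounded_linear.has_derivative[OF assms(2)] by blast
  have "C_nat_on n S (\<lambda>x. frechet_derivative (\<lambda>x. L (f x)) (at x) v)" for v
    by (rule C_nat_on_cong[OF assms(1) _ Suc.IH[of "\<lambda>y. frechet_derivative f (at y) v"]])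
       (use Suc.prems frechet_derivative_eqI[OF d] in auto)
  with d show ?case by (auto simp: differentiable_def)
qed

lemma has_derivative_basis_expansion:
  fixes f' :: "'a::euclidean_space \<Rightarrow> 'b::real_normed_vector"
  assumes "(f has_derivative f') F"
  shows "f' v = (\<Sum>i\<in>Basis. (v \<bullet> i) *\<^sub>R f' i)"
proof -
  interpret bounded_linear f' using assms by (rule has_derivative_bounded_linear)
  have "f' (\<Sum>i\<in>Basis. (v \<bullet> i) *\<^sub>R i) = (\<Sum>i\<in>Basis. (v \<bullet> i) *\<^sub>R f' i)"
    by (simp add: sum scale)
  then show ?thesis by (simp add: euclidean_representation)
qed

lemma C1_compose_frechet_derivative:
  assumes "C_nat_on (Suc 0) S f" "C_nat_on (Suc 0) T h" "f x \<in> T" "x \<in> S"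
  shows "((\<lambda>x. h (f x)) has_derivative
    (\<lambda>v. frechet_derivative h (at (f x)) (frechet_derivative f (at x) v))) (at x)"
  using C_nat_on_has_derivative[OF assms(1,4)] C_nat_on_has_derivative[OF assms(2,3)]
  by (rule has_derivative_compose)

text \<open>Finite dimension turns continuity of each directional derivative into continuity along a varying direction.\<close>

lemma continuous_on_frechet_derivative_compose:
  fixes f :: "'a::topological_space \<Rightarrow> 'b::euclidean_space"
  assumes "C_nat_on (Suc 0) T h" "f ` S \<subseteq> T" "continuous_on S f" "continuous_on S w"
  shows "continuous_on S (\<lambda>x. frechet_derivative h (at (f x)) (w x))"
proof -
  have "continuous_on S (\<lambda>x. \<Sum>i\<in>Basis. (w x \<bullet> i) *\<^sub>R frechet_derivative h (at (f x)) i)"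
    using assms by (intro continuous_intros continuous_on_compose2[of T "\<lambda>y. frechet_derivative h (at y) _" S f]) auto
  then show ?thesis
    by (rule continuous_on_eq)
       (use assms(2) in \<open>auto intro!: has_derivative_basis_expansion[symmetric] C_nat_on_has_derivative[OF assms(1)]\<close>)
qed

text \<open>Order one suffices because the flow maps that are composed with curves are themselves
  only C^1.\<close>

lemma C1_compose:
  fixes f :: "'a::real_normed_vector \<Rightarrow> 'b::euclidean_space"
  assumes "C_nat_on (Suc 0) S f" "C_nat_on (Suc 0) T h" "f ` S \<subseteq> T"
  shows "C_nat_on (Suc 0) S (\<lambda>x. h (f x))"
proof -
  have d: "((\<lambda>x. h (f x)) has_derivative
    (\<lambda>v. frechet_derivative h (at (f x)) (frechet_derivative f (at x) v))) (at x)" if "x \<in> S" for x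
    using C1_compose_frechet_derivative[OF assms(1,2)] assms(3) that by blast
  have "continuous_on S (\<lambda>x. frechet_derivative (\<lambda>x. h (f x)) (at x) v)" for v
    by (rule continuous_on_eq[OF continuous_on_frechet_derivative_compose
          [OF assms(2,3), where w = "\<lambda>x. frechet_derivative f (at x) v"]])
       (use assms(1) C_nat_on_SucD[OF assms(1)] frechet_derivative_eqI[OF d] in auto)
  with d show ?thesis by (auto simp: differentiable_def)
qed

lemma C1_on_compact_bounds:
  fixes f :: "'a::euclidean_space \<Rightarrow> 'b::real_normed_vector"
  assumes f: "C_nat_on (Suc 0) S f" and K: "compact K" "convex K" "K \<subseteq> S"
  obtains L where "0 \<le> L"
    "\<And>x v. x \<in> K \<Longrightarrow> norm (frechet_derivative f (at x) v) \<le> L * norm v"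
    "\<And>x y. x \<in> K \<Longrightarrow> y \<in> K \<Longrightarrow> norm (f x - f y) \<le> L * norm (x - y)"
    "\<And>x. x \<in> K \<Longrightarrow> norm (f x) \<le> L"
proof -
  have "\<exists>C. \<forall>x\<in>K. norm (frechet_derivative f (at x) i) \<le> C" for i
  proof -
    have "compact ((\<lambda>x. frechet_derivative f (at x) i) ` K)"
      using f K by (intro compact_continuous_image) (auto intro: continuous_on_subset)
    then show ?thesis by (auto dest!: compact_imp_bounded simp: bounded_iff)
  qed
  then obtain C where C: "\<And>x i. x \<in> K \<Longrightarrow> norm (frechet_derivative f (at x) i) \<le> C i" by metis
  have "compact (f ` K)"
    using C_nat_on_SucD[OF f] K by (intro compact_continuous_image) (auto intro: continuous_on_subset)
  then have "\<exists>D. \<forall>x\<in>K. norm (f x) \<le> D"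
    by (auto dest!: compact_imp_bounded simp: bounded_iff)
  then obtain D where D: "\<And>x. x \<in> K \<Longrightarrow> norm (f x) \<le> D" by blast
  \<comment> \<open>One constant serves all bounds: the sum controls the derivative, and with it the
    increments on the convex set K, while \<open>\<bar>D\<bar>\<close> controls the values.\<close>
  define L where "L = (\<Sum>i\<in>Basis. \<bar>C i\<bar>) + \<bar>D\<bar>"
  have d: "(f has_derivative frechet_derivative f (at x)) (at x)" if "x \<in> K" for x
    using C_nat_on_has_derivative[OF f] that K by blast
  have b: "norm (frechet_derivative f (at x) v) \<le> L * norm v" if "x \<in> K" for x v
  proof -
    have "norm (frechet_derivative f (at x) v) \<le> (\<Sum>i\<in>Basis. norm ((v \<bullet> i) *\<^sub>R frechet_derivative f (at x) i))"
      by (subst has_derivative_basis_expansion[OF d[OF that]]) (rule norm_sum)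
    also have "\<dots> \<le> (\<Sum>i\<in>Basis. norm v * \<bar>C i\<bar>)"
      using C[OF that] by (intro sum_mono) (auto intro!: mult_mono Basis_le_norm abs_ge_self[THEN order_trans[rotated]])
    also have "\<dots> \<le> L * norm v"
      by (simp add: L_def sum_distrib_left[symmetric] algebra_simps)
    finally show ?thesis .
  qed
  show ?thesis
  proof (rule that[of L])
    show "0 \<le> L" by (auto simp: L_def intro!: sum_nonneg add_nonneg_nonneg)
    show "norm (f x - f y) \<le> L * norm (x - y)" if "x \<in> K" "y \<in> K" for x y
      by (rule differentiable_bound[OF K(2) has_derivative_at_withinI[OF d] onorm_le that])
         (use b in auto)
    show "norm (f x) \<le> L" if "x \<in> K" for x
    proof -
      have "0 \<le> (\<Sum>i\<in>Basis. \<bar>C i\<bar>)" by (auto intro: sum_nonneg)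
      then show ?thesis using D[OF that] unfolding L_def by linarith
    qed
  qed (use b in auto)
qed

section \<open>Derivatives along lines and symmetry of second derivatives\<close>

lemma has_real_derivative_along_line:
  assumes "(f has_derivative f') (at (y + s *\<^sub>R w))"
  shows "((\<lambda>s. f (y + s *\<^sub>R w)) has_vector_derivative f' w) (at s)"
proof -
  have 1: "((\<lambda>s. y + s *\<^sub>R w) has_derivative (\<lambda>h. h *\<^sub>R w)) (at s)"
    by (auto intro!: derivative_eq_intros)
  have 2: "((\<lambda>s. f (y + s *\<^sub>R w)) has_derivative (\<lambda>h. f' (h *\<^sub>R w))) (at s)"
    by (rule has_derivative_compose[OF 1 assms])
  show ?thesis
    using 2 linear.scaleR[OF bounded_linear.linear[OF has_derivative_bounded_linear[OF assms]]]
    by (simp add: has_vector_derivative_def)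
qed

text \<open>The mean value theorem is applied along w to the increment in direction b, and along b
  to the derivative in direction w. The second difference is symmetric in w and b, which is what
  forces the mixed derivatives to agree.\<close>

lemma second_difference_mean_value:
  fixes f :: "'a::real_normed_vector \<Rightarrow> real"
  assumes f: "C_nat_on 2 S f" and t: "0 < t"
    and S: "\<And>\<sigma> \<tau>. \<sigma> \<in> {0..t} \<Longrightarrow> \<tau> \<in> {0..t} \<Longrightarrow> y + \<sigma> *\<^sub>R w + \<tau> *\<^sub>R b \<in> S"
  shows "\<exists>\<sigma>\<in>{0..t}. \<exists>\<tau>\<in>{0..t}. f (y + t *\<^sub>R w + t *\<^sub>R b) - f (y + t *\<^sub>R w) - f (y + t *\<^sub>R b) + f y
    = t * t * frechet_derivative (\<lambda>x. frechet_derivative f (at x) w) (at (y + \<sigma> *\<^sub>R w + \<tau> *\<^sub>R b)) b"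
proof -
  have f1: "C_nat_on (Suc (Suc 0)) S f" using f by (simp add: numeral_2_eq_2)
  let ?D = "\<lambda>x. frechet_derivative f (at x) w"
  let ?\<phi> = "\<lambda>\<sigma>. f (y + \<sigma> *\<^sub>R w + t *\<^sub>R b) - f (y + \<sigma> *\<^sub>R w)"
  have f2: "C_nat_on (Suc 0) S ?D" using f1 by auto
  have d1: "((\<lambda>\<sigma>. f (z + \<sigma> *\<^sub>R w)) has_real_derivative ?D (z + \<sigma> *\<^sub>R w)) (at \<sigma>)"
    if "z + \<sigma> *\<^sub>R w \<in> S" for z \<sigma>
    using has_real_derivative_along_line[OF C_nat_on_has_derivative[OF f1 that]]
    by (simp add: has_real_derivative_iff_has_vector_derivative)
  have D1: "(?\<phi> has_real_derivative ?D (y + \<sigma> *\<^sub>R w + t *\<^sub>R b) - ?D (y + \<sigma> *\<^sub>R w)) (at \<sigma>)"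
    if "0 \<le> \<sigma>" "\<sigma> \<le> t" for \<sigma>
    using d1[of "y + t *\<^sub>R b" \<sigma>] d1[of y \<sigma>] S[of \<sigma> t] S[of \<sigma> 0] that t
    by (auto intro!: derivative_eq_intros simp: algebra_simps)
  then obtain \<sigma> where \<sigma>: "0 < \<sigma>" "\<sigma> < t"
    "?\<phi> t - ?\<phi> 0 = (t - 0) * (?D (y + \<sigma> *\<^sub>R w + t *\<^sub>R b) - ?D (y + \<sigma> *\<^sub>R w))"
    using MVT2[OF t D1] by auto
  have D2: "((\<lambda>\<tau>. ?D ((y + \<sigma> *\<^sub>R w) + \<tau> *\<^sub>R b)) has_real_derivative
      frechet_derivative ?D (at (y + \<sigma> *\<^sub>R w + \<tau> *\<^sub>R b)) b) (at \<tau>)" if "0 \<le> \<tau>" "\<tau> \<le> t" for \<tau>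
    using has_real_derivative_along_line[OF C_nat_on_has_derivative[OF f2], of "y + \<sigma> *\<^sub>R w" \<tau> b] S[of \<sigma> \<tau>] that \<sigma>
    by (simp add: has_real_derivative_iff_has_vector_derivative)
  then obtain \<tau> where \<tau>: "0 < \<tau>" "\<tau> < t"
    "?D (y + \<sigma> *\<^sub>R w + t *\<^sub>R b) - ?D (y + \<sigma> *\<^sub>R w + 0 *\<^sub>R b)
      = (t - 0) * frechet_derivative ?D (at (y + \<sigma> *\<^sub>R w + \<tau> *\<^sub>R b)) b"
    using MVT2[OF t D2] by auto
  have "f (y + t *\<^sub>R w + t *\<^sub>R b) - f (y + t *\<^sub>R w) - f (y + t *\<^sub>R b) + f y = ?\<phi> t - ?\<phi> 0" by simp
  also have "\<dots> = t * t * frechet_derivative ?D (at (y + \<sigma> *\<^sub>R w + \<tau> *\<^sub>R b)) b"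
    using \<sigma>(3) \<tau>(3) by simp
  finally show ?thesis using \<sigma> \<tau> by (intro bexI[of _ \<sigma>] bexI[of _ \<tau>]) auto
qed

lemma second_derivative_symmetric_real:
  fixes f :: "'a::real_normed_vector \<Rightarrow> real"
  assumes f: "C_nat_on 2 S f" and S: "open S" "y \<in> S"
  shows "frechet_derivative (\<lambda>x. frechet_derivative f (at x) w) (at y) b
       = frechet_derivative (\<lambda>x. frechet_derivative f (at x) b) (at y) w"
proof -
  let ?P = "\<lambda>w b x. frechet_derivative (\<lambda>x. frechet_derivative f (at x) w) (at x) b"
  have f1: "C_nat_on (Suc (Suc 0)) S f" using f by (simp add: numeral_2_eq_2)
  have cont: "(?P w b \<longlongrightarrow> ?P w b y) (nhds y)" for w b
  proof -
    have "isCont (?P w b) y" using f1 S by (auto simp: continuous_on_eq_continuous_at)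
    then show ?thesis using tendsto_at_iff_tendsto_nhds[of "?P w b" y] by (simp add: isCont_def)
  qed
  have "\<bar>?P w b y - ?P b w y\<bar> \<le> 2 * e" if "0 < e" for e
  proof -
    have ev: "\<forall>\<^sub>F x in nhds y. \<bar>?P w b x - ?P w b y\<bar> < e \<and> \<bar>?P b w x - ?P b w y\<bar> < e \<and> x \<in> S"
      using tendstoD[OF cont[of w b] \<open>0 < e\<close>]
        tendstoD[OF cont[of b w] \<open>0 < e\<close>]
        eventually_nhds_in_open[OF S]
      by (simp add: eventually_conj_iff dist_real_def)
    then obtain \<delta> where \<delta>: "0 < \<delta>"
      "\<And>x. dist x y < \<delta> \<Longrightarrow> \<bar>?P w b x - ?P w b y\<bar> < e \<and> \<bar>?P b w x - ?P b w y\<bar> < e \<and> x \<in> S"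
      by (auto simp: eventually_nhds_metric)
    \<comment> \<open>The summand 1 keeps the divisor positive when w and b both vanish.\<close>
    define N where "N = norm w + norm b + 1"
    have N: "0 < N" by (simp add: N_def add_nonneg_pos)
    define t where "t = \<delta> / N / 2"
    have t: "0 < t" using \<delta>(1) N by (simp add: t_def)
    have tb: "t * (norm w + norm b) < \<delta>"
    proof -
      have "t * (norm w + norm b) \<le> t * N" using t by (simp add: N_def)
      also have "\<dots> = \<delta> / 2" using N by (simp add: t_def)
      finally show ?thesis using \<delta>(1) by simp
    qed
    have near: "dist (y + \<sigma> *\<^sub>R u + \<tau> *\<^sub>R v) y < \<delta>"
      if "\<sigma> \<in> {0..t}" "\<tau> \<in> {0..t}" "norm u + norm v = norm w + norm b" for \<sigma> \<tau> u v
    proof -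
      have "dist (y + \<sigma> *\<^sub>R u + \<tau> *\<^sub>R v) y \<le> norm (\<sigma> *\<^sub>R u) + norm (\<tau> *\<^sub>R v)"
        using norm_triangle_ineq[of "\<sigma> *\<^sub>R u" "\<tau> *\<^sub>R v"] by (simp add: dist_norm)
      also have "\<dots> \<le> t * norm u + t * norm v"
        using that by (auto intro!: add_mono mult_right_mono)
      also have "\<dots> = t * (norm w + norm b)" using that by (simp add: distrib_left[symmetric])
      finally show ?thesis using tb by simp
    qed
    obtain \<sigma> \<tau> where 1: "\<sigma> \<in> {0..t}" "\<tau> \<in> {0..t}"
      "f (y + t *\<^sub>R w + t *\<^sub>R b) - f (y + t *\<^sub>R w) - f (y + t *\<^sub>R b) + f y = t * t * ?P w b (y + \<sigma> *\<^sub>R w + \<tau> *\<^sub>R b)"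
      using second_difference_mean_value[OF f t, of y w b] near[of _ _ w b] \<delta>(2) by blast
    obtain \<sigma>' \<tau>' where 2: "\<sigma>' \<in> {0..t}" "\<tau>' \<in> {0..t}"
      "f (y + t *\<^sub>R b + t *\<^sub>R w) - f (y + t *\<^sub>R b) - f (y + t *\<^sub>R w) + f y = t * t * ?P b w (y + \<sigma>' *\<^sub>R b + \<tau>' *\<^sub>R w)"
      using second_difference_mean_value[OF f t, of y b w] near[of _ _ b w] \<delta>(2)
      by (auto simp: add.commute)
    have eq: "?P w b (y + \<sigma> *\<^sub>R w + \<tau> *\<^sub>R b) = ?P b w (y + \<sigma>' *\<^sub>R b + \<tau>' *\<^sub>R w)"
    proof -
      have "t * t * ?P w b (y + \<sigma> *\<^sub>R w + \<tau> *\<^sub>R b) = t * t * ?P b w (y + \<sigma>' *\<^sub>R b + \<tau>' *\<^sub>R w)"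
      proof -
        have comm: "y + t *\<^sub>R b + t *\<^sub>R w = y + t *\<^sub>R w + t *\<^sub>R b" by (simp add: add_ac)
        show ?thesis using 1(3) 2(3) unfolding comm by linarith
      qed
      then show ?thesis using t by simp
    qed
    show ?thesis
      using \<delta>(2)[OF near[OF 1(1,2), of w b]] \<delta>(2)[OF near[OF 2(1,2), of b w]] eq by auto
  qed
  \<comment> \<open>With e a quarter of the gap the estimate reads gap <= gap / 2, so the gap is
    0.\<close>
  from this[of "\<bar>?P w b y - ?P b w y\<bar> / 4"] show ?thesis by (cases "?P w b y = ?P b w y") auto
qed

lemma second_derivative_symmetric:
  fixes f :: "'a::real_normed_vector \<Rightarrow> 'b::euclidean_space"
  assumes f: "C_nat_on 2 S f" and S: "open S" "y \<in> S"
  shows "frechet_derivative (\<lambda>x. frechet_derivative f (at x) w) (at y) b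
       = frechet_derivative (\<lambda>x. frechet_derivative f (at x) b) (at y) w"
proof (rule euclidean_eqI)
  fix i :: 'b assume "i \<in> Basis"
  have f1: "C_nat_on (Suc (Suc 0)) S f" using f by (simp add: numeral_2_eq_2)
  have fi: "C_nat_on 2 S (\<lambda>x. f x \<bullet> i)"
    by (rule C_nat_on_bounded_linear_image[OF S(1) bounded_linear_inner_left f])
  have d1: "frechet_derivative (\<lambda>x. f x \<bullet> i) (at x) v = frechet_derivative f (at x) v \<bullet> i"
    if "x \<in> S" for x v
    using C_nat_on_has_derivative[OF f1 that]
    by (intro frechet_derivative_eqI) (auto intro!: derivative_eq_intros)
  have d2: "frechet_derivative (\<lambda>x. frechet_derivative (\<lambda>x. f x \<bullet> i) (at x) v) (at y) u
     = frechet_derivative (\<lambda>x. frechet_derivative f (at x) v) (at y) u \<bullet> i" for u v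
  proof (rule frechet_derivative_eqI)
    have "((\<lambda>x. frechet_derivative f (at x) v) has_derivative
       frechet_derivative (\<lambda>x. frechet_derivative f (at x) v) (at y)) (at y)"
      using f1 S(2) by (auto intro!: C_nat_on_has_derivative[of 0 S])
    then have "((\<lambda>x. frechet_derivative f (at x) v \<bullet> i) has_derivative
       (\<lambda>u. frechet_derivative (\<lambda>x. frechet_derivative f (at x) v) (at y) u \<bullet> i)) (at y)"
      by (auto intro!: derivative_eq_intros)
    then show "((\<lambda>x. frechet_derivative (\<lambda>x. f x \<bullet> i) (at x) v) has_derivative
       (\<lambda>u. frechet_derivative (\<lambda>x. frechet_derivative f (at x) v) (at y) u \<bullet> i)) (at y)"
      by (rule has_derivative_transform_within_open[OF _ S]) (simp add: d1)
  qed
  show "frechet_derivative (\<lambda>x. frechet_derivative f (at x) w) (at y) b \<bullet> i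
       = frechet_derivative (\<lambda>x. frechet_derivative f (at x) b) (at y) w \<bullet> i"
    using second_derivative_symmetric_real[OF fi S, of w b] by (simp add: d2)
qed

section \<open>A Riemannian metric in a chart\<close>

text \<open>A metric seen in one chart, detached from the manifold and its tangent vectors, so that
  statements on geodesics become estimates on an open subset of Euclidean space. Class C^2 makes the
  first derivatives of the metric Lipschitz on compact convex sets, as the uniqueness argument
  requires.\<close>

locale coord_metric =
  fixes W :: "'e::euclidean_space set" and G :: "'e \<Rightarrow> 'e \<Rightarrow> 'e \<Rightarrow> real"
  assumes open_W: "open W"
    and G_bilinear: "y \<in> W \<Longrightarrow> bilinear (G y)"
    and G_sym: "y \<in> W \<Longrightarrow> G y u v = G y v u"
    and G_pos: "y \<in> W \<Longrightarrow> u \<noteq> 0 \<Longrightarrow> 0 < G y u u"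
    and G_smooth: "C_nat_on 2 W (\<lambda>y. G y u v)"
begin

definition dG :: "'e \<Rightarrow> 'e \<Rightarrow> 'e \<Rightarrow> 'e \<Rightarrow> real" where
  "dG y a u v = frechet_derivative (\<lambda>z. G z u v) (at y) a"

text \<open>The Christoffel symbols, given through the linear form that they represent under G. The
  shape agrees with \<open>christoffel\<close>, and \<open>riesz\<close> shows that the description
  is proper.\<close>

definition chris :: "'e \<Rightarrow> 'e \<Rightarrow> 'e \<Rightarrow> 'e" where
  "chris y u v = (THE z. \<forall>w. G y z w = (dG y u v w + dG y v u w - dG y w u v) / 2)"

lemma G_C1: "C_nat_on (Suc 0) W (\<lambda>y. G y u v)"
  by (rule C_nat_on_mono[OF G_smooth]) simp

text \<open>Reduces continuity and differentiability of G along varying arguments to the finitely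
  many coefficient functions \<open>G y i j\<close>, whose regularity is assumed.\<close>

lemma G_expand:
  assumes "y \<in> W"
  shows "G y u v = (\<Sum>i\<in>Basis. \<Sum>j\<in>Basis. (u \<bullet> i) * (v \<bullet> j) * G y i j)"
proof -
  note G_bilinear[OF assms]
  then have "G y (\<Sum>i\<in>Basis. (u \<bullet> i) *\<^sub>R i) (\<Sum>j\<in>Basis. (v \<bullet> j) *\<^sub>R j)
     = (\<Sum>i\<in>Basis. \<Sum>j\<in>Basis. G y ((u \<bullet> i) *\<^sub>R i) ((v \<bullet> j) *\<^sub>R j))"
    by (simp add: bilinear_sum sum.cartesian_product)
  then show ?thesis
    using \<open>bilinear (G y)\<close> by (simp add: euclidean_representation bilinear_lmul bilinear_rmul mult.assoc)
qed

lemma G_linear_right: "y \<in> W \<Longrightarrow> linear (G y u)"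
  using G_bilinear by (auto simp: bilinear_def)

lemma
  assumes "y \<in> W"
  shows G_add_left: "G y (u + u') v = G y u v + G y u' v"
    and G_diff_left: "G y (u - u') v = G y u v - G y u' v"
    and G_minus_left: "G y (- u) v = - G y u v"
    and G_scale_left: "G y (r *\<^sub>R u) v = r * G y u v"
    and G_add_right: "G y u (v + v') = G y u v + G y u v'"
    and G_diff_right: "G y u (v - v') = G y u v - G y u v'"
    and G_scale_right: "G y u (r *\<^sub>R v) = r * G y u v"
  using G_bilinear[OF assms]
  by (simp_all add: bilinear_ladd bilinear_radd bilinear_lsub bilinear_rsub bilinear_lneg
      bilinear_lmul bilinear_rmul)

lemma G_nonneg: "y \<in> W \<Longrightarrow> 0 \<le> G y u u"
  using G_pos[of y u] G_scale_left[of y 0 0 u] by (cases "u = 0") auto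

lemma dG_works: "y \<in> W \<Longrightarrow> ((\<lambda>y. G y u v) has_derivative (\<lambda>a. dG y a u v)) (at y)"
  using C_nat_on_has_derivative[OF G_C1, of y u v] by (simp add: dG_def[abs_def])

lemma dG_expand:
  assumes "y \<in> W"
  shows "dG y a u v = (\<Sum>i\<in>Basis. \<Sum>j\<in>Basis. (u \<bullet> i) * (v \<bullet> j) * dG y a i j)"
proof -
  have "((\<lambda>y. \<Sum>i\<in>Basis. \<Sum>j\<in>Basis. (u \<bullet> i) * (v \<bullet> j) * G y i j) has_derivative
     (\<lambda>a. \<Sum>i\<in>Basis. \<Sum>j\<in>Basis. (u \<bullet> i) * (v \<bullet> j) * dG y a i j)) (at y)"
    by (intro has_derivative_sum has_derivative_mult_right dG_works assms)
  then have "((\<lambda>y. G y u v) has_derivative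
     (\<lambda>a. \<Sum>i\<in>Basis. \<Sum>j\<in>Basis. (u \<bullet> i) * (v \<bullet> j) * dG y a i j)) (at y)"
    by (rule has_derivative_transform_within_open[OF _ open_W assms]) (simp add: G_expand[symmetric])
  then show ?thesis
    unfolding dG_def by (rule frechet_derivative_eqI)
qed

lemma
  assumes "y \<in> W"
  shows dG_linear: "linear (\<lambda>a. dG y a u v)"
    and dG_linear_left: "linear (\<lambda>u. dG y a u v)" and dG_linear_right: "linear (dG y a u)"
proof -
  show "linear (\<lambda>a. dG y a u v)"
    using has_derivative_bounded_linear[OF dG_works[OF assms]] by (rule bounded_linear.linear)
  have "linear (\<lambda>u. \<Sum>i\<in>Basis. \<Sum>j\<in>Basis. (u \<bullet> i) * (v \<bullet> j) * dG y a i j)"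
    by (rule linearI) (simp_all add: inner_add_left sum.distrib sum_distrib_left algebra_simps)
  then show "linear (\<lambda>u. dG y a u v)"
    by (simp only: dG_expand[OF assms, symmetric])
  have "linear (\<lambda>v. \<Sum>i\<in>Basis. \<Sum>j\<in>Basis. (u \<bullet> i) * (v \<bullet> j) * dG y a i j)"
    by (rule linearI) (simp_all add: inner_add_left sum.distrib sum_distrib_left algebra_simps)
  then show "linear (dG y a u)"
    by (simp only: dG_expand[OF assms, symmetric])
qed

lemma
  assumes "y \<in> W"
  shows dG_diff: "dG y (a - a') u v = dG y a u v - dG y a' u v"
    and dG_diff_left: "dG y a (u - u') v = dG y a u v - dG y a u' v"
    and dG_diff_right: "dG y a u (v - v') = dG y a u v - dG y a u v'"
  using linear_diff[OF dG_linear[OF assms]] linear_diff[OF dG_linear_left[OF assms]]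
    linear_diff[OF dG_linear_right[OF assms]] by auto

lemma G_expand_right:
  assumes "y \<in> W" shows "G y u w = (\<Sum>i\<in>Basis. (w \<bullet> i) * G y u i)"
  by (subst euclidean_representation[of w, symmetric])
     (simp only: linear_sum[OF G_linear_right[OF assms]] G_scale_right[OF assms])

text \<open>Positivity makes the linear map that sends z to its coefficients \<open>G y z i\<close>
  injective, hence onto in finite dimension; matching l on the basis then matches it
  everywhere.\<close>

lemma riesz:
  assumes y: "y \<in> W" and l: "linear l"
  shows "\<exists>!z. \<forall>w. G y z w = l w"
proof -
  let ?T = "\<lambda>z. \<Sum>i\<in>Basis. G y z i *\<^sub>R i"
  have linT: "linear ?T"
    by (rule linearI) (simp_all add: G_add_left[OF y] G_scale_left[OF y] scaleR_add_left sum.distrib scaleR_sum_right)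
  have unique: "z = 0" if "\<forall>i\<in>Basis. G y z i = 0" for z
  proof -
    have "G y z z = 0" using that by (subst G_expand_right[OF y]) simp
    then show ?thesis using G_pos[OF y, of z] by force
  qed
  have coord: "?T z \<bullet> i = G y z i" if "i \<in> Basis" for z i
    using that by simp
  have "inj ?T"
    unfolding linear_injective_0[OF linT]
  proof (intro allI impI unique ballI)
    fix z i :: 'e assume "?T z = 0" "i \<in> Basis"
    then show "G y z i = 0" using coord[of i z] by simp
  qed
  with linT have "surj ?T" by (rule linear_injective_imp_surjective) simp
  then obtain z where z: "(\<Sum>i\<in>Basis. l i *\<^sub>R i) = ?T z" by (rule surjE)
  have zi: "G y z i = l i" if "i \<in> Basis" for i
    using coord[OF that, of z] that unfolding z[symmetric] by simp
  have "G y z w = l w" for w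
  proof -
    have "G y z w = (\<Sum>i\<in>Basis. (w \<bullet> i) * G y z i)" by (rule G_expand_right[OF y])
    also have "\<dots> = (\<Sum>i\<in>Basis. (w \<bullet> i) * l i)" using zi by simp
    also have "\<dots> = l w"
      by (subst (2) euclidean_representation[of w, symmetric])
         (simp only: linear_sum[OF l] linear_scale[OF l] real_scaleR_def)
    finally show ?thesis .
  qed
  then show ?thesis
  proof (intro ex1I[of _ z] allI)
    fix z' assume "\<forall>w. G y z' w = l w"
    then have "z' - z = 0" using \<open>\<And>w. G y z w = l w\<close> by (intro unique) (simp add: G_diff_left[OF y])
    then show "z' = z" by simp
  qed
qed

lemma chris_works:
  assumes y: "y \<in> W"
  shows "G y (chris y u v) w = (dG y u v w + dG y v u w - dG y w u v) / 2"
proof -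
  have "linear (\<lambda>w. (dG y u v w + dG y v u w - dG y w u v) / 2)"
    using linear_add[OF dG_linear_right[OF y]] linear_scale[OF dG_linear_right[OF y]]
      linear_add[OF dG_linear[OF y]] linear_scale[OF dG_linear[OF y]]
    by (intro linearI) (simp_all add: field_simps)
  from theI'[OF riesz[OF y this]] show ?thesis unfolding chris_def by blast
qed

lemma chris_same: "y \<in> W \<Longrightarrow> G y (chris y a a) w = dG y a a w - dG y w a a / 2"
  by (simp add: chris_works)

text \<open>The product rule in three slots, obtained from the coefficient expansion. Derivatives
  are taken within J so that the one-sided ones at the ends of a geodesic are covered.\<close>

lemma G_has_vector_derivative:
  assumes q: "(q has_vector_derivative q') (at s within J)"
    and a: "(a has_vector_derivative a') (at s within J)"
    and b: "(b has_vector_derivative b') (at s within J)"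
    and W: "q s \<in> W" and s: "s \<in> J"
  shows "((\<lambda>s. G (q s) (a s) (b s)) has_vector_derivative
     dG (q s) q' (a s) (b s) + G (q s) a' (b s) + G (q s) (a s) b') (at s within J)"
proof -
  have Gq: "((\<lambda>s. G (q s) i j) has_vector_derivative dG (q s) q' i j) (at s within J)" for i j
    using vector_derivative_diff_chain_within[OF q has_derivative_at_withinI[OF dG_works[OF W]]]
    by (simp add: o_def)
  have ai: "((\<lambda>s. a s \<bullet> i) has_vector_derivative a' \<bullet> i) (at s within J)" for i
    by (rule bounded_linear.has_vector_derivative[OF bounded_linear_inner_left a])
  have bi: "((\<lambda>s. b s \<bullet> i) has_vector_derivative b' \<bullet> i) (at s within J)" for i
    by (rule bounded_linear.has_vector_derivative[OF bounded_linear_inner_left b])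
  have "((\<lambda>s. (a s \<bullet> i) * (b s \<bullet> j) * G (q s) i j) has_vector_derivative
     (a s \<bullet> i) * (b s \<bullet> j) * dG (q s) q' i j + (a' \<bullet> i) * (b s \<bullet> j) * G (q s) i j
       + (a s \<bullet> i) * (b' \<bullet> j) * G (q s) i j) (at s within J)" for i j
    using has_vector_derivative_mult[OF has_vector_derivative_mult[OF ai bi] Gq, of i j i j]
    by (simp add: algebra_simps)
  then have "((\<lambda>s. \<Sum>i\<in>Basis. \<Sum>j\<in>Basis. (a s \<bullet> i) * (b s \<bullet> j) * G (q s) i j) has_vector_derivative
     (\<Sum>i\<in>Basis. \<Sum>j\<in>Basis. (a s \<bullet> i) * (b s \<bullet> j) * dG (q s) q' i j + (a' \<bullet> i) * (b s \<bullet> j) * G (q s) i j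
       + (a s \<bullet> i) * (b' \<bullet> j) * G (q s) i j)) (at s within J)"
    by (intro has_vector_derivative_sum)
  also have "(\<Sum>i\<in>Basis. \<Sum>j\<in>Basis. (a s \<bullet> i) * (b s \<bullet> j) * dG (q s) q' i j + (a' \<bullet> i) * (b s \<bullet> j) * G (q s) i j
       + (a s \<bullet> i) * (b' \<bullet> j) * G (q s) i j)
     = dG (q s) q' (a s) (b s) + G (q s) a' (b s) + G (q s) (a s) b'"
    by (simp only: sum.distrib dG_expand[OF W, symmetric] G_expand[OF W, symmetric])
  finally have main: "((\<lambda>s. \<Sum>i\<in>Basis. \<Sum>j\<in>Basis. (a s \<bullet> i) * (b s \<bullet> j) * G (q s) i j) has_vector_derivative
     dG (q s) q' (a s) (b s) + G (q s) a' (b s) + G (q s) (a s) b') (at s within J)" .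
  have "(q \<longlongrightarrow> q s) (at s within J)"
    using has_derivative_continuous[OF q[unfolded has_vector_derivative_def]]
    by (simp add: continuous_within)
  then have "\<forall>\<^sub>F s in at s within J. q s \<in> W"
    by (rule topological_tendstoD[OF _ open_W W])
  then have "\<forall>\<^sub>F s in at s within J. (\<Sum>i\<in>Basis. \<Sum>j\<in>Basis. (a s \<bullet> i) * (b s \<bullet> j) * G (q s) i j) = G (q s) (a s) (b s)"
    by eventually_elim (simp add: G_expand[symmetric])
  from has_derivative_transform_eventually[OF main[unfolded has_vector_derivative_def] this _ s]
  show ?thesis by (simp add: has_vector_derivative_def G_expand[OF W, symmetric])
qed

text \<open>The acceleration is eliminated by Koszul's formula: only derivatives of the metric remain.\<close>

lemma G_along_geodesic:
  assumes "(q has_vector_derivative a s) (at s within J)"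
    and "(a has_vector_derivative - chris (q s) (a s) (a s)) (at s within J)"
    and "(b has_vector_derivative b') (at s within J)" and "q s \<in> W" "s \<in> J"
  shows "((\<lambda>s. G (q s) (a s) (b s)) has_vector_derivative
     dG (q s) (b s) (a s) (a s) / 2 + G (q s) (a s) b') (at s within J)"
  using G_has_vector_derivative[OF assms] assms(4) by (simp add: G_minus_left chris_same)

lemma geodesic_constant_speed:
  assumes "(q has_vector_derivative a s) (at s within J)"
    and "(a has_vector_derivative - chris (q s) (a s) (a s)) (at s within J)" and "q s \<in> W" "s \<in> J"
  shows "((\<lambda>s. G (q s) (a s) (a s)) has_vector_derivative 0) (at s within J)"
proof -
  \<comment> \<open>Testing the acceleration with the velocity itself leaves half of
    \<open>dG (q s) (a s) (a s) (a s)\<close>, which cancels the contribution of the varying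
    metric.\<close>
  have "dG (q s) (a s) (a s) (a s) / 2 + G (q s) (a s) (- chris (q s) (a s) (a s)) = 0"
    by (subst G_sym[OF assms(3)]) (simp add: G_minus_left[OF assms(3)] chris_same[OF assms(3)])
  then show ?thesis using G_along_geodesic[OF assms(1,2,2,3,4)] by simp
qed

lemma continuous_on_G:
  assumes "continuous_on S q" "continuous_on S a" "continuous_on S b" "q ` S \<subseteq> W"
  shows "continuous_on S (\<lambda>s. G (q s) (a s) (b s))"
proof -
  have "continuous_on S (\<lambda>s. G (q s) i j)" for i j
    using C_nat_on_SucD[OF G_C1, of i j]
    by (intro continuous_on_compose2[of W "\<lambda>y. G y i j" S q] assms) simp
  then have "continuous_on S (\<lambda>s. \<Sum>i\<in>Basis. \<Sum>j\<in>Basis. (a s \<bullet> i) * (b s \<bullet> j) * G (q s) i j)"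
    by (intro continuous_intros assms)
  then show ?thesis
    by (rule continuous_on_eq) (use assms(4) in \<open>auto simp: G_expand[symmetric]\<close>)
qed

text \<open>The minimum of G over K times the unit sphere is positive by compactness, and
  homogeneity carries it to all u.\<close>

lemma G_lower_bound:
  assumes "compact K" "K \<subseteq> W"
  obtains l where "0 < l" "\<And>y u. y \<in> K \<Longrightarrow> l * (norm u)\<^sup>2 \<le> G y u u"
proof (cases "K = {}")
  case False
  let ?S = "K \<times> sphere (0::'e) 1"
  have "compact ?S" using assms by (intro compact_Times) auto
  moreover obtain i :: 'e where "i \<in> Basis" using nonempty_Basis by blast
  then have "?S \<noteq> {}" using False by (force intro: norm_Basis)
  moreover have "continuous_on ?S (\<lambda>z. G (fst z) (snd z) (snd z))"
    using assms(2) by (intro continuous_on_G continuous_intros) auto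
  ultimately obtain z where z: "z \<in> ?S" "\<And>x. x \<in> ?S \<Longrightarrow> G (fst z) (snd z) (snd z) \<le> G (fst x) (snd x) (snd x)"
    using continuous_attains_inf[of ?S "\<lambda>z. G (fst z) (snd z) (snd z)"] by blast
  define l where "l = G (fst z) (snd z) (snd z)"
  have "snd z \<noteq> 0" using z(1) by (cases z) auto
  then have "0 < l" using z(1) assms(2) unfolding l_def by (intro G_pos) (auto simp: mem_Times_iff)
  moreover have "l * (norm u)\<^sup>2 \<le> G y u u" if y: "y \<in> K" for y u
  proof (cases "u = 0")
    case False
    have "l \<le> G y (sgn u) (sgn u)"
      using z(2)[of "(y, sgn u)"] y False by (simp add: l_def norm_sgn)
    also have "\<dots> = G y u u / (norm u)\<^sup>2"
      using y assms(2) by (auto simp: sgn_div_norm G_scale_left G_scale_right power2_eq_square field_simps)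
    finally show ?thesis using False by (simp add: field_simps)
  qed (use y assms(2) G_nonneg in auto)
  ultimately show ?thesis using that by blast
qed (use that[of 1] in auto)

lemma bilinear_sum_bound:
  assumes "\<And>i j. i \<in> Basis \<Longrightarrow> j \<in> Basis \<Longrightarrow> \<bar>t i j\<bar> \<le> (c i j :: real)"
  shows "\<bar>\<Sum>i\<in>Basis. \<Sum>j\<in>Basis. ((u::'e) \<bullet> i) * ((v::'e) \<bullet> j) * t i j\<bar>
     \<le> norm u * norm v * (\<Sum>i\<in>Basis. \<Sum>j\<in>Basis. c i j)"
proof -
  have "\<bar>\<Sum>i\<in>Basis. \<Sum>j\<in>Basis. (u \<bullet> i) * (v \<bullet> j) * t i j\<bar>
     \<le> (\<Sum>i\<in>Basis. \<Sum>j\<in>Basis. \<bar>(u \<bullet> i) * (v \<bullet> j) * t i j\<bar>)"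
    by (rule order_trans[OF sum_abs], intro sum_mono sum_abs)
  also have "\<dots> \<le> (\<Sum>i\<in>Basis. \<Sum>j\<in>Basis. norm u * norm v * c i j)"
  proof (intro sum_mono)
    fix i j :: 'e assume ij: "i \<in> Basis" "j \<in> Basis"
    have "\<bar>u \<bullet> i\<bar> * \<bar>v \<bullet> j\<bar> \<le> norm u * norm v"
      by (intro mult_mono Basis_le_norm ij) auto
    then show "\<bar>(u \<bullet> i) * (v \<bullet> j) * t i j\<bar> \<le> norm u * norm v * c i j"
      unfolding abs_mult by (rule mult_mono[OF _ assms[OF ij]]) auto
  qed
  finally show ?thesis by (simp add: sum_distrib_left)
qed

text \<open>A common constant for sizes and Lipschitz increments of G and dG keeps the later
  Gronwall estimate manageable. Convexity of K enters through the mean value theorem.\<close>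

lemma G_bounds:
  assumes K: "compact K" "convex K" "K \<subseteq> W"
  obtains C where "0 \<le> C"
    "\<And>y u v. y \<in> K \<Longrightarrow> \<bar>G y u v\<bar> \<le> C * norm u * norm v"
    "\<And>y a u v. y \<in> K \<Longrightarrow> \<bar>dG y a u v\<bar> \<le> C * norm a * norm u * norm v"
    "\<And>y y' u v. y \<in> K \<Longrightarrow> y' \<in> K \<Longrightarrow> \<bar>G y u v - G y' u v\<bar> \<le> C * norm (y - y') * norm u * norm v"
    "\<And>y y' a u v. y \<in> K \<Longrightarrow> y' \<in> K \<Longrightarrow>
        \<bar>dG y a u v - dG y' a u v\<bar> \<le> C * norm (y - y') * norm a * norm u * norm v"
proof -
  have "\<exists>L. 0 \<le> L \<and> (\<forall>x\<in>K. \<forall>a. \<bar>dG x a i j\<bar> \<le> L * norm a) \<and>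
      (\<forall>x\<in>K. \<forall>y\<in>K. \<bar>G x i j - G y i j\<bar> \<le> L * norm (x - y)) \<and> (\<forall>x\<in>K. \<bar>G x i j\<bar> \<le> L)" for i j
    using C1_on_compact_bounds[OF G_C1 K, of i j] unfolding dG_def real_norm_def by metis
  then obtain L where L: "\<And>i j. 0 \<le> L i j" "\<And>i j x a. x \<in> K \<Longrightarrow> \<bar>dG x a i j\<bar> \<le> L i j * norm a"
    "\<And>i j x y. x \<in> K \<Longrightarrow> y \<in> K \<Longrightarrow> \<bar>G x i j - G y i j\<bar> \<le> L i j * norm (x - y)"
    "\<And>i j x. x \<in> K \<Longrightarrow> \<bar>G x i j\<bar> \<le> L i j" by metis
  have "C_nat_on (Suc 0) W (\<lambda>y. dG y k i j)" for k i j
    using G_smooth[of i j] by (simp add: numeral_2_eq_2 dG_def)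
  from C1_on_compact_bounds[OF this K]
  have "\<exists>L. 0 \<le> L \<and> (\<forall>x\<in>K. \<forall>y\<in>K. \<bar>dG x k i j - dG y k i j\<bar> \<le> L * norm (x - y))" for k i j
    unfolding real_norm_def by metis
  then obtain M where M: "\<And>k i j. 0 \<le> M k i j"
    "\<And>k i j x y. x \<in> K \<Longrightarrow> y \<in> K \<Longrightarrow> \<bar>dG x k i j - dG y k i j\<bar> \<le> M k i j * norm (x - y)" by metis
  \<comment> \<open>The direction a is expanded in the basis, and M' adds up the Lipschitz constants
    of the coefficients \<open>dG y k i j\<close> over k.\<close>
  define M' where "M' i j = (\<Sum>k\<in>Basis. M k i j)" for i j
  have M'0: "0 \<le> M' i j" for i j using M(1) by (auto simp: M'_def intro: sum_nonneg)
  have M': "\<bar>dG x a i j - dG y a i j\<bar> \<le> norm a * norm (x - y) * M' i j" if "x \<in> K" "y \<in> K" for x y a i j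
  proof -
    have eq: "dG x a i j - dG y a i j = (\<Sum>k\<in>Basis. (a \<bullet> k) * (dG x k i j - dG y k i j))"
      using has_derivative_basis_expansion[OF dG_works, of x a i j] has_derivative_basis_expansion[OF dG_works, of y a i j] that K(3)
      by (simp add: subset_iff sum_subtractf right_diff_distrib)
    have "\<bar>dG x a i j - dG y a i j\<bar> \<le> (\<Sum>k\<in>Basis. \<bar>(a \<bullet> k) * (dG x k i j - dG y k i j)\<bar>)"
      unfolding eq by (rule sum_abs)
    also have "\<dots> \<le> (\<Sum>k\<in>Basis. norm a * (M k i j * norm (x - y)))"
      unfolding abs_mult
    proof (rule sum_mono)
      fix k :: 'e assume "k \<in> Basis"
      then show "\<bar>a \<bullet> k\<bar> * \<bar>dG x k i j - dG y k i j\<bar> \<le> norm a * (M k i j * norm (x - y))"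
        by (intro mult_mono[OF Basis_le_norm M(2)[OF that]]) auto
    qed
    finally show ?thesis by (simp add: M'_def sum_distrib_left algebra_simps)
  qed
  define L1 where "L1 = (\<Sum>i\<in>Basis. \<Sum>j\<in>Basis. L i j)"
  define M1 where "M1 = (\<Sum>i\<in>Basis. \<Sum>j\<in>Basis. M' i j)"
  have nn: "0 \<le> L1" "0 \<le> M1" using L(1) M'0 by (auto simp: L1_def M1_def intro!: sum_nonneg)
  have W: "y \<in> W" if "y \<in> K" for y using that K by auto
  show ?thesis
  proof (rule that[of "L1 + M1"])
    show "0 \<le> L1 + M1" using nn by simp
    show "\<bar>G y u v\<bar> \<le> (L1 + M1) * norm u * norm v" if "y \<in> K" for y u v
    proof -
      have "\<bar>G y u v\<bar> \<le> norm u * norm v * L1"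
        unfolding L1_def by (subst G_expand[OF W[OF that]], rule bilinear_sum_bound) (rule L(4)[OF that])
      also have "\<dots> \<le> norm u * norm v * (L1 + M1)" using nn by (intro mult_left_mono) auto
      finally show ?thesis by (simp add: mult_ac)
    qed
    show "\<bar>dG y a u v\<bar> \<le> (L1 + M1) * norm a * norm u * norm v" if "y \<in> K" for y a u v
    proof -
      have "\<bar>dG y a u v\<bar> \<le> norm u * norm v * (\<Sum>i\<in>Basis. \<Sum>j\<in>Basis. L i j * norm a)"
        by (subst dG_expand[OF W[OF that]], rule bilinear_sum_bound) (rule L(2)[OF that])
      also have "\<dots> = norm u * norm v * norm a * L1"
        by (simp add: L1_def sum_distrib_left sum_distrib_right mult_ac)
      also have "\<dots> \<le> norm u * norm v * norm a * (L1 + M1)" using nn by (intro mult_left_mono) auto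
      finally show ?thesis by (simp add: mult_ac)
    qed
    show "\<bar>G y u v - G y' u v\<bar> \<le> (L1 + M1) * norm (y - y') * norm u * norm v" if "y \<in> K" "y' \<in> K" for y y' u v
    proof -
      have eq: "G y u v - G y' u v = (\<Sum>i\<in>Basis. \<Sum>j\<in>Basis. (u \<bullet> i) * (v \<bullet> j) * (G y i j - G y' i j))"
        using G_expand[OF W[OF that(1)], of u v] G_expand[OF W[OF that(2)], of u v]
        by (simp add: sum_subtractf right_diff_distrib)
      have "\<bar>G y u v - G y' u v\<bar> \<le> norm u * norm v * (\<Sum>i\<in>Basis. \<Sum>j\<in>Basis. L i j * norm (y - y'))"
        unfolding eq by (rule bilinear_sum_bound) (rule L(3)[OF that])
      also have "\<dots> = norm u * norm v * norm (y - y') * L1"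
        by (simp add: L1_def sum_distrib_left sum_distrib_right mult_ac)
      also have "\<dots> \<le> norm u * norm v * norm (y - y') * (L1 + M1)" using nn by (intro mult_left_mono) auto
      finally show ?thesis by (simp add: mult_ac)
    qed
    show "\<bar>dG y a u v - dG y' a u v\<bar> \<le> (L1 + M1) * norm (y - y') * norm a * norm u * norm v"
      if "y \<in> K" "y' \<in> K" for y y' a u v
    proof -
      have eq: "dG y a u v - dG y' a u v = (\<Sum>i\<in>Basis. \<Sum>j\<in>Basis. (u \<bullet> i) * (v \<bullet> j) * (dG y a i j - dG y' a i j))"
        using dG_expand[OF W[OF that(1)], of a u v] dG_expand[OF W[OF that(2)], of a u v]
        by (simp add: sum_subtractf right_diff_distrib)
      have "\<bar>dG y a u v - dG y' a u v\<bar> \<le> norm u * norm v * (\<Sum>i\<in>Basis. \<Sum>j\<in>Basis. norm a * norm (y - y') * M' i j)"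
        unfolding eq by (rule bilinear_sum_bound) (rule M'[OF that])
      also have "\<dots> = norm u * norm v * norm a * norm (y - y') * M1"
        by (simp add: M1_def sum_distrib_left sum_distrib_right mult_ac)
      also have "\<dots> \<le> norm u * norm v * norm a * norm (y - y') * (L1 + M1)" using nn by (intro mult_left_mono) auto
      finally show ?thesis by (simp add: mult_ac)
    qed
  qed
qed

end

section \<open>Uniqueness of geodesics inside one chart\<close>

lemma gronwall_zero:
  fixes E :: "real \<Rightarrow> real"
  assumes E: "\<And>s. s \<in> {s0..s1} \<Longrightarrow> (E has_real_derivative E' s) (at s within {s0..s1})"
    and le: "\<And>s. s \<in> {s0..s1} \<Longrightarrow> E' s \<le> C * E s"
    and nn: "\<And>s. s \<in> {s0..s1} \<Longrightarrow> 0 \<le> E s" and "E s0 = 0" and s: "s \<in> {s0..s1}"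
  shows "E s = 0"
proof -
  \<comment> \<open>Weighted by this exponential the function can only decrease, and it starts at
    0.\<close>
  let ?h = "\<lambda>s. E s * exp (- C * s)"
  have d: "(?h has_real_derivative (E' s - C * E s) * exp (- C * s)) (at s within {s0..s1})"
    if "s \<in> {s0..s1}" for s
    by (rule derivative_eq_intros E[OF that] refl)+ (simp add: algebra_simps)
  have "?h s \<le> ?h s0"
  proof (rule DERIV_nonpos_imp_decreasing_open[of s0 s ?h])
    show "s0 \<le> s" using s by simp
    show "\<exists>y. (?h has_real_derivative y) (at x) \<and> y \<le> 0" if "s0 < x" "x < s" for x
    proof -
      have "x \<in> interior {s0..s1}" using that s by (simp add: interior_atLeastAtMost_real)
      from at_within_interior[OF this]
      have "(?h has_real_derivative (E' x - C * E x) * exp (- C * x)) (at x)"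
        using d[of x] that s by simp
      moreover have "(E' x - C * E x) * exp (- C * x) \<le> 0"
        using le[of x] that s by (intro mult_nonpos_nonneg) auto
      ultimately show ?thesis by blast
    qed
    have "continuous_on {s0..s1} ?h" by (rule DERIV_continuous_on[OF d])
    then show "continuous_on {s0..s} ?h" by (rule continuous_on_subset) (use s in auto)
  qed
  then have "E s * exp (- C * s) \<le> 0" using \<open>E s0 = 0\<close> by simp
  then have "E s \<le> 0" by (simp add: mult_le_0_iff)
  then show ?thesis using nn[OF s] by simp
qed

context coord_metric
begin

text \<open>The Christoffel acceleration with its index lowered: for y in W,
  \<open>force y a w\<close> equals \<open>G y (chris y a a) w\<close> by \<open>chris_same\<close>.
  It contains no inverse of the metric.\<close>

definition force :: "'e \<Rightarrow> 'e \<Rightarrow> 'e \<Rightarrow> real" where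
  "force y a w = dG y a a w - dG y w a a / 2"

text \<open>Trilinearity allows the arguments to be exchanged one at a time, beginning with the base
  point; each exchange costs one summand.\<close>

lemma dG_lipschitz:
  assumes C: "0 \<le> C" "\<And>y a u v. y \<in> K \<Longrightarrow> \<bar>dG y a u v\<bar> \<le> C * norm a * norm u * norm v"
    "\<And>y y' a u v. y \<in> K \<Longrightarrow> y' \<in> K \<Longrightarrow>
        \<bar>dG y a u v - dG y' a u v\<bar> \<le> C * norm (y - y') * norm a * norm u * norm v"
    and K: "K \<subseteq> W" "y \<in> K" "y' \<in> K"
  shows "\<bar>dG y a u v - dG y' a' u' v'\<bar> \<le> C * norm (y - y') * norm a * norm u * norm v
    + C * norm (a - a') * norm u * norm v + C * norm a' * norm (u - u') * norm v + C * norm a' * norm u' * norm (v - v')"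
proof -
  have y': "y' \<in> W" using K by auto
  have "dG y a u v - dG y' a' u' v' = (dG y a u v - dG y' a u v) + dG y' (a - a') u v
     + dG y' a' (u - u') v + dG y' a' u' (v - v')"
    by (simp add: dG_diff[OF y'] dG_diff_left[OF y'] dG_diff_right[OF y'])
  then show ?thesis
    using C(3)[OF K(2,3), of a u v] C(2)[OF K(3), of "a - a'" u v] C(2)[OF K(3), of a' "u - u'" v]
      C(2)[OF K(3), of a' u' "v - v'"] by linarith
qed

text \<open>The factor 3/2 comes from the two terms of \<open>force\<close>, of weights 1 and 1/2.
  The first bound estimates the acceleration, the second its change with position and
  velocity.\<close>

lemma force_bounds:
  assumes C: "0 \<le> C" "\<And>y a u v. y \<in> K \<Longrightarrow> \<bar>dG y a u v\<bar> \<le> C * norm a * norm u * norm v"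
    "\<And>y y' a u v. y \<in> K \<Longrightarrow> y' \<in> K \<Longrightarrow>
        \<bar>dG y a u v - dG y' a u v\<bar> \<le> C * norm (y - y') * norm a * norm u * norm v"
    and K: "K \<subseteq> W" "y \<in> K" "y' \<in> K" and R: "norm a \<le> R" "norm a' \<le> R"
  shows "\<bar>force y a w\<bar> \<le> 3/2 * C * R\<^sup>2 * norm w"
    and "\<bar>force y a w - force y' a' w\<bar> \<le> 3/2 * (C * R\<^sup>2 * norm (y - y') + 2 * C * R * norm (a - a')) * norm w"
proof -
  have R0: "0 \<le> R" using R(1) norm_ge_zero order_trans by blast
  have aa: "norm a * norm a \<le> R\<^sup>2"
    unfolding power2_eq_square by (intro mult_mono R R0) auto
  have 1: "C * norm a * norm a * norm w \<le> C * R\<^sup>2 * norm w"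
    using mult_right_mono[OF mult_left_mono[OF aa C(1)], of "norm w"] by (simp add: mult.assoc)
  show "\<bar>force y a w\<bar> \<le> 3/2 * C * R\<^sup>2 * norm w"
  proof -
    have "\<bar>dG y w a a\<bar> \<le> C * norm a * norm a * norm w"
      using C(2)[OF K(2), of w a a] by (simp add: mult_ac)
    then have "\<bar>force y a w\<bar> \<le> 3/2 * (C * R\<^sup>2 * norm w)"
      using C(2)[OF K(2), of a a w] 1 unfolding force_def by linarith
    then show ?thesis by simp
  qed
  have 2: "C * norm (y - y') * norm a * norm a * norm w \<le> C * R\<^sup>2 * norm (y - y') * norm w"
    using mult_right_mono[OF 1, of "norm (y - y')"] by (simp add: mult_ac)
  have 3: "C * norm (a - a') * norm a * norm w \<le> C * R * norm (a - a') * norm w"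
    using mult_right_mono[OF mult_left_mono[OF R(1) C(1)], of "norm (a - a') * norm w"] by (simp add: mult_ac)
  have 4: "C * norm (a - a') * norm a' * norm w \<le> C * R * norm (a - a') * norm w"
    using mult_right_mono[OF mult_left_mono[OF R(2) C(1)], of "norm (a - a') * norm w"] by (simp add: mult_ac)
  have A: "\<bar>dG y a a w - dG y' a' a' w\<bar> \<le> C * R\<^sup>2 * norm (y - y') * norm w + 2 * (C * R * norm (a - a') * norm w)"
    using dG_lipschitz[OF C K, of a a w a' a' w] 2 3 4 by (simp add: mult_ac)
  have B: "\<bar>dG y w a a - dG y' w a' a'\<bar> \<le> C * R\<^sup>2 * norm (y - y') * norm w + 2 * (C * R * norm (a - a') * norm w)"
    using dG_lipschitz[OF C K, of w a a w a' a'] 2 3 4 by (simp add: mult_ac)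
  have "\<bar>force y a w - force y' a' w\<bar> \<le> 3/2 * (C * R\<^sup>2 * norm (y - y') * norm w + 2 * (C * R * norm (a - a') * norm w))"
  proof -
    have "\<bar>x - z / 2 - (x' - z' / 2)\<bar> \<le> 3/2 * u" if "\<bar>x - x'\<bar> \<le> u" "\<bar>z - z'\<bar> \<le> u" for x x' z z' u :: real
      using that by linarith
    from this[OF A B] show ?thesis unfolding force_def .
  qed
  then show "\<bar>force y a w - force y' a' w\<bar> \<le> 3/2 * (C * R\<^sup>2 * norm (y - y') + 2 * C * R * norm (a - a')) * norm w"
    by (simp add: algebra_simps)
qed

text \<open>
  Working with the energy \<open>|q\<^sub>1 - q\<^sub>2|\<^sup>2 + G(q\<^sub>1)(q\<^sub>1' - q\<^sub>2', q\<^sub>1' - q\<^sub>2')\<close> makes the inverse matrix hidden in the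
  Christoffel symbols disappear, so that no Lipschitz estimate for them is needed.
\<close>

lemma geodesic_unique_in_chart:
  assumes K: "compact K" "convex K" "K \<subseteq> W"
    and q1: "\<And>s. s \<in> {s0..s1} \<Longrightarrow> (q1 has_vector_derivative a1 s) (at s within {s0..s1})"
    and q2: "\<And>s. s \<in> {s0..s1} \<Longrightarrow> (q2 has_vector_derivative a2 s) (at s within {s0..s1})"
    and a1: "\<And>s. s \<in> {s0..s1} \<Longrightarrow> (a1 has_vector_derivative - chris (q1 s) (a1 s) (a1 s)) (at s within {s0..s1})"
    and a2: "\<And>s. s \<in> {s0..s1} \<Longrightarrow> (a2 has_vector_derivative - chris (q2 s) (a2 s) (a2 s)) (at s within {s0..s1})"
    and inK: "\<And>s. s \<in> {s0..s1} \<Longrightarrow> q1 s \<in> K" "\<And>s. s \<in> {s0..s1} \<Longrightarrow> q2 s \<in> K"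
    and init: "q1 s0 = q2 s0" "a1 s0 = a2 s0" and s: "s \<in> {s0..s1}"
  shows "q1 s = q2 s \<and> a1 s = a2 s"
proof -
  let ?I = "{s0..s1}"
  obtain C where C: "0 \<le> C"
    "\<And>y u v. y \<in> K \<Longrightarrow> \<bar>G y u v\<bar> \<le> C * norm u * norm v"
    "\<And>y a u v. y \<in> K \<Longrightarrow> \<bar>dG y a u v\<bar> \<le> C * norm a * norm u * norm v"
    "\<And>y y' u v. y \<in> K \<Longrightarrow> y' \<in> K \<Longrightarrow> \<bar>G y u v - G y' u v\<bar> \<le> C * norm (y - y') * norm u * norm v"
    "\<And>y y' a u v. y \<in> K \<Longrightarrow> y' \<in> K \<Longrightarrow>
        \<bar>dG y a u v - dG y' a u v\<bar> \<le> C * norm (y - y') * norm a * norm u * norm v"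
    using G_bounds[OF K] by blast
  obtain l where l: "0 < l" "\<And>y u. y \<in> K \<Longrightarrow> l * (norm u)\<^sup>2 \<le> G y u u"
    using G_lower_bound[OF K(1,3)] by blast
  have cont: "continuous_on ?I a1" "continuous_on ?I a2"
    by (rule continuous_on_vector_derivative[OF a1], assumption, rule continuous_on_vector_derivative[OF a2])
  have "bounded (a1 ` ?I \<union> a2 ` ?I)"
    using compact_imp_bounded[OF compact_continuous_image[OF cont(1)]]
      compact_imp_bounded[OF compact_continuous_image[OF cont(2)]] by simp
  then obtain R where "\<And>x. x \<in> a1 ` ?I \<union> a2 ` ?I \<Longrightarrow> norm x \<le> R" by (auto simp: bounded_iff)
  then have R: "\<And>s. s \<in> ?I \<Longrightarrow> norm (a1 s) \<le> R" "\<And>s. s \<in> ?I \<Longrightarrow> norm (a2 s) \<le> R" by auto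
  have R0: "0 \<le> R" using R(1)[OF s] norm_ge_zero order_trans by blast
  have W: "\<And>s. s \<in> ?I \<Longrightarrow> q1 s \<in> W" "\<And>s. s \<in> ?I \<Longrightarrow> q2 s \<in> W" using inK K by auto
  \<comment> \<open>A bound for the Christoffel acceleration z of the second curve: l |z|^2 is at
    most G(z, z), which is \<open>force\<close> applied to z and hence at most 3/2 C R^2 |z|;
    dividing by l |z| gives R'.\<close>
  define R' where "R' = 3/2 * C * R\<^sup>2 / l"
  have R'0: "0 \<le> R'" using C(1) R0 l by (simp add: R'_def)
  let ?c1 = "\<lambda>s. chris (q1 s) (a1 s) (a1 s)" and ?c2 = "\<lambda>s. chris (q2 s) (a2 s) (a2 s)"
  have R': "norm (?c2 s) \<le> R'" if "s \<in> ?I" for s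
  proof -
    let ?z = "?c2 s"
    have "l * (norm ?z)\<^sup>2 \<le> force (q2 s) (a2 s) ?z"
      using l(2)[OF inK(2)[OF that], of ?z] chris_same[OF W(2)[OF that]] by (simp add: force_def)
    also have "\<dots> \<le> 3/2 * C * R\<^sup>2 * norm ?z"
      using force_bounds(1)[OF C(1,3,5) K(3) inK(2)[OF that] inK(2)[OF that] R(2)[OF that] R(2)[OF that], of ?z] by linarith
    finally have "(l * norm ?z) * norm ?z \<le> (3/2 * C * R\<^sup>2) * norm ?z" by (simp add: power2_eq_square mult_ac)
    then have "?z = 0 \<or> l * norm ?z \<le> 3/2 * C * R\<^sup>2"
      using mult_right_le_imp_le[of "l * norm ?z" "norm ?z" "3/2 * C * R\<^sup>2"] by (cases "?z = 0") simp_all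
    then show ?thesis
      using R'0 l(1) by (auto simp: R'_def pos_le_divide_eq mult_ac)
  qed
  define E where "E s = (q1 s - q2 s) \<bullet> (q1 s - q2 s) + G (q1 s) (a1 s - a2 s) (a1 s - a2 s)" for s
  define E' where "E' s = 2 * ((q1 s - q2 s) \<bullet> (a1 s - a2 s)) + (dG (q1 s) (a1 s) (a1 s - a2 s) (a1 s - a2 s)
      + 2 * G (q1 s) (- ?c1 s - - ?c2 s) (a1 s - a2 s))" for s
  \<comment> \<open>Let D and H be the distances of positions and of velocities. In front of D * H
    stand 2 from the squared distance, 3 C R^2 from the position dependence of \<open>force\<close>
    and 2 C R' from comparing the metric at both points. In front of H * H stand C R from moving the
    metric along q1 and 6 C R from the velocity dependence of \<open>force\<close>.\<close>
  define M where "M = 2 + 3 * C * R\<^sup>2 + 2 * C * R' + 7 * C * R"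
  have M0: "0 \<le> M" using C(1) R0 R'0 by (simp add: M_def)
  have dE: "(E has_real_derivative E' s) (at s within ?I)" if "s \<in> ?I" for s
  proof -
    have d: "((\<lambda>s. q1 s - q2 s) has_vector_derivative a1 s - a2 s) (at s within ?I)"
      by (intro has_vector_derivative_diff q1 q2 that)
    have e: "((\<lambda>s. a1 s - a2 s) has_vector_derivative - ?c1 s - - ?c2 s) (at s within ?I)"
      by (intro has_vector_derivative_diff a1 a2 that)
    have "((\<lambda>s. (q1 s - q2 s) \<bullet> (q1 s - q2 s)) has_vector_derivative 2 * ((q1 s - q2 s) \<bullet> (a1 s - a2 s))) (at s within ?I)"
      using bounded_bilinear.has_vector_derivative[OF bounded_bilinear_inner d d] by (simp add: inner_commute)
    moreover have "((\<lambda>s. G (q1 s) (a1 s - a2 s) (a1 s - a2 s)) has_vector_derivative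
       dG (q1 s) (a1 s) (a1 s - a2 s) (a1 s - a2 s) + 2 * G (q1 s) (- ?c1 s - - ?c2 s) (a1 s - a2 s)) (at s within ?I)"
      using G_has_vector_derivative[OF q1[OF that] e e W(1)[OF that] that]
        G_sym[OF W(1)[OF that], of "a1 s - a2 s" "- ?c1 s - - ?c2 s"]
      by (simp add: add.commute)
    ultimately show ?thesis
      unfolding has_real_derivative_iff_has_vector_derivative E_def[abs_def] E'_def
      by (rule has_vector_derivative_add)
  qed
  have le: "E' s \<le> M * (1 + 1 / l) * E s" if "s \<in> ?I" for s
  proof -
    define D where "D = norm (q1 s - q2 s)"
    define H where "H = norm (a1 s - a2 s)"
    let ?\<eta> = "a1 s - a2 s"
    have nn: "0 \<le> D" "0 \<le> H" by (auto simp: D_def H_def)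
    have 1: "(q1 s - q2 s) \<bullet> ?\<eta> \<le> D * H" unfolding D_def H_def by (rule norm_cauchy_schwarz)
    have "dG (q1 s) (a1 s) ?\<eta> ?\<eta> \<le> C * norm (a1 s) * H * H"
      using C(3)[OF inK(1)[OF that], of "a1 s" ?\<eta> ?\<eta>] by (simp add: H_def)
    also have "\<dots> \<le> C * R * H * H"
      using R(1)[OF that] C(1) nn by (intro mult_right_mono mult_left_mono) auto
    finally have 2: "dG (q1 s) (a1 s) ?\<eta> ?\<eta> \<le> C * R * H * H" .
    \<comment> \<open>The second curve obeys its equation with respect to the metric at its own
      position. Exchanging that metric for the one at \<open>q1 s\<close> costs the second bracket
      and leaves a difference of forces.\<close>
    have "G (q1 s) (- ?c1 s - - ?c2 s) ?\<eta>
        = (force (q2 s) (a2 s) ?\<eta> - force (q1 s) (a1 s) ?\<eta>) + (G (q1 s) (?c2 s) ?\<eta> - G (q2 s) (?c2 s) ?\<eta>)"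
      by (simp add: G_diff_left[OF W(1)[OF that]] G_minus_left[OF W(1)[OF that]] chris_same[OF W(1)[OF that]]
          chris_same[OF W(2)[OF that]] force_def)
    moreover have "force (q2 s) (a2 s) ?\<eta> - force (q1 s) (a1 s) ?\<eta> \<le> 3/2 * (C * R\<^sup>2 * D + 2 * C * R * H) * H"
      using force_bounds(2)[OF C(1,3,5) K(3) inK(1)[OF that] inK(2)[OF that] R(1)[OF that] R(2)[OF that], of ?\<eta>]
      unfolding D_def H_def by linarith
    moreover have "G (q1 s) (?c2 s) ?\<eta> - G (q2 s) (?c2 s) ?\<eta> \<le> C * D * R' * H"
    proof -
      have "G (q1 s) (?c2 s) ?\<eta> - G (q2 s) (?c2 s) ?\<eta> \<le> C * D * norm (?c2 s) * H"
        using C(4)[OF inK(1)[OF that] inK(2)[OF that], of "?c2 s" ?\<eta>] unfolding D_def H_def by linarith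
      also have "\<dots> \<le> C * D * R' * H"
        using R'[OF that] C(1) nn by (intro mult_right_mono mult_left_mono) auto
      finally show ?thesis .
    qed
    ultimately have 3: "G (q1 s) (- ?c1 s - - ?c2 s) ?\<eta> \<le> 3/2 * (C * R\<^sup>2 * D + 2 * C * R * H) * H + C * D * R' * H"
      by linarith
    have "E' s \<le> 2 * (D * H) + (C * R * H * H + 2 * (3/2 * (C * R\<^sup>2 * D + 2 * C * R * H) * H + C * D * R' * H))"
      unfolding E'_def by (intro add_mono mult_left_mono 1 2 3) auto
    also have "\<dots> = (2 + 3 * C * R\<^sup>2 + 2 * C * R') * (D * H) + 7 * C * R * (H * H)"
      by (simp add: algebra_simps)
    also have "\<dots> \<le> M * (D * D + H * H)"
    proof -
      have "0 \<le> (D - H)\<^sup>2" by simp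
      then have "2 * (D * H) \<le> D * D + H * H" by (simp add: power2_eq_square algebra_simps)
      moreover have "0 \<le> D * H" "0 \<le> D * D" using nn by auto
      ultimately have DH: "D * H \<le> D * D + H * H" by linarith
      have "(2 + 3 * C * R\<^sup>2 + 2 * C * R') * (D * H) \<le> (2 + 3 * C * R\<^sup>2 + 2 * C * R') * (D * D + H * H)"
        using C(1) R0 R'0 by (intro mult_left_mono[OF DH]) auto
      moreover have "7 * C * R * (H * H) \<le> 7 * C * R * (D * D + H * H)"
        using C(1) R0 nn by (intro mult_left_mono) auto
      ultimately show ?thesis by (simp add: M_def distrib_right)
    qed
    also have "\<dots> \<le> M * ((1 + 1 / l) * E s)"
    proof (rule mult_left_mono[OF _ M0])
      have Es: "E s = D * D + G (q1 s) ?\<eta> ?\<eta>"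
        by (simp add: E_def D_def dot_square_norm power2_eq_square)
      have "H * H \<le> G (q1 s) ?\<eta> ?\<eta> / l"
        using l(2)[OF inK(1)[OF that], of ?\<eta>] l(1) by (simp add: H_def pos_le_divide_eq power2_eq_square mult_ac)
      moreover have "0 \<le> G (q1 s) ?\<eta> ?\<eta>" by (rule G_nonneg[OF W(1)[OF that]])
      moreover have "0 \<le> D * D / l" using nn l by simp
      ultimately show "D * D + H * H \<le> (1 + 1 / l) * E s"
        by (simp add: Es distrib_right add_divide_distrib distrib_left)
    qed
    finally show ?thesis by (simp add: mult.assoc)
  qed
  have nn: "0 \<le> E s" if "s \<in> ?I" for s
    using G_nonneg[OF W(1)[OF that]] by (simp add: E_def)
  have "E s0 = 0"
    using init s G_scale_left[OF W(1), of s0 0 0 0] by (simp add: E_def)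
  from gronwall_zero[OF dE le nn this s] have "E s = 0" .
  moreover have "0 \<le> G (q1 s) (a1 s - a2 s) (a1 s - a2 s)" by (rule G_nonneg[OF W(1)[OF s]])
  moreover have "0 \<le> (q1 s - q2 s) \<bullet> (q1 s - q2 s)" by simp
  ultimately have "(q1 s - q2 s) \<bullet> (q1 s - q2 s) = 0" "G (q1 s) (a1 s - a2 s) (a1 s - a2 s) = 0"
    unfolding E_def by linarith+
  then show ?thesis using G_pos[OF W(1)[OF s], of "a1 s - a2 s"] by force
qed

lemma G_cauchy_schwarz:
  assumes y: "y \<in> W"
  shows "G y u v \<le> sqrt (G y u u) * sqrt (G y v v)"
proof -
  have "(G y u v)\<^sup>2 \<le> G y u u * G y v v"
  proof (cases "v = 0")
    case True
    then show ?thesis using G_scale_right[OF y, of u 0 0] G_scale_right[OF y, of 0 0 0] by simp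
  next
    case False
    define t where "t = G y u v / G y v v"
    have p: "0 < G y v v" by (rule G_pos[OF y False])
    have "0 \<le> G y (u - t *\<^sub>R v) (u - t *\<^sub>R v)" by (rule G_nonneg[OF y])
    also have "\<dots> = G y u u - 2 * t * G y u v + t * t * G y v v"
      by (simp add: G_diff_left[OF y] G_diff_right[OF y] G_scale_left[OF y] G_scale_right[OF y]
          G_sym[OF y, of v u] algebra_simps)
    also have "\<dots> = G y u u - (G y u v)\<^sup>2 / G y v v"
      using p by (simp add: t_def power2_eq_square)
    finally show ?thesis using p by (simp add: pos_divide_le_eq)
  qed
  then have "sqrt ((G y u v)\<^sup>2) \<le> sqrt (G y u u * G y v v)" by (rule real_sqrt_le_mono)
  then show ?thesis by (simp add: real_sqrt_mult)
qed

end

section \<open>Tangent vectors and Riemannian metrics in charts\<close>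

locale riemannian =
  fixes \<A> :: "('m::{t2_space,second_countable_topology}, 'e::euclidean_space) chart set"
    and g :: "'m \<Rightarrow> ('m, 'e) tvec \<Rightarrow> ('m, 'e) tvec \<Rightarrow> real"
  assumes atlas: "smooth_atlas \<A>" and metric: "riemannian_metric \<A> g"
begin

lemma chart_ex: "\<exists>c\<in>\<A>. x \<in> cdom c"
  using atlas unfolding smooth_atlas_def by blast

lemma chart_at: "chart_at \<A> x \<in> \<A>" "x \<in> cdom (chart_at \<A> x)"
  using someI_ex[of "\<lambda>c. c \<in> \<A> \<and> x \<in> cdom c"] chart_ex unfolding chart_at_def by blast+

lemma
  assumes "c \<in> \<A>"
  shows open_cdom: "open (cdom c)" and open_cran: "open (cran c)"
    and chart_homeo: "homeomorphism (cdom c) (cran c) (cmap c) (cinv c)"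
  using atlas assms unfolding smooth_atlas_def by auto

lemma
  assumes "c \<in> \<A>"
  shows continuous_cmap: "continuous_on (cdom c) (cmap c)"
    and continuous_cinv: "continuous_on (cran c) (cinv c)"
    and cinv_cmap: "\<And>x. x \<in> cdom c \<Longrightarrow> cinv c (cmap c x) = x"
    and cmap_cinv: "\<And>y. y \<in> cran c \<Longrightarrow> cmap c (cinv c y) = y"
    and cinv_in: "\<And>y. y \<in> cran c \<Longrightarrow> cinv c y \<in> cdom c"
  using chart_homeo[OF assms] unfolding homeomorphism_def by auto

lemma overlap_eq: "c \<in> \<A> \<Longrightarrow> cmap c ` (cdom c \<inter> S) = cran c \<inter> cinv c -` S"
  by (auto simp: cinv_cmap cmap_cinv cinv_in image_iff intro!: bexI[of _ "cinv c _"])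

lemma open_overlap: "c \<in> \<A> \<Longrightarrow> open S \<Longrightarrow> open (cmap c ` (cdom c \<inter> S))"
  using continuous_open_preimage[OF continuous_cinv open_cran] by (simp add: overlap_eq)

lemma transition_smooth:
  "c \<in> \<A> \<Longrightarrow> d \<in> \<A> \<Longrightarrow> Ck_on \<infinity> (cmap c ` (cdom c \<inter> cdom d)) (cmap d \<circ> cinv c)"
  using atlas unfolding smooth_atlas_def by blast

text \<open>The Jacobian of a coordinate change. It is indexed by the point of M and not by its
  coordinates, so that the cocycle rule \<open>transition_transition\<close> involves a single
  point.\<close>

definition transition :: "('m, 'e) chart \<Rightarrow> ('m, 'e) chart \<Rightarrow> 'm \<Rightarrow> 'e \<Rightarrow> 'e" where
  "transition c d x = frechet_derivative (cmap d \<circ> cinv c) (at (cmap c x))"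

lemma transition_works:
  assumes "c \<in> \<A>" "d \<in> \<A>" "x \<in> cdom c" "x \<in> cdom d"
  shows "((cmap d \<circ> cinv c) has_derivative transition c d x) (at (cmap c x))"
  unfolding transition_def
  by (rule C_nat_on_has_derivative[OF Ck_on_imp_C_nat_on[OF transition_smooth[OF assms(1,2)], of "Suc 0"]])
     (use assms in auto)

text \<open>The domain and J are left general to serve both one-sided derivatives of curves and maps
  from Euclidean space. The eventual condition is a remnant of continuity: differentiability of
  \<open>cmap c \<circ> \<gamma>\<close> alone says nothing about whether nearby values lie in the
  chart.\<close>

lemma has_derivative_change_chart:
  fixes \<gamma> :: "'a::real_normed_vector \<Rightarrow> 'm"
  assumes c: "c \<in> \<A>" "d \<in> \<A>" "\<gamma> s \<in> cdom c" "\<gamma> s \<in> cdom d" "s \<in> J"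
    and ev: "\<forall>\<^sub>F s' in at s within J. \<gamma> s' \<in> cdom c"
    and der: "((cmap c \<circ> \<gamma>) has_derivative f') (at s within J)"
  shows "((cmap d \<circ> \<gamma>) has_derivative (\<lambda>h. transition c d (\<gamma> s) (f' h))) (at s within J)"
proof -
  have "((\<lambda>s. (cmap d \<circ> cinv c) ((cmap c \<circ> \<gamma>) s)) has_derivative (\<lambda>h. transition c d (\<gamma> s) (f' h))) (at s within J)"
    by (rule has_derivative_compose[OF der]) (use transition_works[OF c(1-4)] in \<open>simp add: o_def\<close>)
  moreover have "\<forall>\<^sub>F s' in at s within J. (cmap d \<circ> cinv c) ((cmap c \<circ> \<gamma>) s') = (cmap d \<circ> \<gamma>) s'"
    using ev by eventually_elim (simp add: cinv_cmap[OF c(1)])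
  ultimately show ?thesis
    by (rule has_derivative_transform_eventually) (use c in \<open>simp_all add: cinv_cmap\<close>)
qed

lemma transition_self:
  assumes "c \<in> \<A>" "x \<in> cdom c" shows "transition c c x u = u"
proof -
  have "((\<lambda>y. y) has_derivative (\<lambda>h. h)) (at (cmap c x))" by (rule has_derivative_ident)
  then have "((cmap c \<circ> cinv c) has_derivative (\<lambda>h. h)) (at (cmap c x))"
    by (rule has_derivative_transform_within_open[OF _ open_cran[OF assms(1)]])
       (use assms in \<open>auto simp: cmap_cinv\<close>)
  from frechet_derivative_eqI[OF this] show ?thesis unfolding transition_def .
qed

lemma transition_transition:
  assumes "c \<in> \<A>" "d \<in> \<A>" "e \<in> \<A>" "x \<in> cdom c" "x \<in> cdom d" "x \<in> cdom e"
  shows "transition d e x (transition c d x u) = transition c e x u"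
proof -
  have x: "cinv c (cmap c x) = x" using assms by (simp add: cinv_cmap)
  have "\<forall>\<^sub>F y in nhds (cmap c x). y \<in> cmap c ` (cdom c \<inter> cdom d)"
    using assms by (intro eventually_nhds_in_open open_overlap open_cdom) auto
  then have "\<forall>\<^sub>F y in at (cmap c x). cinv c y \<in> cdom d"
    using assms(1) by (auto simp: eventually_at_filter overlap_eq elim!: eventually_mono)
  from has_derivative_change_chart[OF assms(2,3) _ _ _ this transition_works[OF assms(1,2,4,5)]]
  have "((cmap e \<circ> cinv c) has_derivative (\<lambda>u. transition d e x (transition c d x u))) (at (cmap c x))"
    using assms x by simp
  from frechet_derivative_eqI[OF this] show ?thesis by (simp add: transition_def)
qed

lemma transition_linear:
  assumes "c \<in> \<A>" "d \<in> \<A>" "x \<in> cdom c" "x \<in> cdom d"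
  shows "linear (transition c d x)"
  using has_derivative_bounded_linear[OF transition_works[OF assms]] by (rule bounded_linear.linear)

lemma tvec_of_eq: "tvec_of \<A> c x u = (\<lambda>d. if d \<in> \<A> \<and> x \<in> cdom d then transition c d x u else 0)"
  unfolding tvec_of_def transition_def by (rule refl)

lemma tangent_space_iff:
  "v \<in> tangent_space \<A> x \<longleftrightarrow> (\<forall>c. \<not> (c \<in> \<A> \<and> x \<in> cdom c) \<longrightarrow> v c = 0) \<and>
     (\<forall>c\<in>\<A>. \<forall>d\<in>\<A>. x \<in> cdom c \<inter> cdom d \<longrightarrow> v d = transition c d x (v c))"
  by (simp add: tangent_space_def transition_def)

lemma tvec_of_in:
  assumes "c \<in> \<A>" "x \<in> cdom c" shows "tvec_of \<A> c x u \<in> tangent_space \<A> x"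
  unfolding tangent_space_iff by (auto simp: tvec_of_eq transition_transition assms)

lemma tvec_of_component: "c \<in> \<A> \<Longrightarrow> x \<in> cdom c \<Longrightarrow> tvec_of \<A> c x u c = u"
  by (simp add: tvec_of_eq transition_self)

lemma tvec_of_component_self:
  assumes "v \<in> tangent_space \<A> x" "c \<in> \<A>" "x \<in> cdom c" shows "tvec_of \<A> c x (v c) = v"
proof
  fix d
  show "tvec_of \<A> c x (v c) d = v d"
  proof (cases "d \<in> \<A> \<and> x \<in> cdom d")
    case True
    then have "v d = transition c d x (v c)"
      using assms unfolding tangent_space_iff by blast
    with True show ?thesis by (simp add: tvec_of_eq)
  next
    case False
    then have "v d = 0" using assms(1) unfolding tangent_space_iff by blast
    with False show ?thesis by (auto simp: tvec_of_eq)
  qed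
qed

lemma tvec_of_linear:
  assumes "c \<in> \<A>" "x \<in> cdom c"
  shows "tvec_of \<A> c x (a *\<^sub>R u + b *\<^sub>R v) = (\<lambda>d. a *\<^sub>R tvec_of \<A> c x u d + b *\<^sub>R tvec_of \<A> c x v d)"
  using transition_linear[OF assms(1) _ assms(2)]
  by (auto simp: tvec_of_eq linear_add linear_scale)

abbreviation "mc \<equiv> metric_coord \<A> g"

lemma metric_eq_coord:
  assumes "c \<in> \<A>" "x \<in> cdom c" "v \<in> tangent_space \<A> x" "w \<in> tangent_space \<A> x"
  shows "g x v w = mc c (cmap c x) (v c) (w c)"
  using assms by (simp add: metric_coord_def cinv_cmap tvec_of_component_self)

lemma metric_tvec_of:
  assumes "c \<in> \<A>" "x \<in> cdom c"
  shows "g x (tvec_of \<A> c x u) (tvec_of \<A> c x v) = mc c (cmap c x) u v"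
  using assms by (simp add: metric_coord_def cinv_cmap)

lemma metric_sym: "u \<in> tangent_space \<A> x \<Longrightarrow> v \<in> tangent_space \<A> x \<Longrightarrow> g x u v = g x v u"
  using metric unfolding riemannian_metric_def by blast

lemma metric_pos: "u \<in> tangent_space \<A> x \<Longrightarrow> u \<noteq> (\<lambda>_. 0) \<Longrightarrow> 0 < g x u u"
  using metric unfolding riemannian_metric_def by blast

lemma metric_linear:
  "u \<in> tangent_space \<A> x \<Longrightarrow> v \<in> tangent_space \<A> x \<Longrightarrow> w \<in> tangent_space \<A> x \<Longrightarrow>
    g x (\<lambda>c. a *\<^sub>R u c + b *\<^sub>R v c) w = a * g x u w + b * g x v w"
  using metric unfolding riemannian_metric_def by blast

text \<open>The bridge from the intrinsic metric to the Euclidean estimates. Bilinearity transfers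
  because \<open>tvec_of\<close> is linear, positivity because its component in c returns the
  argument and so it kills no nonzero vector.\<close>

lemma coord_metric:
  assumes c: "c \<in> \<A>" shows "coord_metric (cran c) (mc c)"
proof
  show "open (cran c)" by (rule open_cran[OF c])
  fix y assume y: "y \<in> cran c"
  let ?x = "cinv c y"
  have x: "?x \<in> cdom c" by (rule cinv_in[OF c y])
  note T = tvec_of_in[OF c x]
  show sym: "mc c y u v = mc c y v u" for u v
    unfolding metric_coord_def by (rule metric_sym[OF T T])
  have lin: "mc c y (a *\<^sub>R u + b *\<^sub>R v) w = a * mc c y u w + b * mc c y v w" for a b u v w
    unfolding metric_coord_def tvec_of_linear[OF c x] by (rule metric_linear[OF T T T])
  have l: "linear (\<lambda>u. mc c y u w)" for w
  proof
    show "mc c y (u + v) w = mc c y u w + mc c y v w" for u v using lin[of 1 u 1 v] by simp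
    show "mc c y (r *\<^sub>R u) w = r *\<^sub>R mc c y u w" for r u using lin[of r u 0 u] by simp
  qed
  moreover have "linear (mc c y u)" for u
  proof -
    have "(\<lambda>w. mc c y w u) = mc c y u" by (rule ext) (rule sym)
    then show ?thesis using l[of u] by simp
  qed
  ultimately show "bilinear (mc c y)" by (simp add: bilinear_def)
  show "0 < mc c y u u" if "u \<noteq> 0" for u
    unfolding metric_coord_def
    by (rule metric_pos[OF T]) (use that tvec_of_component[OF c x, of u] in auto)
next
  show "C_nat_on 2 (cran c) (\<lambda>y. mc c y u v)" for u v
  proof -
    have "Ck_on \<infinity> (cran c) (\<lambda>y. mc c y u v)"
      using metric c unfolding riemannian_metric_def by blast
    then show ?thesis by (rule Ck_on_imp_C_nat_on) simp
  qed
qed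

lemma christoffel_eq:
  assumes c: "c \<in> \<A>"
  shows "christoffel \<A> g c = coord_metric.chris (mc c)"
proof -
  interpret coord_metric "cran c" "mc c" by (rule coord_metric[OF c])
  show ?thesis
    by (intro ext) (simp add: christoffel_def chris_def dG_def Let_def)
qed

lemma metric_nonneg:
  assumes "v \<in> tangent_space \<A> x" shows "0 \<le> g x v v"
proof -
  obtain c where c: "c \<in> \<A>" "x \<in> cdom c" using chart_ex by blast
  interpret coord_metric "cran c" "mc c" by (rule coord_metric[OF c(1)])
  show ?thesis unfolding metric_eq_coord[OF c assms assms] by (rule G_nonneg) (use c in auto)
qed

lemma metric_cauchy_schwarz:
  assumes "v \<in> tangent_space \<A> x" "w \<in> tangent_space \<A> x"
  shows "g x v w \<le> sqrt (g x v v) * sqrt (g x w w)"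
proof -
  obtain c where c: "c \<in> \<A>" "x \<in> cdom c" using chart_ex by blast
  interpret coord_metric "cran c" "mc c" by (rule coord_metric[OF c(1)])
  show ?thesis
    unfolding metric_eq_coord[OF c assms] metric_eq_coord[OF c assms(1,1)] metric_eq_coord[OF c assms(2,2)]
    by (rule G_cauchy_schwarz) (use c in auto)
qed

text \<open>\<open>pushf f y a\<close> is \<open>df\<^sub>y(a)\<close>.\<close>

definition mdiff :: "('a::real_normed_vector \<Rightarrow> 'm) \<Rightarrow> 'a \<Rightarrow> bool" where
  "mdiff f y \<longleftrightarrow> isCont f y \<and> (\<exists>c\<in>\<A>. f y \<in> cdom c \<and> (cmap c \<circ> f) differentiable (at y))"

definition pushf :: "('a::real_normed_vector \<Rightarrow> 'm) \<Rightarrow> 'a \<Rightarrow> 'a \<Rightarrow> ('m, 'e) tvec" where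
  "pushf f y a = (\<lambda>d. if d \<in> \<A> \<and> f y \<in> cdom d then frechet_derivative (cmap d \<circ> f) (at y) a else 0)"

lemma isCont_eventually: "isCont f y \<Longrightarrow> open S \<Longrightarrow> f y \<in> S \<Longrightarrow> \<forall>\<^sub>F z in at y. f z \<in> S"
  unfolding isCont_def by (rule topological_tendstoD)

lemma mdiff_change:
  assumes "isCont f y" "c \<in> \<A>" "f y \<in> cdom c" "((cmap c \<circ> f) has_derivative f') (at y)"
    and "d \<in> \<A>" "f y \<in> cdom d"
  shows "((cmap d \<circ> f) has_derivative (\<lambda>a. transition c d (f y) (f' a))) (at y)"
  by (rule has_derivative_change_chart[OF assms(2,5,3,6) _ isCont_eventually assms(4)])
     (use assms open_cdom in auto)

lemma mdiff_chart:
  assumes "mdiff f y" "d \<in> \<A>" "f y \<in> cdom d"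
  shows "((cmap d \<circ> f) has_derivative (\<lambda>a. pushf f y a d)) (at y)"
proof -
  obtain c where c: "c \<in> \<A>" "f y \<in> cdom c" "(cmap c \<circ> f) differentiable (at y)" "isCont f y"
    using assms unfolding mdiff_def by blast
  then obtain f' where "((cmap c \<circ> f) has_derivative f') (at y)" by (auto simp: differentiable_def)
  from mdiff_change[OF c(4,1,2) this assms(2,3)]
  have "(cmap d \<circ> f) differentiable (at y)" by (auto simp: differentiable_def)
  then show ?thesis using assms by (simp add: pushf_def frechet_derivative_works)
qed

lemma pushf_in:
  assumes "mdiff f y" shows "pushf f y a \<in> tangent_space \<A> (f y)"
proof -
  have "pushf f y a d = transition c d (f y) (pushf f y a c)"
    if "c \<in> \<A>" "d \<in> \<A>" "f y \<in> cdom c" "f y \<in> cdom d" for c d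
  proof -
    have "isCont f y" using assms by (simp add: mdiff_def)
    from mdiff_change[OF this that(1,3) mdiff_chart[OF assms that(1,3)] that(2,4)]
    have "frechet_derivative (cmap d \<circ> f) (at y) a = transition c d (f y) (pushf f y a c)"
      by (rule frechet_derivative_eqI)
    then show ?thesis using that by (simp add: pushf_def)
  qed
  moreover have "pushf f y a d = 0" if "\<not> (d \<in> \<A> \<and> f y \<in> cdom d)" for d
    using that by (auto simp: pushf_def)
  ultimately show ?thesis unfolding tangent_space_iff by blast
qed

lemma pushf_component:
  assumes "((cmap d \<circ> f) has_derivative f') (at y)" "d \<in> \<A>" "f y \<in> cdom d"
  shows "pushf f y a d = f' a"
  using frechet_derivative_eqI[OF assms(1)] assms by (simp add: pushf_def)

lemma metric_pushf:
  assumes "mdiff f y" "c \<in> \<A>" "f y \<in> cdom c"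
  shows "g (f y) (pushf f y a) (pushf f y b) = mc c ((cmap c \<circ> f) y) (pushf f y a c) (pushf f y b c)"
  using metric_eq_coord[OF assms(2,3) pushf_in[OF assms(1)] pushf_in[OF assms(1)]] by simp

lemma
  assumes f: "mdiff f (h x)" and h: "(h has_derivative h') (at x)"
  shows mdiff_compose: "mdiff (\<lambda>x. f (h x)) x" and pushf_compose: "pushf (\<lambda>x. f (h x)) x a = pushf f (h x) (h' a)"
proof -
  have d: "((cmap d \<circ> (\<lambda>x. f (h x))) has_derivative (\<lambda>a. pushf f (h x) (h' a) d)) (at x)"
    if "d \<in> \<A>" "f (h x) \<in> cdom d" for d
    using has_derivative_compose[OF h mdiff_chart[OF f that]] by (simp add: o_def)
  obtain c where c: "c \<in> \<A>" "f (h x) \<in> cdom c" using chart_ex by blast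
  have "isCont (\<lambda>x. f (h x)) x"
    using continuous_within_compose3[OF _ has_derivative_continuous[OF h], of f] f by (simp add: mdiff_def)
  with c d[OF c] show m: "mdiff (\<lambda>x. f (h x)) x" unfolding mdiff_def differentiable_def by blast
  show "pushf (\<lambda>x. f (h x)) x a = pushf f (h x) (h' a)"
  proof
    fix d
    show "pushf (\<lambda>x. f (h x)) x a d = pushf f (h x) (h' a) d"
    proof (cases "d \<in> \<A> \<and> f (h x) \<in> cdom d")
      case True
      then show ?thesis using pushf_component[OF d] by auto
    next
      case False
      then show ?thesis by (auto simp: pushf_def)
    qed
  qed
qed

text \<open>Derivatives are local. The intended use is a curve that can be written as
  \<open>E\<close> composed with its pullback only on an open set of times.\<close>

lemma pushf_cong:
  assumes "open S" "y \<in> S" "\<And>z. z \<in> S \<Longrightarrow> f z = h z" "mdiff f y"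
  shows "mdiff h y" "pushf h y a = pushf f y a"
proof -
  have y: "h y = f y" using assms by auto
  have d: "((cmap d \<circ> h) has_derivative (\<lambda>a. pushf f y a d)) (at y)" if "d \<in> \<A>" "f y \<in> cdom d" for d
    by (rule has_derivative_transform_within_open[OF mdiff_chart[OF assms(4) that] assms(1,2)])
       (simp add: assms(3))
  obtain c where c: "c \<in> \<A>" "f y \<in> cdom c" using chart_ex by blast
  have "isCont f y" using assms(4) by (simp add: mdiff_def)
  moreover have "\<forall>\<^sub>F z in nhds y. f z = h z"
    using eventually_nhds_in_open[OF assms(1,2)] by eventually_elim (rule assms(3))
  ultimately have "isCont h y" using isCont_cong[of f h y] by simp
  with c d[OF c] y show m: "mdiff h y" unfolding mdiff_def differentiable_def by auto
  show "pushf h y a = pushf f y a"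
  proof
    fix e
    show "pushf h y a e = pushf f y a e"
    proof (cases "e \<in> \<A> \<and> f y \<in> cdom e")
      case True
      then show ?thesis using pushf_component[OF d] y by auto
    next
      case False
      then show ?thesis using y by (auto simp: pushf_def)
    qed
  qed
qed

end

text \<open>The infimum of the counterexamples satisfies the claim by \<open>left\<close>, and
  \<open>right\<close> then pushes it further up. The start s = 0 is contained in
  \<open>left\<close> with a vacuous premise.\<close>

lemma real_interval_induct:
  fixes P :: "real \<Rightarrow> bool"
  assumes left: "\<And>s. 0 \<le> s \<Longrightarrow> s \<le> 1 \<Longrightarrow> (\<And>r. 0 \<le> r \<Longrightarrow> r < s \<Longrightarrow> P r) \<Longrightarrow> P s"
    and right: "\<And>s. 0 \<le> s \<Longrightarrow> s < 1 \<Longrightarrow> P s \<Longrightarrow> \<exists>s'>s. \<forall>r. s \<le> r \<and> r < s' \<and> r \<le> 1 \<longrightarrow> P r"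
    and s: "0 \<le> s" "s \<le> 1"
  shows "P s"
proof (rule ccontr)
  assume "\<not> P s"
  define N where "N = {r. 0 \<le> r \<and> r \<le> 1 \<and> \<not> P r}"
  have ne: "N \<noteq> {}" and bdd: "bdd_below N" using s \<open>\<not> P s\<close> by (auto simp: N_def bdd_below_def)
  define m where "m = Inf N"
  have m0: "0 \<le> m" unfolding m_def by (rule cInf_greatest[OF ne]) (simp add: N_def)
  have m1: "m \<le> 1" using cInf_lower[OF _ bdd, of s] s \<open>\<not> P s\<close> by (simp add: m_def N_def)
  have below: "P r" if "0 \<le> r" "r < m" for r
    using cInf_lower[OF _ bdd, of r] that m1 by (force simp: m_def N_def)
  have Pm: "P m" by (rule left[OF m0 m1 below])
  show False
  proof (cases "m < 1")
    case True
    then obtain s' where s': "s' > m" "\<And>r. m \<le> r \<Longrightarrow> r < s' \<Longrightarrow> r \<le> 1 \<Longrightarrow> P r"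
      using right[OF m0 _ Pm] by blast
    have "s' \<le> Inf N"
    proof (rule cInf_greatest[OF ne])
      fix r assume "r \<in> N"
      then have r: "0 \<le> r" "r \<le> 1" "\<not> P r" by (auto simp: N_def)
      show "s' \<le> r"
      proof (rule ccontr)
        assume "\<not> s' \<le> r"
        then show False using r s'(2)[of r] below[of r] by (cases "m \<le> r") auto
      qed
    qed
    then show False using s'(1) by (simp add: m_def)
  next
    case False
    then have "m = 1" using m1 by simp
    then have "P s" using below[of s] Pm s by (cases "s = 1") auto
    then show False using \<open>\<not> P s\<close> by simp
  qed
qed

context riemannian
begin

section \<open>Geodesics\<close>

lemma geodesic_onD:
  assumes "geodesic_on \<A> g {0..1} \<gamma>" "t \<in> {0..1}" "c \<in> \<A>" "\<gamma> t \<in> cdom c"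
  defines "q \<equiv> cmap c \<circ> \<gamma>"
  defines "a \<equiv> \<lambda>s. vector_derivative q (at s within {0..1})"
  shows "(q has_vector_derivative a t) (at t within {0..1})"
    and "(a has_vector_derivative - coord_metric.chris (mc c) (q t) (a t) (a t)) (at t within {0..1})"
  using assms by (auto simp: geodesic_on_def Let_def vector_derivative_works christoffel_eq)

lemma continuous_within_eventually:
  assumes "continuous_on J \<gamma>" "t \<in> J" "open S" "\<gamma> t \<in> S"
  shows "\<forall>\<^sub>F s in at t within J. \<gamma> s \<in> S"
  using assms by (auto simp: continuous_on_def intro: topological_tendstoD)

lemma geodesic_continuous: "geodesic_on \<A> g J \<gamma> \<Longrightarrow> continuous_on J \<gamma>"
  by (simp add: geodesic_on_def)

lemma geodesic_velocity_in:
  assumes \<gamma>: "geodesic_on \<A> g {0..1} \<gamma>" and t: "t \<in> {0..1}"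
  shows "velocity \<A> {0..1} \<gamma> t \<in> tangent_space \<A> (\<gamma> t)"
proof -
  have "velocity \<A> {0..1} \<gamma> t d = transition c d (\<gamma> t) (velocity \<A> {0..1} \<gamma> t c)"
    if cd: "c \<in> \<A>" "d \<in> \<A>" "\<gamma> t \<in> cdom c" "\<gamma> t \<in> cdom d" for c d
  proof -
    have "((cmap d \<circ> \<gamma>) has_derivative (\<lambda>h. transition c d (\<gamma> t) (h *\<^sub>R vector_derivative (cmap c \<circ> \<gamma>) (at t within {0..1})))) (at t within {0..1})"
      by (rule has_derivative_change_chart[where \<gamma> = \<gamma> and s = t, OF cd t])
         (use continuous_within_eventually[OF geodesic_continuous[OF \<gamma>] t open_cdom[OF cd(1)] cd(3)]
           geodesic_onD(1)[OF \<gamma> t cd(1,3)] in \<open>auto simp: has_vector_derivative_def\<close>)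
    then have "((cmap d \<circ> \<gamma>) has_vector_derivative transition c d (\<gamma> t) (vector_derivative (cmap c \<circ> \<gamma>) (at t within {0..1}))) (at t within {0..1})"
      using transition_linear[OF cd] by (simp add: has_vector_derivative_def linear_scale)
    then have "vector_derivative (cmap d \<circ> \<gamma>) (at t within {0..1}) = transition c d (\<gamma> t) (vector_derivative (cmap c \<circ> \<gamma>) (at t within {0..1}))"
      using t by (intro vector_derivative_within_closed_interval) auto
    then show ?thesis using cd by (simp add: velocity_def)
  qed
  moreover have "velocity \<A> {0..1} \<gamma> t d = 0" if "\<not> (d \<in> \<A> \<and> \<gamma> t \<in> cdom d)" for d
    using that by (auto simp: velocity_def)
  ultimately show ?thesis unfolding tangent_space_iff by blast
qed

lemma tangent_eqI:
  assumes "v \<in> tangent_space \<A> x" "w \<in> tangent_space \<A> x" "c \<in> \<A>" "x \<in> cdom c" "v c = w c"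
  shows "v = w"
proof -
  have "v = tvec_of \<A> c x (v c)" by (rule tvec_of_component_self[OF assms(1,3,4), symmetric])
  also have "\<dots> = tvec_of \<A> c x (w c)" by (simp only: assms(5))
  also have "\<dots> = w" by (rule tvec_of_component_self[OF assms(2,3,4)])
  finally show ?thesis .
qed

text \<open>Agreement passes to limits from the left: for positions by continuity, for velocities
  because their components in a chart around the limit point are differentiable, hence
  continuous.\<close>

lemma geodesic_unique_left:
  assumes \<gamma>: "geodesic_on \<A> g {0..1} \<gamma>" and \<delta>: "geodesic_on \<A> g {0..1} \<delta>"
    and s: "0 < s" "s \<le> 1"
    and eq: "\<And>r. 0 \<le> r \<Longrightarrow> r < s \<Longrightarrow> \<gamma> r = \<delta> r \<and> velocity \<A> {0..1} \<gamma> r = velocity \<A> {0..1} \<delta> r"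
  shows "\<gamma> s = \<delta> s \<and> velocity \<A> {0..1} \<gamma> s = velocity \<A> {0..1} \<delta> s"
proof -
  let ?F = "at s within {0..<s}"
  have nt: "?F \<noteq> bot" using s by (simp add: trivial_limit_within islimpt_Ico)
  have sI: "s \<in> {0..1}" using s by auto
  have sub: "{0..<s} \<subseteq> {0..1}" using s by auto
  have lim: "(f \<longlongrightarrow> f s) ?F" if "continuous_on {0..1} f" for f :: "real \<Rightarrow> 'm"
  proof -
    have "(f \<longlongrightarrow> f s) (at s within {0..1})" using that sI by (simp add: continuous_on_def)
    then show ?thesis by (rule tendsto_within_subset[OF _ sub])
  qed
  have ev: "\<forall>\<^sub>F r in ?F. r \<in> {0..<s}" by (simp add: eventually_at_filter)
  have "(\<gamma> \<longlongrightarrow> \<delta> s) ?F"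
    by (rule Lim_transform_eventually[OF lim[OF geodesic_continuous[OF \<delta>]]])
       (use ev in \<open>eventually_elim, use eq in auto\<close>)
  then have e: "\<gamma> s = \<delta> s" using tendsto_unique[OF nt lim[OF geodesic_continuous[OF \<gamma>]]] by blast
  obtain c where c: "c \<in> \<A>" "\<gamma> s \<in> cdom c" using chart_ex by blast
  let ?a = "\<lambda>s. vector_derivative (cmap c \<circ> \<gamma>) (at s within {0..1})"
  let ?b = "\<lambda>s. vector_derivative (cmap c \<circ> \<delta>) (at s within {0..1})"
  have evc: "\<forall>\<^sub>F r in ?F. \<gamma> r \<in> cdom c"
    by (rule topological_tendstoD[OF lim[OF geodesic_continuous[OF \<gamma>]] open_cdom[OF c(1)] c(2)])
  have la: "(?a \<longlongrightarrow> ?a s) ?F"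
    using has_vector_derivative_continuous[OF geodesic_onD(2)[OF \<gamma> sI c]]
    unfolding continuous_within by (rule tendsto_within_subset[OF _ sub])
  have lb: "(?b \<longlongrightarrow> ?b s) ?F"
    using has_vector_derivative_continuous[OF geodesic_onD(2)[OF \<delta> sI c(1) c(2)[unfolded e]]]
    unfolding continuous_within by (rule tendsto_within_subset[OF _ sub])
  have "(?a \<longlongrightarrow> ?b s) ?F"
  proof (rule Lim_transform_eventually[OF lb])
    show "\<forall>\<^sub>F r in ?F. ?b r = ?a r"
      using ev evc
    proof eventually_elim
      case (elim r)
      then have *: "\<gamma> r = \<delta> r" "velocity \<A> {0..1} \<gamma> r c = velocity \<A> {0..1} \<delta> r c" using eq[of r] by auto
      then show ?case using elim c by (simp add: velocity_def)
    qed
  qed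
  then have "?a s = ?b s" using tendsto_unique[OF nt la] by blast
  then have "velocity \<A> {0..1} \<gamma> s c = velocity \<A> {0..1} \<delta> s c"
    using c e by (simp add: velocity_def)
  then show ?thesis
    using e tangent_eqI[OF geodesic_velocity_in[OF \<gamma> sI] _ c] geodesic_velocity_in[OF \<delta> sI] by auto
qed

text \<open>Common position and velocity at s pose an initial value problem in one chart. A closed
  coordinate ball serves as the compact convex set in
  \<open>geodesic_unique_in_chart\<close>.\<close>

lemma geodesic_unique_right:
  assumes \<gamma>: "geodesic_on \<A> g {0..1} \<gamma>" and \<delta>: "geodesic_on \<A> g {0..1} \<delta>"
    and s: "0 \<le> s" "s < 1"
    and eq: "\<gamma> s = \<delta> s" "velocity \<A> {0..1} \<gamma> s = velocity \<A> {0..1} \<delta> s"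
  shows "\<exists>s'>s. \<forall>r. s \<le> r \<and> r < s' \<and> r \<le> 1 \<longrightarrow>
    \<gamma> r = \<delta> r \<and> velocity \<A> {0..1} \<gamma> r = velocity \<A> {0..1} \<delta> r"
proof -
  have sI: "s \<in> {0..1}" using s by auto
  obtain c where c: "c \<in> \<A>" "\<gamma> s \<in> cdom c" using chart_ex by blast
  interpret coord_metric "cran c" "mc c" by (rule coord_metric[OF c(1)])
  let ?q = "cmap c \<circ> \<gamma>" and ?p = "cmap c \<circ> \<delta>"
  let ?a = "\<lambda>s. vector_derivative ?q (at s within {0..1})"
  let ?b = "\<lambda>s. vector_derivative ?p (at s within {0..1})"
  have "?q s \<in> cran c" using c by auto
  then obtain e where e: "0 < e" "cball (?q s) e \<subseteq> cran c"
    using open_cran[OF c(1)] open_contains_cball by blast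
  define S where "S = cdom c \<inter> cmap c -` ball (?q s) e"
  have "open S"
    unfolding S_def by (rule continuous_open_preimage[OF continuous_cmap[OF c(1)] open_cdom[OF c(1)]]) simp
  have "\<gamma> s \<in> S" using c e by (simp add: S_def)
  have "\<forall>\<^sub>F r in at s within {0..1}. \<gamma> r \<in> S \<and> \<delta> r \<in> S"
    using continuous_within_eventually[OF geodesic_continuous[OF \<gamma>] sI \<open>open S\<close> \<open>\<gamma> s \<in> S\<close>]
      continuous_within_eventually[OF geodesic_continuous[OF \<delta>] sI \<open>open S\<close>] \<open>\<gamma> s \<in> S\<close> eq
    by (simp add: eventually_conj_iff)
  then obtain h where h: "0 < h" "\<And>r. r \<in> {0..1} \<Longrightarrow> dist r s < h \<Longrightarrow> \<gamma> r \<in> S \<and> \<delta> r \<in> S"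
    using \<open>\<gamma> s \<in> S\<close> eq unfolding eventually_at by (metis)
  \<comment> \<open>Half of h keeps the closed interval strictly inside the range where both curves
    are known to stay in S.\<close>
  define s1 where "s1 = min 1 (s + h / 2)"
  have s1: "s < s1" "s1 \<le> 1" using s h(1) by (auto simp: s1_def)
  have sub: "{s..s1} \<subseteq> {0..1}" using s s1 by auto
  have inS: "\<gamma> r \<in> S \<and> \<delta> r \<in> S" if "r \<in> {s..s1}" for r
  proof (rule h(2))
    show "r \<in> {0..1}" using that sub by auto
    have "\<bar>r - s\<bar> \<le> h / 2" using that by (auto simp: s1_def)
    then show "dist r s < h" using h(1) by (simp add: dist_real_def)
  qed
  have inc: "\<gamma> r \<in> cdom c" "\<delta> r \<in> cdom c" if "r \<in> {s..s1}" for r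
    using inS[OF that] by (auto simp: S_def)
  have ab: "?q r = ?p r \<and> ?a r = ?b r" if r: "r \<in> {s..s1}" for r
  proof (rule geodesic_unique_in_chart[OF compact_cball convex_cball e(2) _ _ _ _ _ _ _ _ r])
    fix r assume r: "r \<in> {s..s1}"
    then have rI: "r \<in> {0..1}" using sub by auto
    show "(?q has_vector_derivative ?a r) (at r within {s..s1})"
      by (rule has_vector_derivative_within_subset[OF geodesic_onD(1)[OF \<gamma> rI c(1) inc(1)[OF r]] sub])
    show "(?p has_vector_derivative ?b r) (at r within {s..s1})"
      by (rule has_vector_derivative_within_subset[OF geodesic_onD(1)[OF \<delta> rI c(1) inc(2)[OF r]] sub])
    show "(?a has_vector_derivative - chris (?q r) (?a r) (?a r)) (at r within {s..s1})"
      by (rule has_vector_derivative_within_subset[OF geodesic_onD(2)[OF \<gamma> rI c(1) inc(1)[OF r]] sub])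
    show "(?b has_vector_derivative - chris (?p r) (?b r) (?b r)) (at r within {s..s1})"
      by (rule has_vector_derivative_within_subset[OF geodesic_onD(2)[OF \<delta> rI c(1) inc(2)[OF r]] sub])
    show "?q r \<in> cball (?q s) e" "?p r \<in> cball (?q s) e"
      using inS[OF r] by (auto simp: S_def)
  next
    show "?q s = ?p s" using eq by simp
    have "velocity \<A> {0..1} \<gamma> s c = velocity \<A> {0..1} \<delta> s c" using eq by simp
    then show "?a s = ?b s" using c eq(1) by (simp add: velocity_def)
  qed
  have "\<gamma> r = \<delta> r \<and> velocity \<A> {0..1} \<gamma> r = velocity \<A> {0..1} \<delta> r" if r: "r \<in> {s..s1}" for r
  proof -
    have rI: "r \<in> {0..1}" using r sub by auto
    have e: "\<gamma> r = \<delta> r"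
      using ab[OF r] inc[OF r] cinv_cmap[OF c(1)] by (metis comp_apply)
    have "velocity \<A> {0..1} \<gamma> r c = velocity \<A> {0..1} \<delta> r c"
      using ab[OF r] inc[OF r] c(1) by (simp add: velocity_def)
    then show ?thesis
      using e tangent_eqI[OF geodesic_velocity_in[OF \<gamma> rI] _ c(1) inc(1)[OF r]] geodesic_velocity_in[OF \<delta> rI] by auto
  qed
  then show ?thesis using s1 by (intro exI[of _ s1]) auto
qed

text \<open>Makes the description in \<open>exp_map\<close> proper. The velocity is carried along in
  the induction because the position alone does not determine the continuation.\<close>

lemma geodesic_unique:
  assumes \<gamma>: "geodesic_from \<A> g x v \<gamma>" and \<delta>: "geodesic_from \<A> g x v \<delta>" and s: "s \<in> {0..1}"
  shows "\<gamma> s = \<delta> s"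
proof -
  let ?P = "\<lambda>s. \<gamma> s = \<delta> s \<and> velocity \<A> {0..1} \<gamma> s = velocity \<A> {0..1} \<delta> s"
  have \<gamma>': "geodesic_on \<A> g {0..1} \<gamma>" and \<delta>': "geodesic_on \<A> g {0..1} \<delta>" and init: "?P 0"
    using \<gamma> \<delta> by (auto simp: geodesic_from_def)
  have "?P s"
  proof (rule real_interval_induct[of ?P])
    show "?P s" if "0 \<le> s" "s \<le> 1" "\<And>r. 0 \<le> r \<Longrightarrow> r < s \<Longrightarrow> ?P r" for s
    proof (cases "s = 0")
      case False
      show ?thesis by (rule geodesic_unique_left[OF \<gamma>' \<delta>' _ that(2,3)]) (use that(1) False in auto)
    qed (use init in simp)
    show "\<exists>s'>s. \<forall>r. s \<le> r \<and> r < s' \<and> r \<le> 1 \<longrightarrow> ?P r" if "0 \<le> s" "s < 1" "?P s" for s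
      using geodesic_unique_right[OF \<gamma>' \<delta>' that(1,2)] that(3) by blast
  qed (use s in auto)
  then show ?thesis by blast
qed

lemma exp_map_eq:
  assumes "geodesic_from \<A> g x v \<gamma>" shows "exp_map \<A> g x v = \<gamma> 1"
  unfolding exp_map_def
proof (rule the_equality)
  show "\<exists>\<gamma>'. geodesic_from \<A> g x v \<gamma>' \<and> \<gamma>' 1 = \<gamma> 1" using assms by blast
  show "y = \<gamma> 1" if ex: "\<exists>\<gamma>'. geodesic_from \<A> g x v \<gamma>' \<and> \<gamma>' 1 = y" for y
  proof -
    obtain \<gamma>' where "geodesic_from \<A> g x v \<gamma>'" "\<gamma>' 1 = y" using ex by blast
    with geodesic_unique[OF this(1) assms, of 1] show ?thesis by simp
  qed
qed

end

section \<open>Reparametrisation of geodesics\<close>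

context coord_metric
begin

lemma
  assumes "y \<in> W"
  shows dG_scale: "dG y (r *\<^sub>R a) u v = r * dG y a u v"
    and dG_scale_left: "dG y a (r *\<^sub>R u) v = r * dG y a u v"
    and dG_scale_right: "dG y a u (r *\<^sub>R v) = r * dG y a u v"
  using linear_scale[OF dG_linear[OF assms]] linear_scale[OF dG_linear_left[OF assms]]
    linear_scale[OF dG_linear_right[OF assms]] by auto

text \<open>Quadratic homogeneity is the reason why a geodesic slowed down by the factor k is again
  a geodesic. It is verified on the represented form, as \<open>chris\<close> is not given by an
  explicit formula.\<close>

lemma chris_scale:
  assumes y: "y \<in> W" shows "chris y (k *\<^sub>R a) (k *\<^sub>R a) = (k * k) *\<^sub>R chris y a a"
proof -
  let ?z = "(k * k) *\<^sub>R chris y a a"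
  have "G y ?z w = force y (k *\<^sub>R a) w" for w
    unfolding force_def dG_scale[OF y] dG_scale_left[OF y] dG_scale_right[OF y] G_scale_left[OF y] chris_same[OF y]
    by (simp add: algebra_simps)
  then have "G y (chris y (k *\<^sub>R a) (k *\<^sub>R a) - ?z) w = 0" for w
    unfolding G_diff_left[OF y] chris_same[OF y] force_def by simp
  then have "chris y (k *\<^sub>R a) (k *\<^sub>R a) - ?z = 0"
    using G_pos[OF y, of "chris y (k *\<^sub>R a) (k *\<^sub>R a) - ?z"] by force
  then show ?thesis by simp
qed

end

context riemannian
begin

lemma geodesic_rescale:
  assumes \<gamma>: "geodesic_from \<A> g x v \<gamma>" and k: "0 < k" "k \<le> 1"
  shows "geodesic_from \<A> g x (\<lambda>c. k *\<^sub>R v c) (\<lambda>s. \<gamma> (k * s))"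
proof -
  let ?I = "{0..1::real}"
  let ?\<delta> = "\<lambda>s. \<gamma> (k * s)"
  have g: "geodesic_on \<A> g ?I \<gamma>" and init: "\<gamma> 0 = x" "velocity \<A> ?I \<gamma> 0 = v"
    using \<gamma> by (auto simp: geodesic_from_def)
  have kI: "k * s \<in> ?I" if "s \<in> ?I" for s using that k by (auto simp: mult_le_one)
  have sub: "(\<lambda>s. k * s) ` ?I \<subseteq> ?I" using kI by auto
  have lin: "((\<lambda>s. k * s) has_vector_derivative k) (at s within ?I)" for s
    by (auto intro!: derivative_eq_intros simp: has_real_derivative_iff_has_vector_derivative[symmetric])
  have cont: "continuous_on ?I ?\<delta>"
    by (rule continuous_on_compose2[OF geodesic_continuous[OF g] _ sub]) (intro continuous_intros)
  have chain: "((\<lambda>s. f (k * s)) has_vector_derivative k *\<^sub>R f') (at s within ?I)"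
    if "(f has_vector_derivative f') (at (k * s) within ?I)" for f :: "real \<Rightarrow> 'e" and f' s
    using vector_diff_chain_within[OF lin has_vector_derivative_within_subset[OF that sub]] by (simp add: o_def)
  have d1: "((cmap c \<circ> ?\<delta>) has_vector_derivative k *\<^sub>R vector_derivative (cmap c \<circ> \<gamma>) (at (k * s) within ?I)) (at s within ?I)"
    if "s \<in> ?I" "c \<in> \<A>" "?\<delta> s \<in> cdom c" for s c
    using chain[OF geodesic_onD(1)[OF g kI[OF that(1)] that(2,3)]] by (simp add: o_def)
  have vd: "vector_derivative (cmap c \<circ> ?\<delta>) (at s within ?I) = k *\<^sub>R vector_derivative (cmap c \<circ> \<gamma>) (at (k * s) within ?I)"
    if "s \<in> ?I" "c \<in> \<A>" "?\<delta> s \<in> cdom c" for s c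
    using d1[OF that] that(1) by (intro vector_derivative_within_closed_interval) auto
  have "geodesic_on \<A> g ?I ?\<delta>"
    unfolding geodesic_on_def Let_def
  proof (intro conjI ballI impI cont)
    fix t c assume t: "t \<in> ?I" and c: "c \<in> \<A>" and tc: "?\<delta> t \<in> cdom c"
    interpret coord_metric "cran c" "mc c" by (rule coord_metric[OF c])
    let ?q = "cmap c \<circ> ?\<delta>"
    let ?a = "\<lambda>s. vector_derivative (cmap c \<circ> \<gamma>) (at s within ?I)"
    show "?q differentiable (at t within ?I)"
      using d1[OF t c tc] by (rule differentiableI_vector)
    have "((\<lambda>s. ?a (k * s)) has_vector_derivative k *\<^sub>R (- chris (?q t) (?a (k * t)) (?a (k * t)))) (at t within ?I)"
      using chain[OF geodesic_onD(2)[OF g kI[OF t] c tc]] by simp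
    from bounded_linear.has_vector_derivative[OF bounded_linear_scaleR_right[of k] this]
    have "((\<lambda>s. k *\<^sub>R ?a (k * s)) has_vector_derivative k *\<^sub>R (k *\<^sub>R (- chris (?q t) (?a (k * t)) (?a (k * t))))) (at t within ?I)" .
    moreover have "k *\<^sub>R (k *\<^sub>R (- chris (?q t) (?a (k * t)) (?a (k * t)))) = - chris (?q t) (k *\<^sub>R ?a (k * t)) (k *\<^sub>R ?a (k * t))"
      using tc by (subst chris_scale) auto
    ultimately have d: "((\<lambda>s. k *\<^sub>R ?a (k * s)) has_vector_derivative - chris (?q t) (k *\<^sub>R ?a (k * t)) (k *\<^sub>R ?a (k * t))) (at t within ?I)"
      by simp
    have "\<forall>\<^sub>F s in at t within ?I. s \<in> ?I \<and> ?\<delta> s \<in> cdom c"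
      using continuous_within_eventually[OF cont t open_cdom[OF c] tc]
      by (simp add: eventually_conj_iff eventually_at_filter)
    \<comment> \<open>The velocity formula is available only for parameters in the interval whose
      points lie in the chart, so its derivative is transferred along an eventual equality.\<close>
    then have ev: "\<forall>\<^sub>F s in at t within ?I. k *\<^sub>R ?a (k * s) = vector_derivative ?q (at s within ?I)"
      by eventually_elim (use vd c in auto)
    from has_derivative_transform_eventually[OF d[unfolded has_vector_derivative_def] ev _ t]
    show "((\<lambda>s. vector_derivative ?q (at s within ?I)) has_vector_derivative
        - christoffel \<A> g c (?q t) (vector_derivative ?q (at t within ?I)) (vector_derivative ?q (at t within ?I))) (at t within ?I)"
      using vd[OF t c tc] by (simp add: has_vector_derivative_def christoffel_eq[OF c])
  qed
  moreover have "velocity \<A> ?I ?\<delta> 0 = (\<lambda>c. k *\<^sub>R v c)"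
  proof
    fix c
    have "velocity \<A> ?I ?\<delta> 0 c = k *\<^sub>R velocity \<A> ?I \<gamma> 0 c"
      by (cases "c \<in> \<A> \<and> \<gamma> 0 \<in> cdom c") (use vd[of 0 c] in \<open>auto simp: velocity_def\<close>)
    then show "velocity \<A> ?I ?\<delta> 0 c = k *\<^sub>R v c" by (simp add: init(2))
  qed
  ultimately show ?thesis using init(1) by (simp add: geodesic_from_def)
qed

text \<open>Identifies radial lines in the tangent space with one and the same geodesic. The value k
  = 0 is recovered later by continuity.\<close>

lemma exp_map_scale:
  assumes "geodesic_from \<A> g x v \<gamma>" "0 < k" "k \<le> 1"
  shows "exp_map \<A> g x (\<lambda>c. k *\<^sub>R v c) = \<gamma> k"
  using exp_map_eq[OF geodesic_rescale[OF assms]] by simp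

end

section \<open>Maps of class C^1 from Euclidean sets into the manifold\<close>

context riemannian
begin

text \<open>The source carries no atlas, so only target charts are tested. Curves and the
  exponential map are both treated as such maps.\<close>

definition C1m :: "'a::euclidean_space set \<Rightarrow> ('a \<Rightarrow> 'm) \<Rightarrow> bool" where
  "C1m S f \<longleftrightarrow> open S \<and> continuous_on S f \<and>
     (\<forall>d\<in>\<A>. C_nat_on (Suc 0) (S \<inter> f -` cdom d) (cmap d \<circ> f))"

lemma Ck_map_euclidean_chart:
  assumes "Ck_map k euclidean_atlas \<A> S f" "d \<in> \<A>" "enat n \<le> k"
  shows "C_nat_on n (S \<inter> f -` cdom d) (cmap d \<circ> f)"
proof -
  have "Ck_on k (id ` (S \<inter> UNIV \<inter> f -` cdom d)) (cmap d \<circ> f \<circ> inv_into UNIV id)"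
    using assms(1,2) unfolding Ck_map_def euclidean_atlas_def by fastforce
  then show ?thesis using assms(3) by (simp add: Ck_on_def)
qed

lemma C1m_Ck_map:
  assumes "Ck_map k euclidean_atlas \<A> S f" "1 \<le> k" "open S"
  shows "C1m S f"
  using assms Ck_map_euclidean_chart[OF assms(1), of _ "Suc 0"]
  by (auto simp: C1m_def Ck_map_def one_enat_def)

lemma C1m_open_preimage: "C1m S f \<Longrightarrow> open V \<Longrightarrow> open (S \<inter> f -` V)"
  unfolding C1m_def by (simp add: continuous_open_preimage)

lemma C1m_mdiff:
  assumes "C1m S f" "y \<in> S" shows "mdiff f y"
proof -
  obtain c where c: "c \<in> \<A>" "f y \<in> cdom c" using chart_ex by blast
  have "isCont f y" using assms by (auto simp: C1m_def continuous_on_eq_continuous_at)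
  moreover have "(cmap c \<circ> f) differentiable (at y)" using assms c by (auto simp: C1m_def)
  ultimately show ?thesis using c by (auto simp: mdiff_def)
qed

text \<open>Each parameter is treated in a chart around its image, on the relatively open set of
  parameters that stay in it. The inner map h and the directions w, z let one statement cover speeds
  of curves and the products in the Gauss lemma.\<close>

lemma continuous_metric_pushf:
  fixes f :: "'a::euclidean_space \<Rightarrow> 'm" and h :: "'b::t2_space \<Rightarrow> 'a"
  assumes f: "C1m S f" and h: "continuous_on T h" "h ` T \<subseteq> S"
    and w: "continuous_on T w" and z: "continuous_on T z"
  shows "continuous_on T (\<lambda>s. g (f (h s)) (pushf f (h s) (w s)) (pushf f (h s) (z s)))" (is "continuous_on T ?F")
  unfolding continuous_on_eq_continuous_within
proof
  fix s0 assume s0: "s0 \<in> T"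
  obtain d where d: "d \<in> \<A>" "f (h s0) \<in> cdom d" using chart_ex by blast
  interpret coord_metric "cran d" "mc d" by (rule coord_metric[OF d(1)])
  have fh: "continuous_on T (\<lambda>s. f (h s))"
    using f h by (auto simp: C1m_def intro: continuous_on_compose2)
  then obtain U where U: "open U" "U \<inter> T = (\<lambda>s. f (h s)) -` cdom d \<inter> T"
    using open_cdom[OF d(1)] unfolding continuous_on_open_invariant by blast
  let ?T = "U \<inter> T"
  have im: "h ` ?T \<subseteq> S \<inter> f -` cdom d" using h(2) U(2) by auto
  have C1: "C_nat_on (Suc 0) (S \<inter> f -` cdom d) (cmap d \<circ> f)" using f d by (simp add: C1m_def)
  have cont: "continuous_on ?T h" "continuous_on ?T w" "continuous_on ?T z"
    using h(1) w z continuous_on_subset by blast+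
  have "continuous_on ?T (\<lambda>s. mc d ((cmap d \<circ> f) (h s)) (frechet_derivative (cmap d \<circ> f) (at (h s)) (w s))
     (frechet_derivative (cmap d \<circ> f) (at (h s)) (z s)))"
  proof (rule continuous_on_G)
    show "continuous_on ?T (\<lambda>s. (cmap d \<circ> f) (h s))"
      by (rule continuous_on_compose2[OF C_nat_on_SucD[OF C1, simplified C_nat_on.simps] cont(1) im])
    show "continuous_on ?T (\<lambda>s. frechet_derivative (cmap d \<circ> f) (at (h s)) (w s))"
      by (rule continuous_on_frechet_derivative_compose[OF C1 im cont(1,2)])
    show "continuous_on ?T (\<lambda>s. frechet_derivative (cmap d \<circ> f) (at (h s)) (z s))"
      by (rule continuous_on_frechet_derivative_compose[OF C1 im cont(1,3)])
    show "(\<lambda>s. (cmap d \<circ> f) (h s)) ` ?T \<subseteq> cran d" using U(2) by auto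
  qed
  then have "continuous_on ?T ?F"
  proof (rule continuous_on_eq)
    fix s assume s: "s \<in> ?T"
    then have "f (h s) \<in> cdom d" "h s \<in> S" using U(2) h(2) by auto
    then show "mc d ((cmap d \<circ> f) (h s)) (frechet_derivative (cmap d \<circ> f) (at (h s)) (w s))
       (frechet_derivative (cmap d \<circ> f) (at (h s)) (z s)) = ?F s"
      using metric_pushf[OF C1m_mdiff[OF f] d(1)] d(1) by (simp add: pushf_def)
  qed
  moreover have "s0 \<in> ?T" using s0 d U(2) by auto
  ultimately have "continuous (at s0 within ?T) ?F" by (auto simp: continuous_on_eq_continuous_within)
  moreover have "at s0 within ?T = at s0 within T"
    by (rule at_within_nhd[of s0 U]) (use \<open>s0 \<in> ?T\<close> U(1) in auto)
  ultimately show "continuous (at s0 within T) ?F" by simp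
qed

lemma C1m_has_derivative:
  assumes "C1m S f" "y \<in> S" "d \<in> \<A>" "f y \<in> cdom d"
  shows "((cmap d \<circ> f) has_derivative frechet_derivative (cmap d \<circ> f) (at y)) (at y)"
  by (rule C_nat_on_has_derivative[of 0 "S \<inter> f -` cdom d"]) (use assms in \<open>auto simp: C1m_def\<close>)

end

section \<open>Normal balls\<close>

locale normal_ball = riemannian \<A> g
  for \<A> :: "('m::{t2_space,second_countable_topology}, 'e::euclidean_space) chart set" and g +
  fixes p :: 'm and c0 :: "('m, 'e) chart" and r :: real
  assumes c0: "c0 \<in> \<A>" "p \<in> cdom c0" and r: "0 < r"
    and exp_defined: "{v \<in> tangent_space \<A> p. sqrt (g p v v) < r} \<subseteq> exp_domain \<A> g p"
    and exp_diffeo: "Ck_diffeo_onto_open_image \<infinity> euclidean_atlas \<A>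
          {u. sqrt (g p (tvec_of \<A> c0 p u) (tvec_of \<A> c0 p u)) < r}
          (\<lambda>u. exp_map \<A> g p (tvec_of \<A> c0 p u))"
begin

definition N :: "'e \<Rightarrow> 'e \<Rightarrow> real" where "N u v = mc c0 (cmap c0 p) u v"

definition B :: "'e set" where "B = {u. sqrt (N u u) < r}"

definition E :: "'e \<Rightarrow> 'm" where "E u = exp_map \<A> g p (tvec_of \<A> c0 p u)"

sublocale M0: coord_metric "cran c0" "mc c0" by (rule coord_metric[OF c0(1)])

lemma y0: "cmap c0 p \<in> cran c0" using c0 by blast

lemma N_metric: "g p (tvec_of \<A> c0 p u) (tvec_of \<A> c0 p v) = N u v"
  unfolding N_def by (rule metric_tvec_of[OF c0])

lemma E_diffeo: "Ck_diffeo_onto_open_image \<infinity> euclidean_atlas \<A> B E"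
  using exp_diffeo unfolding N_metric B_def E_def[abs_def] .

lemma N_scale: "N (k *\<^sub>R u) (k *\<^sub>R u) = k * k * N u u"
  unfolding N_def by (simp add: M0.G_scale_left[OF y0] M0.G_scale_right[OF y0])

lemma N_nonneg: "0 \<le> N u u"
  unfolding N_def by (rule M0.G_nonneg[OF y0])

lemma N_zero [simp]: "N 0 0 = 0"
  using N_scale[of 0 0] by simp

lemma sqrt_N_scale: "0 \<le> k \<Longrightarrow> sqrt (N (k *\<^sub>R u) (k *\<^sub>R u)) = k * sqrt (N u u)"
  by (simp add: N_scale real_sqrt_mult)

lemma open_B: "open B" and open_EB: "open (E ` B)" and inj_E: "inj_on E B"
  and E_smooth: "Ck_map \<infinity> euclidean_atlas \<A> B E"
  and E_inv_smooth: "Ck_map \<infinity> \<A> euclidean_atlas (E ` B) (inv_into B E)"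
  using E_diffeo by (simp_all add: Ck_diffeo_onto_open_image_def)

lemma zero_in_B: "0 \<in> B" using r by (simp add: B_def)

lemma B_star: assumes "u \<in> B" "0 \<le> k" "k \<le> 1" shows "k *\<^sub>R u \<in> B"
proof -
  have "k * sqrt (N u u) \<le> 1 * sqrt (N u u)" using assms N_nonneg by (intro mult_right_mono) auto
  then show ?thesis using assms by (simp add: B_def sqrt_N_scale)
qed

lemma E_C1m: "C1m B E"
  by (rule C1m_Ck_map[OF E_smooth _ open_B]) simp

lemma E_C2: "d \<in> \<A> \<Longrightarrow> C_nat_on 2 (B \<inter> E -` cdom d) (cmap d \<circ> E)"
  by (rule Ck_map_euclidean_chart[OF E_smooth]) simp_all

lemma open_E_preimage: "d \<in> \<A> \<Longrightarrow> open (B \<inter> E -` cdom d)"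
  by (rule C1m_open_preimage[OF E_C1m open_cdom])

lemma tvec_scale: "tvec_of \<A> c0 p (k *\<^sub>R u) = (\<lambda>c. k *\<^sub>R tvec_of \<A> c0 p u c)"
  using tvec_of_linear[OF c0, of k u 0 u] by simp

lemma continuous_radial: "u \<in> B \<Longrightarrow> continuous_on {0..1} (\<lambda>s. E (s *\<^sub>R u))"
  using E_C1m B_star by (auto simp: C1m_def intro!: continuous_on_compose2[of B E] continuous_intros)

text \<open>For positive s this is \<open>exp_map_scale\<close>; at s = 0 both sides are continuous.
  The case s = 0 is what shows that \<open>E\<close> sends the origin to p.\<close>

lemma radial_curve:
  assumes u: "u \<in> B"
  obtains \<gamma> where "geodesic_from \<A> g p (tvec_of \<A> c0 p u) \<gamma>" "\<And>s. s \<in> {0..1} \<Longrightarrow> E (s *\<^sub>R u) = \<gamma> s"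
proof -
  have "tvec_of \<A> c0 p u \<in> exp_domain \<A> g p"
    using exp_defined tvec_of_in[OF c0, of u] u unfolding B_def by (auto simp: N_metric)
  then obtain \<gamma> where \<gamma>: "geodesic_from \<A> g p (tvec_of \<A> c0 p u) \<gamma>" by (auto simp: exp_domain_def)
  have pos: "E (s *\<^sub>R u) = \<gamma> s" if "0 < s" "s \<le> 1" for s
    unfolding E_def tvec_scale by (rule exp_map_scale[OF \<gamma> that])
  have "E (0 *\<^sub>R u) = \<gamma> 0"
  proof -
    have c: "continuous_on {0..1} \<gamma>" using \<gamma> by (simp add: geodesic_from_def geodesic_on_def)
    have l1: "((\<lambda>s. E (s *\<^sub>R u)) \<longlongrightarrow> E (0 *\<^sub>R u)) (at 0 within {0..1})"
      using bspec[OF continuous_radial[OF u, unfolded continuous_on_def], of 0] by simp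
    have l2: "(\<gamma> \<longlongrightarrow> \<gamma> 0) (at 0 within {0..1})" using c by (simp add: continuous_on_def)
    have "\<forall>\<^sub>F s in at 0 within {0..1}. \<gamma> s = E (s *\<^sub>R u)"
      using pos by (auto simp: eventually_at_filter)
    from Lim_transform_eventually[OF l2 this] have "((\<lambda>s. E (s *\<^sub>R u)) \<longlongrightarrow> \<gamma> 0) (at 0 within {0..1})" .
    moreover have "at (0::real) within {0..1} \<noteq> bot" by (simp add: trivial_limit_within islimpt_Icc)
    ultimately show ?thesis using tendsto_unique[OF _ l1] by blast
  qed
  then have "E (s *\<^sub>R u) = \<gamma> s" if "s \<in> {0..1}" for s using pos[of s] that by (cases "s = 0") auto
  then show ?thesis using that \<gamma> by blast
qed

lemma radial_derivative:
  assumes "u \<in> B" "s \<in> {0..1}" "d \<in> \<A>" "E (s *\<^sub>R u) \<in> cdom d"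
  shows "((\<lambda>s. (cmap d \<circ> E) (s *\<^sub>R u)) has_vector_derivative frechet_derivative (cmap d \<circ> E) (at (s *\<^sub>R u)) u) (at s)"
  using has_real_derivative_along_line[of "cmap d \<circ> E" _ 0 s u] assms B_star
    C1m_has_derivative[OF E_C1m _ assms(3,4)] by simp

lemma radial_velocity:
  assumes u: "u \<in> B" and s: "s \<in> {0..1}" and d: "d \<in> \<A>" "E (s *\<^sub>R u) \<in> cdom d"
    and \<gamma>: "\<And>s. s \<in> {0..1} \<Longrightarrow> E (s *\<^sub>R u) = \<gamma> s"
  shows "vector_derivative (cmap d \<circ> \<gamma>) (at s within {0..1}) = frechet_derivative (cmap d \<circ> E) (at (s *\<^sub>R u)) u"
proof -
  have "((\<lambda>s. (cmap d \<circ> E) (s *\<^sub>R u)) has_derivative (\<lambda>h. h *\<^sub>R frechet_derivative (cmap d \<circ> E) (at (s *\<^sub>R u)) u)) (at s within {0..1})"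
    using has_vector_derivative_at_within[OF radial_derivative[OF u s d]] by (simp add: has_vector_derivative_def)
  then have "((cmap d \<circ> \<gamma>) has_derivative (\<lambda>h. h *\<^sub>R frechet_derivative (cmap d \<circ> E) (at (s *\<^sub>R u)) u)) (at s within {0..1})"
    by (rule has_derivative_transform_within[OF _ zero_less_one s]) (simp add: \<gamma>)
  then show ?thesis
    using s by (intro vector_derivative_within_closed_interval) (auto simp: has_vector_derivative_def)
qed

lemma E_zero: "E 0 = p"
  using radial_curve[OF zero_in_B] by (force simp: geodesic_from_def)

text \<open>The differential of the exponential map at the origin is the identity, because along u
  it is the initial velocity of the geodesic with that velocity.\<close>

lemma pushf_E_zero:
  assumes u: "u \<in> B" shows "pushf E 0 u = tvec_of \<A> c0 p u"
proof
  fix d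
  obtain \<gamma> where \<gamma>: "geodesic_from \<A> g p (tvec_of \<A> c0 p u) \<gamma>" "\<And>s. s \<in> {0..1} \<Longrightarrow> E (s *\<^sub>R u) = \<gamma> s"
    using radial_curve[OF u] by blast
  then have v: "velocity \<A> {0..1} \<gamma> 0 d = tvec_of \<A> c0 p u d" and p: "\<gamma> 0 = p"
    by (auto simp: geodesic_from_def)
  show "pushf E 0 u d = tvec_of \<A> c0 p u d"
  proof (cases "d \<in> \<A> \<and> p \<in> cdom d")
    case True
    then show ?thesis
      using radial_velocity[OF u, of 0 d, OF _ _ _ \<gamma>(2)] v p E_zero by (simp add: velocity_def pushf_def)
  next
    case False
    then show ?thesis using v p E_zero by (auto simp: velocity_def pushf_def)
  qed
qed

text \<open>At inner parameters the derivatives within the interval in \<open>geodesic_on\<close>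
  become two-sided, as needed to combine them with derivatives of \<open>E\<close>.\<close>

lemma radial_geodesic:
  assumes u: "u \<in> B" and s: "0 < s" "s < 1" and d: "d \<in> \<A>" "E (s *\<^sub>R u) \<in> cdom d"
  defines "a \<equiv> \<lambda>s. frechet_derivative (cmap d \<circ> E) (at (s *\<^sub>R u)) u"
  shows "(a has_vector_derivative - coord_metric.chris (mc d) ((cmap d \<circ> E) (s *\<^sub>R u)) (a s) (a s)) (at s)"
proof -
  obtain \<gamma> where \<gamma>: "geodesic_from \<A> g p (tvec_of \<A> c0 p u) \<gamma>" "\<And>s. s \<in> {0..1} \<Longrightarrow> E (s *\<^sub>R u) = \<gamma> s"
    using radial_curve[OF u] by blast
  let ?b = "\<lambda>t. vector_derivative (cmap d \<circ> \<gamma>) (at t within {0..1})"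
  have sI: "s \<in> {0..1}" using s by auto
  have g: "geodesic_on \<A> g {0..1} \<gamma>" using \<gamma> by (simp add: geodesic_from_def)
  have ds: "\<gamma> s \<in> cdom d" using d \<gamma>(2)[OF sI] by simp
  have "s \<in> interior {0..1}" using s by (simp add: interior_atLeastAtMost_real)
  then have at: "at s within {0..1} = at s" by (rule at_within_interior)
  have b: "(?b has_vector_derivative - coord_metric.chris (mc d) ((cmap d \<circ> \<gamma>) s) (?b s) (?b s)) (at s)"
    using geodesic_onD(2)[OF g sI d(1) ds] unfolding at .
  have ab: "?b t = a t" if "t \<in> {0..1}" "E (t *\<^sub>R u) \<in> cdom d" for t
    unfolding a_def by (rule radial_velocity[OF u that(1) d(1) that(2) \<gamma>(2)])
  have "\<forall>\<^sub>F t in at s within {0..1}. \<gamma> t \<in> cdom d \<and> t \<in> {0..1}"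
    using continuous_within_eventually[OF geodesic_continuous[OF g] sI open_cdom[OF d(1)] ds]
    by (simp add: eventually_conj_iff eventually_at_filter)
  then have ev: "\<forall>\<^sub>F t in at s. ?b t = a t"
    unfolding at by eventually_elim (use ab \<gamma>(2) in auto)
  from has_derivative_transform_eventually[OF b[unfolded has_vector_derivative_def] ev]
  show ?thesis using ab[OF sI d(2)] \<gamma>(2)[OF sI] by (simp add: has_vector_derivative_def)
qed

text \<open>Along the ray the squared speed is constant by the geodesic equation, and its value can
  be read off at the origin from \<open>pushf_E_zero\<close>. Continuity at both ends completes the
  argument on the open interval.\<close>

lemma radial_speed:
  assumes u: "u \<in> B" and s: "s \<in> {0..1}"
  shows "g (E (s *\<^sub>R u)) (pushf E (s *\<^sub>R u) u) (pushf E (s *\<^sub>R u) u) = N u u"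
proof -
  let ?F = "\<lambda>s. g (E (s *\<^sub>R u)) (pushf E (s *\<^sub>R u) u) (pushf E (s *\<^sub>R u) u)"
  have cont: "continuous_on {0..1} ?F"
    by (rule continuous_metric_pushf[OF E_C1m]) (use B_star u in \<open>auto intro!: continuous_intros\<close>)
  have "(?F has_real_derivative 0) (at x)" if x: "0 < x" "x < 1" for x
  proof -
    obtain d where d: "d \<in> \<A>" "E (x *\<^sub>R u) \<in> cdom d" using chart_ex by blast
    interpret coord_metric "cran d" "mc d" by (rule coord_metric[OF d(1)])
    have xI: "x \<in> {0..1}" using x by auto
    let ?q = "\<lambda>s. (cmap d \<circ> E) (s *\<^sub>R u)" and ?a = "\<lambda>s. frechet_derivative (cmap d \<circ> E) (at (s *\<^sub>R u)) u"
    have "((\<lambda>s. mc d (?q s) (?a s) (?a s)) has_vector_derivative 0) (at x)"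
      by (rule geodesic_constant_speed[OF radial_derivative[OF u xI d] radial_geodesic[OF u x d]])
         (use d in auto)
    then have D: "((\<lambda>s. mc d (?q s) (?a s) (?a s)) has_derivative (\<lambda>h. h *\<^sub>R 0)) (at x)"
      by (simp add: has_vector_derivative_def)
    have "\<forall>\<^sub>F t in at x within {0..1}. E (t *\<^sub>R u) \<in> cdom d \<and> t \<in> {0..1}"
      using continuous_within_eventually[OF continuous_radial[OF u] xI open_cdom[OF d(1)] d(2)]
      by (simp add: eventually_conj_iff eventually_at_filter)
    moreover have at: "at x within {0..1} = at x"
      by (rule at_within_interior) (use x in \<open>simp add: interior_atLeastAtMost_real\<close>)
    ultimately have "\<forall>\<^sub>F t in at x. E (t *\<^sub>R u) \<in> cdom d \<and> t \<in> {0..1}" by simp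
    then have ev: "\<forall>\<^sub>F t in at x. mc d (?q t) (?a t) (?a t) = ?F t"
    proof eventually_elim
      case (elim t)
      then show ?case
        using metric_pushf[OF C1m_mdiff[OF E_C1m B_star[OF u]] d(1), of t] d(1) by (simp add: pushf_def)
    qed
    have "mc d (?q x) (?a x) (?a x) = ?F x"
      using metric_pushf[OF C1m_mdiff[OF E_C1m B_star[OF u]] d(1), of x] d x by (simp add: pushf_def)
    from has_derivative_transform_eventually[OF D ev this]
    show ?thesis by (simp add: has_real_derivative_iff_has_vector_derivative has_vector_derivative_def)
  qed
  from DERIV_isconst2[OF zero_less_one cont this, of s]
  have "?F s = ?F 0" using s by auto
  also have "?F 0 = N u u" using pushf_E_zero[OF u] E_zero by (simp add: N_metric)
  finally show ?thesis .
qed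

end

section \<open>The Gauss lemma\<close>

context normal_ball
begin

lemma
  shows N_add_left: "N (u + u') v = N u v + N u' v" and N_add_right: "N u (v + v') = N u v + N u v'"
    and N_scale_left: "N (k *\<^sub>R u) v = k * N u v" and N_scale_right: "N u (k *\<^sub>R v) = k * N u v"
    and N_sym: "N u v = N v u"
  unfolding N_def using M0.G_add_left[OF y0] M0.G_add_right[OF y0] M0.G_scale_left[OF y0] M0.G_scale_right[OF y0]
    M0.G_sym[OF y0] by blast+

text \<open>
  First variation of the energy: differentiating the constant speed of the radial geodesics in the
  direction \<open>b\<close> gives the derivative of the product of radial and transversal velocity.
\<close>

lemma gauss_derivative:
  assumes w: "w \<in> B" and s: "0 < s" "s < 1"
  shows "((\<lambda>s. g (E (s *\<^sub>R w)) (pushf E (s *\<^sub>R w) w) (pushf E (s *\<^sub>R w) (s *\<^sub>R b))) has_real_derivative N w b) (at s)"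
proof -
  obtain d where d: "d \<in> \<A>" "E (s *\<^sub>R w) \<in> cdom d" using chart_ex by blast
  interpret coord_metric "cran d" "mc d" by (rule coord_metric[OF d(1)])
  define Q where "Q = cmap d \<circ> E"
  define DQ where "DQ y v = frechet_derivative Q (at y) v" for y v
  define D2 where "D2 v u = frechet_derivative (\<lambda>y. DQ y v) (at (s *\<^sub>R w)) u" for v u
  define S where "S = B \<inter> E -` cdom d"
  have sI: "s \<in> {0..1}" using s by auto
  have oS: "open S" unfolding S_def by (rule open_E_preimage[OF d(1)])
  have swS: "s *\<^sub>R w \<in> S" using d B_star[OF w] s by (simp add: S_def)
  have Q2: "C_nat_on 2 S Q" unfolding S_def Q_def by (rule E_C2[OF d(1)])
  then have Q2': "C_nat_on (Suc (Suc 0)) S Q" by (simp add: numeral_2_eq_2)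
  have dQ: "(Q has_derivative DQ y) (at y)" if "y \<in> S" for y
    using C_nat_on_has_derivative[OF Q2' that] by (simp add: DQ_def[abs_def])
  have dDQ: "((\<lambda>y. DQ y v) has_derivative D2 v) (at (s *\<^sub>R w))" for v
    unfolding D2_def[abs_def] DQ_def
    by (rule C_nat_on_has_derivative[OF _ swS, of 0]) (use Q2' in simp)
  have lin: "linear (DQ y)" if "y \<in> S" for y
    using has_derivative_bounded_linear[OF dQ[OF that]] by (rule bounded_linear.linear)
  have lin2: "linear (D2 v)" for v
    using has_derivative_bounded_linear[OF dDQ] by (rule bounded_linear.linear)
  \<comment> \<open>This symmetry equates the radial derivative of the transversal velocity with the
    transversal derivative of the radial velocity.\<close>
  have sym: "D2 v u = D2 u v" for v u
    unfolding D2_def DQ_def by (rule second_derivative_symmetric[OF Q2 oS swS])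
  have coord: "g (E y) (pushf E y u) (pushf E y v) = mc d (Q y) (DQ y u) (DQ y v)" if "y \<in> S" for y u v
    using metric_pushf[OF C1m_mdiff[OF E_C1m] d(1)] that d(1) by (simp add: S_def pushf_def Q_def DQ_def)
  let ?q = "\<lambda>t. Q (t *\<^sub>R w)" and ?a = "\<lambda>t. DQ (t *\<^sub>R w) w" and ?\<beta> = "\<lambda>t. t *\<^sub>R DQ (t *\<^sub>R w) b"
  let ?\<beta>' = "s *\<^sub>R D2 b w + DQ (s *\<^sub>R w) b"
  have Qs: "Q (s *\<^sub>R w) \<in> cran d" using d by (auto simp: Q_def)
  have "((\<lambda>t. DQ (t *\<^sub>R w) b) has_vector_derivative D2 b w) (at s)"
    using has_real_derivative_along_line[of "\<lambda>y. DQ y b" "D2 b" 0 s w] dDQ by simp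
  from has_vector_derivative_scaleR[OF DERIV_ident this]
  have d\<beta>: "(?\<beta> has_vector_derivative ?\<beta>') (at s)" by simp
  have dq: "(?q has_vector_derivative ?a s) (at s)"
    using radial_derivative[OF w sI d] by (simp add: Q_def DQ_def)
  have da: "(?a has_vector_derivative - chris (?q s) (?a s) (?a s)) (at s)"
    using radial_geodesic[OF w s d] by (simp add: Q_def DQ_def)
  have k: "((\<lambda>t. mc d (?q t) (?a t) (?\<beta> t)) has_vector_derivative
     dG (?q s) (?\<beta> s) (?a s) (?a s) / 2 + mc d (?q s) (?a s) ?\<beta>') (at s)"
    by (rule G_along_geodesic[OF dq da d\<beta>]) (use Qs in auto)
  have oT: "open {t. t *\<^sub>R w \<in> S}"
    using open_vimage[OF oS, of "\<lambda>t. t *\<^sub>R w"] by (simp add: vimage_def continuous_intros)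
  have k1: "((\<lambda>t. g (E (t *\<^sub>R w)) (pushf E (t *\<^sub>R w) w) (pushf E (t *\<^sub>R w) (t *\<^sub>R b))) has_derivative
     (\<lambda>h. h *\<^sub>R (dG (?q s) (?\<beta> s) (?a s) (?a s) / 2 + mc d (?q s) (?a s) ?\<beta>'))) (at s)"
    by (rule has_derivative_transform_within_open[OF k[unfolded has_vector_derivative_def] oT])
       (use swS in \<open>auto simp: coord linear_scale[OF lin]\<close>)
  \<comment> \<open>The second curve keeps the time s fixed and varies the direction: it runs
    through the points s (w + t b).\<close>
  let ?y = "\<lambda>t. s *\<^sub>R w + t *\<^sub>R (s *\<^sub>R b)"
  have yw: "?y t = s *\<^sub>R (w + t *\<^sub>R b)" for t by (simp add: algebra_simps)
  let ?a2 = "\<lambda>t. DQ (?y t) w + t *\<^sub>R DQ (?y t) b"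
  have dy: "((\<lambda>t. DQ (?y t) v) has_vector_derivative D2 v (s *\<^sub>R b)) (at 0)" for v
    using has_real_derivative_along_line[of "\<lambda>y. DQ y v" "D2 v" "s *\<^sub>R w" 0 "s *\<^sub>R b"] dDQ by simp
  have dqy: "((\<lambda>t. Q (?y t)) has_vector_derivative DQ (s *\<^sub>R w) (s *\<^sub>R b)) (at 0)"
    using has_real_derivative_along_line[of Q "DQ (s *\<^sub>R w)" "s *\<^sub>R w" 0 "s *\<^sub>R b"] dQ[OF swS] by simp
  have "(?a2 has_vector_derivative D2 w (s *\<^sub>R b) + (0 *\<^sub>R D2 b (s *\<^sub>R b) + 1 *\<^sub>R DQ (?y 0) b)) (at 0)"
    by (intro has_vector_derivative_add dy has_vector_derivative_scaleR[OF DERIV_ident dy, of b, simplified id_def])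
  then have da2: "(?a2 has_vector_derivative ?\<beta>') (at 0)"
    by (simp add: linear_scale[OF lin2] sym[of w b])
  have n: "((\<lambda>t. mc d (Q (?y t)) (?a2 t) (?a2 t)) has_vector_derivative
     dG (Q (?y 0)) (DQ (s *\<^sub>R w) (s *\<^sub>R b)) (?a2 0) (?a2 0) + mc d (Q (?y 0)) ?\<beta>' (?a2 0) + mc d (Q (?y 0)) (?a2 0) ?\<beta>') (at 0)"
    by (rule G_has_vector_derivative[OF dqy da2 da2]) (use Qs in auto)
  have e0: "?y 0 = s *\<^sub>R w" "?a2 0 = ?a s" by simp_all
  have n': "((\<lambda>t. mc d (Q (?y t)) (?a2 t) (?a2 t)) has_vector_derivative
     dG (?q s) (?\<beta> s) (?a s) (?a s) + 2 * mc d (?q s) (?a s) ?\<beta>') (at 0)"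
  proof -
    have sym': "mc d (?q s) ?\<beta>' (?a s) = mc d (?q s) (?a s) ?\<beta>'" by (rule G_sym[OF Qs])
    have "dG (Q (?y 0)) (DQ (s *\<^sub>R w) (s *\<^sub>R b)) (?a2 0) (?a2 0) + mc d (Q (?y 0)) ?\<beta>' (?a2 0) + mc d (Q (?y 0)) (?a2 0) ?\<beta>'
      = dG (?q s) (?\<beta> s) (?a s) (?a s) + 2 * mc d (?q s) (?a s) ?\<beta>'"
      unfolding e0 linear_scale[OF lin[OF swS]] by (simp add: sym')
    from n[unfolded this] show ?thesis .
  qed
  let ?T = "{t. w + t *\<^sub>R b \<in> B \<and> ?y t \<in> S}"
  have oT2: "open ?T"
  proof -
    have "open ((\<lambda>t. w + t *\<^sub>R b) -` B \<inter> ?y -` S)"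
      by (intro open_Int open_vimage open_B oS continuous_intros)
    then show ?thesis by (simp add: vimage_def Int_def)
  qed
  have N2: "((\<lambda>t. N (w + t *\<^sub>R b) (w + t *\<^sub>R b)) has_derivative
     (\<lambda>h. h *\<^sub>R (dG (?q s) (?\<beta> s) (?a s) (?a s) + 2 * mc d (?q s) (?a s) ?\<beta>'))) (at 0)"
  proof (rule has_derivative_transform_within_open[OF n'[unfolded has_vector_derivative_def] oT2])
    show "0 \<in> ?T" using w swS by simp
    fix t assume "t \<in> ?T"
    then have t: "w + t *\<^sub>R b \<in> B" "?y t \<in> S" by auto
    have "DQ (?y t) (w + t *\<^sub>R b) = ?a2 t"
      using linear_add[OF lin[OF t(2)]] linear_scale[OF lin[OF t(2)]] by simp
    then show "mc d (Q (?y t)) (?a2 t) (?a2 t) = N (w + t *\<^sub>R b) (w + t *\<^sub>R b)"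
      using radial_speed[OF t(1) sI] coord[OF t(2), of "w + t *\<^sub>R b" "w + t *\<^sub>R b"] unfolding yw by simp
  qed
  \<comment> \<open>Expanding the quadratic form gives its derivative at t = 0 a second time;
    uniqueness of derivatives equates it with the value found from the constant speed.\<close>
  have "N (w + t *\<^sub>R b) (w + t *\<^sub>R b) = N w w + t * (2 * N w b) + t * t * N b b" for t
    by (simp add: N_add_left N_add_right N_scale_left N_scale_right N_sym[of b w] algebra_simps)
  moreover have "((\<lambda>t. N w w + t * (2 * N w b) + t * t * N b b) has_real_derivative 2 * N w b) (at 0)"
    by (auto intro!: derivative_eq_intros)
  ultimately have "((\<lambda>t. N (w + t *\<^sub>R b) (w + t *\<^sub>R b)) has_vector_derivative 2 * N w b) (at 0)"
    by (simp add: has_real_derivative_iff_has_vector_derivative)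
  from vector_derivative_unique_at[OF this N2[folded has_vector_derivative_def]]
  have "N w b = dG (?q s) (?\<beta> s) (?a s) (?a s) / 2 + mc d (?q s) (?a s) ?\<beta>'" by simp
  then show ?thesis using k1
    by (simp add: has_real_derivative_iff_has_vector_derivative has_vector_derivative_def)
qed

text \<open>The product of radial and transversal velocity has the constant derivative
  \<open>N w b\<close> along the ray. The factor s in the transversal field makes it vanish at the
  origin, so at s = 1 it equals that constant.\<close>

lemma gauss_lemma:
  assumes w: "w \<in> B"
  shows "g (E w) (pushf E w w) (pushf E w b) = N w b"
proof -
  let ?k = "\<lambda>s. g (E (s *\<^sub>R w)) (pushf E (s *\<^sub>R w) w) (pushf E (s *\<^sub>R w) (s *\<^sub>R b))"
  have cont: "continuous_on {0..1} (\<lambda>s. ?k s - s * N w b)"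
    by (intro continuous_on_diff continuous_metric_pushf[OF E_C1m])
       (use B_star w in \<open>auto intro!: continuous_intros\<close>)
  have "((\<lambda>s. ?k s - s * N w b) has_real_derivative 0) (at x)" if "0 < x" "x < 1" for x
    by (rule derivative_eq_intros gauss_derivative[OF w that] refl)+ simp
  from DERIV_isconst2[OF zero_less_one cont this, of 1]
  have "?k 1 - 1 * N w b = ?k 0 - 0 * N w b" by simp
  moreover have "?k 0 = 0"
  proof -
    have "pushf E 0 w = tvec_of \<A> c0 p w" by (rule pushf_E_zero[OF w])
    moreover have "pushf E 0 0 = tvec_of \<A> c0 p 0" by (rule pushf_E_zero[OF zero_in_B])
    ultimately show ?thesis using N_scale_right[of w 0 0] by (simp add: E_zero N_metric)
  qed
  ultimately show ?thesis by simp
qed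

abbreviation "nrm u \<equiv> sqrt (N u u)"

abbreviation "Einv \<equiv> inv_into B E"

lemma E_Einv: "x \<in> E ` B \<Longrightarrow> E (Einv x) = x" and Einv_in: "x \<in> E ` B \<Longrightarrow> Einv x \<in> B"
  by (auto intro: f_inv_into_f inv_into_into)

lemma Einv_E: "u \<in> B \<Longrightarrow> Einv (E u) = u"
  by (rule inv_into_f_f[OF inj_E])

text \<open>Smoothness of the inverse is expressed in charts of M, so curve and inverse are joined
  through one chart around the current point.\<close>

lemma Einv_curve_differentiable:
  fixes \<gamma> :: "real \<Rightarrow> 'm"
  assumes \<gamma>: "mdiff \<gamma> s" "\<gamma> s \<in> E ` B"
  obtains w' where "((\<lambda>s. Einv (\<gamma> s)) has_vector_derivative w') (at s)"
proof -
  obtain d where d: "d \<in> \<A>" "\<gamma> s \<in> cdom d" using chart_ex by blast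
  let ?V = "cmap d ` (E ` B \<inter> cdom d \<inter> Einv -` UNIV)"
  have "Ck_on \<infinity> ?V (id \<circ> Einv \<circ> cinv d)"
    using E_inv_smooth d(1) unfolding Ck_map_def euclidean_atlas_def by fastforce
  from C_nat_on_has_derivative[OF Ck_on_imp_C_nat_on[OF this, of "Suc 0"], of "cmap d (\<gamma> s)"]
  obtain D where D: "((Einv \<circ> cinv d) has_derivative D) (at (cmap d (\<gamma> s)))"
    using \<gamma>(2) d by auto
  have "((cmap d \<circ> \<gamma>) has_derivative (\<lambda>a. pushf \<gamma> s a d)) (at s)" by (rule mdiff_chart[OF \<gamma>(1) d])
  from has_derivative_compose[OF this, of "Einv \<circ> cinv d" D] D
  have "((\<lambda>t. (Einv \<circ> cinv d) ((cmap d \<circ> \<gamma>) t)) has_derivative (\<lambda>a. D (pushf \<gamma> s a d))) (at s)" by simp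
  moreover have "isCont \<gamma> s" using \<gamma> by (simp add: mdiff_def)
  then have "\<forall>\<^sub>F t in at s. \<gamma> t \<in> cdom d" by (rule isCont_eventually[where f = \<gamma> and y = s, OF _ open_cdom[OF d(1)] d(2)])
  then have "\<forall>\<^sub>F t in at s. (Einv \<circ> cinv d) ((cmap d \<circ> \<gamma>) t) = Einv (\<gamma> t)"
    by eventually_elim (simp add: cinv_cmap[OF d(1)])
  ultimately have "((\<lambda>t. Einv (\<gamma> t)) has_derivative (\<lambda>a. D (pushf \<gamma> s a d))) (at s)"
    by (rule has_derivative_transform_eventually) (simp_all add: cinv_cmap[OF d])
  then have "(\<lambda>t. Einv (\<gamma> t)) differentiable (at s)" by (auto simp: differentiable_def)
  then show ?thesis using that vector_derivative_works by blast
qed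

end

section \<open>Speed of curves and confinement of short curves\<close>

context riemannian
begin

definition speed :: "(real \<Rightarrow> 'm) \<Rightarrow> real \<Rightarrow> real" where
  "speed \<gamma> s = sqrt (g (\<gamma> s) (pushf \<gamma> s 1) (pushf \<gamma> s 1))"

lemma continuous_speed: "C1m U \<gamma> \<Longrightarrow> J \<subseteq> U \<Longrightarrow> continuous_on J (speed \<gamma>)"
  unfolding speed_def[abs_def]
  by (intro continuous_on_real_sqrt continuous_metric_pushf[of U \<gamma> J "\<lambda>s. s"] continuous_intros) auto

lemma speed_nonneg: "C1m U \<gamma> \<Longrightarrow> s \<in> U \<Longrightarrow> 0 \<le> speed \<gamma> s"
  unfolding speed_def by (simp add: metric_nonneg pushf_in C1m_mdiff)

end

context normal_ball
begin

text \<open>By the Gauss lemma only the radial part of the velocity changes the distance from the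
  centre, and the Cauchy-Schwarz inequality bounds that part by the speed.\<close>

lemma radial_growth:
  assumes \<gamma>: "C1m U \<gamma>" "{s1..s2} \<subseteq> U" "s1 \<le> s2" and im: "\<And>s. s \<in> {s1..s2} \<Longrightarrow> \<gamma> s \<in> E ` B"
  shows "nrm (Einv (\<gamma> s2)) \<le> nrm (Einv (\<gamma> s1)) + integral {s1..s2} (speed \<gamma>)"
proof (rule field_le_epsilon)
  fix e :: real assume e: "0 < e"
  let ?w = "\<lambda>s. Einv (\<gamma> s)"
  \<comment> \<open>The norm need not be differentiable where the curve meets the centre, so it is
    smoothed by adding e^2 under the root; the error e disappears through
    \<open>field_le_epsilon\<close>.\<close>
  let ?\<phi> = "\<lambda>s. sqrt (e\<^sup>2 + N (?w s) (?w s))"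
  have cont: "continuous_on {s1..s2} (speed \<gamma>)" by (rule continuous_speed[OF \<gamma>(1,2)])
  have pos: "0 < e\<^sup>2 + N u u" for u using e N_nonneg[of u] by (simp add: add_pos_nonneg)
  have d\<phi>: "\<exists>y. (?\<phi> has_real_derivative y) (at s) \<and> y \<le> speed \<gamma> s" if s: "s \<in> {s1..s2}" for s
  proof -
    have sU: "s \<in> U" using \<gamma>(2) s by auto
    have m: "mdiff \<gamma> s" by (rule C1m_mdiff[OF \<gamma>(1) sU])
    have wB: "?w s \<in> B" by (rule Einv_in[OF im[OF s]])
    obtain w' where w': "(?w has_vector_derivative w') (at s)"
      using Einv_curve_differentiable[OF m im[OF s]] by blast
    let ?V = "U \<inter> \<gamma> -` (E ` B)"
    have V: "open ?V" "s \<in> ?V" using C1m_open_preimage[OF \<gamma>(1) open_EB] sU im[OF s] by auto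
    have Em: "mdiff E (?w s)" by (rule C1m_mdiff[OF E_C1m wB])
    have eqV: "E (?w t) = \<gamma> t" if "t \<in> ?V" for t using that E_Einv[of "\<gamma> t"] by simp
    have push: "pushf \<gamma> s 1 = pushf E (?w s) w'"
      using pushf_cong(2)[OF V eqV mdiff_compose[OF Em w'[unfolded has_vector_derivative_def]]]
        pushf_compose[OF Em w'[unfolded has_vector_derivative_def]] by simp
    have E: "E (?w s) = \<gamma> s" by (rule E_Einv[OF im[OF s]])
    have pin: "pushf \<gamma> s 1 \<in> tangent_space \<A> (\<gamma> s)" by (rule pushf_in[OF m])
    have pin': "pushf E (?w s) (?w s) \<in> tangent_space \<A> (\<gamma> s)"
      using pushf_in[OF Em, of "?w s"] unfolding E .
    have "N (?w s) w' = g (\<gamma> s) (pushf E (?w s) (?w s)) (pushf \<gamma> s 1)"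
      using gauss_lemma[OF wB, of w'] unfolding push E by simp
    also have "\<dots> \<le> sqrt (g (\<gamma> s) (pushf E (?w s) (?w s)) (pushf E (?w s) (?w s))) * speed \<gamma> s"
      unfolding speed_def by (rule metric_cauchy_schwarz[OF pin' pin])
    also have "g (\<gamma> s) (pushf E (?w s) (?w s)) (pushf E (?w s) (?w s)) = N (?w s) (?w s)"
      using gauss_lemma[OF wB, of "?w s"] unfolding E .
    finally have le: "N (?w s) w' \<le> nrm (?w s) * speed \<gamma> s" .
    also have "\<dots> \<le> ?\<phi> s * speed \<gamma> s"
      by (intro mult_right_mono real_sqrt_le_mono speed_nonneg[OF \<gamma>(1) sU]) simp
    finally have le': "N (?w s) w' / ?\<phi> s \<le> speed \<gamma> s"
      using pos[of "?w s"] by (simp add: pos_divide_le_eq mult.commute)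
    have "((\<lambda>s. N (?w s) (?w s)) has_vector_derivative 2 * N (?w s) w') (at s)"
    proof -
      \<comment> \<open>N is the metric at the fixed point p, so the product rule is used over a
        constant base curve and the term with \<open>dG\<close> vanishes.\<close>
      have c: "((\<lambda>s. cmap c0 p) has_vector_derivative 0) (at s)" by simp
      have z: "M0.dG (cmap c0 p) 0 u v = 0" for u v
        using linear_0[OF M0.dG_linear[OF y0]] by simp
      show ?thesis
        using M0.G_has_vector_derivative[OF c w' w' y0 UNIV_I] z N_sym[of w' "?w s"]
        by (simp add: N_def)
    qed
    then have "((\<lambda>s. e\<^sup>2 + N (?w s) (?w s)) has_real_derivative 2 * N (?w s) w') (at s)"
      by (auto simp: has_real_derivative_iff_has_vector_derivative intro!: derivative_eq_intros)
    then have "(?\<phi> has_real_derivative inverse (?\<phi> s) / 2 * (2 * N (?w s) w')) (at s)"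
      by (rule DERIV_chain2[where f = sqrt and x = s, OF DERIV_real_sqrt[OF pos]])
    then have "(?\<phi> has_real_derivative N (?w s) w' / ?\<phi> s) (at s)"
      by (simp add: field_simps)
    with le' show ?thesis by blast
  qed
  let ?\<psi> = "\<lambda>s. ?\<phi> s - integral {s1..s} (speed \<gamma>)"
  have dI: "((\<lambda>s. integral {s1..s} (speed \<gamma>)) has_real_derivative speed \<gamma> s) (at s within {s1..s2})"
    if "s \<in> {s1..s2}" for s by (rule integral_has_real_derivative[OF cont that])
  have "?\<psi> s2 \<le> ?\<psi> s1"
  proof (rule DERIV_nonpos_imp_decreasing_open[of s1 s2 ?\<psi>, OF \<gamma>(3)])
    fix s assume s: "s1 < s" "s < s2"
    then have sI: "s \<in> {s1..s2}" by auto
    have "at s within {s1..s2} = at s"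
      by (rule at_within_interior) (use s in \<open>simp add: interior_atLeastAtMost_real\<close>)
    with dI[OF sI] have D: "((\<lambda>s. integral {s1..s} (speed \<gamma>)) has_real_derivative speed \<gamma> s) (at s)" by simp
    obtain y where y: "(?\<phi> has_real_derivative y) (at s)" "y \<le> speed \<gamma> s" using d\<phi>[OF sI] by blast
    from DERIV_diff[OF y(1) D] y(2)
    show "\<exists>y. (?\<psi> has_real_derivative y) (at s) \<and> y \<le> 0" by (intro exI[of _ "y - speed \<gamma> s"]) simp
  next
    have c1: "continuous_on {s1..s2} ?\<phi>"
      using d\<phi> by (intro continuous_at_imp_continuous_on ballI) (blast intro: DERIV_isCont)
    show "continuous_on {s1..s2} ?\<psi>"
      by (intro continuous_on_diff c1 DERIV_continuous_on[OF dI])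
  qed
  then have "?\<phi> s2 \<le> ?\<phi> s1 + integral {s1..s2} (speed \<gamma>)" by simp
  moreover have "nrm (?w s2) \<le> ?\<phi> s2" by (intro real_sqrt_le_mono) simp
  moreover have "?\<phi> s1 \<le> e + nrm (?w s1)"
    using sqrt_add_le_add_sqrt[of "e\<^sup>2" "N (?w s1) (?w s1)"] N_nonneg e by simp
  ultimately show "nrm (?w s2) \<le> nrm (?w s1) + integral {s1..s2} (speed \<gamma>) + e" by linarith
qed

lemma compact_ball: "compact {u. nrm u \<le> a}"
proof -
  obtain l where l: "0 < l" "\<And>u. l * (norm u)\<^sup>2 \<le> N u u"
  proof -
    have K: "compact {cmap c0 p}" "{cmap c0 p} \<subseteq> cran c0" using y0 by simp_all
    show ?thesis by (rule M0.G_lower_bound[OF K]) (rule that, auto simp: N_def)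
  qed
  have "continuous_on UNIV (\<lambda>u. nrm u)"
    unfolding N_def by (intro continuous_on_real_sqrt M0.continuous_on_G continuous_intros) (use y0 in auto)
  then have "closed {u. nrm u \<le> a}" by (rule closed_Collect_le[OF _ continuous_on_const])
  moreover have "norm u \<le> \<bar>a\<bar> / sqrt l" if "nrm u \<le> a" for u
  proof -
    have "sqrt l * norm u = sqrt (l * (norm u)\<^sup>2)" by (simp add: real_sqrt_mult)
    also have "\<dots> \<le> nrm u" by (rule real_sqrt_le_mono[OF l(2)])
    also have "\<dots> \<le> \<bar>a\<bar>" using that by simp
    finally show ?thesis using l(1) by (simp add: pos_le_divide_eq mult.commute)
  qed
  then have "bounded {u. nrm u \<le> a}" unfolding bounded_iff by blast
  ultimately show ?thesis by (simp add: compact_eq_bounded_closed)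
qed

text \<open>Induction along the interval: lying in the normal ball is an open condition, and it
  survives limits because the distance from the centre is bounded by a value strictly below
  r.\<close>

lemma short_curve_in_ball:
  assumes \<gamma>: "C1m U \<gamma>" "{0..1} \<subseteq> U" and start: "\<gamma> 0 = E w0" "w0 \<in> B"
    and short: "nrm w0 + integral {0..1} (speed \<gamma>) < r" and s: "s \<in> {0..1}"
  shows "\<exists>u\<in>B. \<gamma> s = E u \<and> nrm u \<le> nrm w0 + integral {0..1} (speed \<gamma>)"
proof -
  let ?L = "integral {0..1} (speed \<gamma>)"
  \<comment> \<open>This closed ball is compact and lies in B, so its image is closed in M; a limit
    of points of the curve cannot slip out through the boundary.\<close>
  let ?K = "{u. nrm u \<le> nrm w0 + ?L}"
  have KB: "?K \<subseteq> B" using short by (auto simp: B_def)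
  have cE: "continuous_on B E" using E_C1m by (simp add: C1m_def)
  have "compact (E ` ?K)" by (rule compact_continuous_image[OF continuous_on_subset[OF cE KB] compact_ball])
  then have closed: "closed (E ` ?K)" by (rule compact_imp_closed)
  have c\<gamma>: "continuous_on {0..1} \<gamma>" using \<gamma> by (auto simp: C1m_def intro: continuous_on_subset)
  have int: "speed \<gamma> integrable_on {0..1}" by (rule integrable_continuous_real[OF continuous_speed[OF \<gamma>]])
  have inK: "Einv (\<gamma> t) \<in> ?K" if t: "0 \<le> t" "t \<le> 1" and im: "\<And>r. 0 \<le> r \<Longrightarrow> r \<le> t \<Longrightarrow> \<gamma> r \<in> E ` B" for t
  proof -
    have sub: "{0..t} \<subseteq> {0..1}" using t by auto
    have "nrm (Einv (\<gamma> t)) \<le> nrm (Einv (\<gamma> 0)) + integral {0..t} (speed \<gamma>)"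
      by (rule radial_growth[OF \<gamma>(1) order_trans[OF sub \<gamma>(2)] t(1)]) (use im in auto)
    also have "integral {0..t} (speed \<gamma>) \<le> ?L"
      by (rule integral_subset_le[OF sub integrable_on_subinterval[OF int sub] int])
         (use speed_nonneg[OF \<gamma>(1)] \<gamma>(2) in auto)
    finally show ?thesis using start Einv_E by simp
  qed
  have P: "\<gamma> s \<in> E ` B" if "0 \<le> s" "s \<le> 1" for s
  proof (rule real_interval_induct[of "\<lambda>s. \<gamma> s \<in> E ` B", OF _ _ that])
    fix s :: real assume s: "0 \<le> s" "s \<le> 1" "\<And>r. 0 \<le> r \<Longrightarrow> r < s \<Longrightarrow> \<gamma> r \<in> E ` B"
    show "\<gamma> s \<in> E ` B"
    proof (cases "s = 0")
      case True
      then show ?thesis using start by simp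
    next
      case False
      let ?F = "at s within {0..<s}"
      have nt: "?F \<noteq> bot" using s False by (simp add: trivial_limit_within islimpt_Ico)
      have sub: "{0..<s} \<subseteq> {0..1}" using s by auto
      have "(\<gamma> \<longlongrightarrow> \<gamma> s) (at s within {0..1})" using c\<gamma> s by (simp add: continuous_on_def)
      then have lim: "(\<gamma> \<longlongrightarrow> \<gamma> s) ?F" by (rule tendsto_within_subset[OF _ sub])
      have "\<forall>\<^sub>F t in ?F. t \<in> {0..<s}" by (simp add: eventually_at_filter)
      then have "\<forall>\<^sub>F t in ?F. \<gamma> t \<in> E ` ?K"
      proof eventually_elim
        case (elim t)
        have "\<gamma> t \<in> E ` B" "Einv (\<gamma> t) \<in> ?K" using elim s inK[of t] by auto
        show ?case
          by (rule image_eqI[of _ E "Einv (\<gamma> t)"]) (use E_Einv[OF \<open>\<gamma> t \<in> E ` B\<close>] \<open>Einv (\<gamma> t) \<in> ?K\<close> in simp_all)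
      qed
      from Lim_in_closed_set[OF closed this nt lim] show ?thesis using KB by blast
    qed
  next
    fix s :: real assume s: "0 \<le> s" "s < 1" "\<gamma> s \<in> E ` B"
    have "\<forall>\<^sub>F t in at s within {0..1}. \<gamma> t \<in> E ` B"
      by (rule continuous_within_eventually[OF c\<gamma> _ open_EB s(3)]) (use s in auto)
    then obtain h where h: "0 < h" "\<And>t. t \<in> {0..1} \<Longrightarrow> t \<noteq> s \<Longrightarrow> dist t s < h \<Longrightarrow> \<gamma> t \<in> E ` B"
      unfolding eventually_at by auto
    have "\<gamma> t \<in> E ` B" if "s \<le> t" "t < s + h" "t \<le> 1" for t
      using h(2)[of t] that s by (cases "t = s") (auto simp: dist_real_def)
    then show "\<exists>s'>s. \<forall>r. s \<le> r \<and> r < s' \<and> r \<le> 1 \<longrightarrow> \<gamma> r \<in> E ` B"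
      using h(1) by (intro exI[of _ "s + h"]) auto
  qed
  have s01: "0 \<le> s" "s \<le> 1" using s by auto
  then have "Einv (\<gamma> s) \<in> ?K" using inK[OF s01] P by auto
  then show ?thesis
    using Einv_in[OF P[OF s01]] E_Einv[OF P[OF s01], symmetric] by (intro bexI[of _ "Einv (\<gamma> s)"] conjI) simp_all
qed

end

section \<open>Lengths of transported curves\<close>

text \<open>Lets the integral of a random speed be treated as a limit of finite sums of random
  variables, taken at parameters that do not depend on the sample point.\<close>

lemma continuous_Riemann_sums:
  fixes f :: "real \<Rightarrow> real"
  assumes f: "continuous_on {0..1} f"
  shows "(\<lambda>n. \<Sum>i<Suc n. f (i / Suc n) / Suc n) \<longlonglongrightarrow> integral {0..1} f"
proof (rule LIMSEQ_I)
  fix e :: real assume e: "0 < e"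
  have "uniformly_continuous_on {0..1} f" by (rule compact_uniformly_continuous[OF f]) simp
  then obtain d where d: "0 < d" "\<And>x y. x \<in> {0..1} \<Longrightarrow> y \<in> {0..1} \<Longrightarrow> dist y x < d \<Longrightarrow> dist (f y) (f x) < e / 2"
    unfolding uniformly_continuous_on_def using e by (meson half_gt_zero)
  obtain n0 where n0: "inverse (real (Suc n0)) < d" using reals_Archimedean[OF d(1)] by blast
  have "norm ((\<Sum>i<Suc n. f (i / Suc n) / Suc n) - integral {0..1} f) < e" if n: "n \<ge> n0" for n
  proof -
    let ?m = "real (Suc n)"
    have m: "0 < ?m" by simp
    have md: "1 / ?m < d"
    proof -
      have "1 / ?m \<le> inverse (real (Suc n0))" using n by (simp add: field_simps)
      then show ?thesis using n0 by simp
    qed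
    have sub: "{i / ?m..(i + 1) / ?m} \<subseteq> {0..1}" if "i < Suc n" for i :: nat
      using that by (auto simp: field_simps intro: order_trans)
    have int: "f integrable_on {a..b}" if "{a..b} \<subseteq> {0..1}" for a b
      by (rule integrable_continuous_real[OF continuous_on_subset[OF f that]])
    have split: "integral {0..k / ?m} f = (\<Sum>i<k. integral {i / ?m..(i + 1) / ?m} f)" if "k \<le> Suc n" for k :: nat
      using that
    proof (induction k)
      case (Suc k)
      have "integral {0..k / ?m} f + integral {k / ?m..(k + 1) / ?m} f = integral {0..(k + 1) / ?m} f"
      proof (rule Henstock_Kurzweil_Integration.integral_combine)
        have "real (k + 1) / ?m \<le> 1" using Suc.prems by (simp add: field_simps)
        then show "f integrable_on {0..real (k + 1) / ?m}" by (intro int) auto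
      qed (auto simp: field_simps)
      then show ?case using Suc by (simp add: add.commute)
    qed simp
    have piece: "\<bar>f (i / ?m) / ?m - integral {i / ?m..(i + 1) / ?m} f\<bar> \<le> (e / 2) / ?m" if i: "i < Suc n" for i :: nat
    proof -
      let ?J = "{i / ?m..(i + 1) / ?m}"
      have le: "i / ?m \<le> (i + 1) / ?m" by (simp add: divide_right_mono)
      have len: "(real i + 1) / ?m - i / ?m = 1 / ?m" by (simp add: field_simps)
      have "norm (integral ?J (\<lambda>x. f (i / ?m) - f x)) \<le> e / 2 * ((i + 1) / ?m - i / ?m)"
      proof (rule integral_bound[OF le])
        show "continuous_on ?J (\<lambda>x. f (i / ?m) - f x)"
          by (intro continuous_intros continuous_on_subset[OF f sub[OF i]])
        fix x assume x: "x \<in> ?J"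
        have mem: "i / ?m \<in> {0..1}" "x \<in> {0..1}"
          using le by (intro subsetD[OF sub[OF i]], simp) (rule subsetD[OF sub[OF i] x])
        have "dist (i / ?m) x \<le> 1 / ?m"
        proof -
          have "i / ?m \<le> x" "x \<le> (real i + 1) / ?m" using x by (simp_all add: add.commute)
          then show ?thesis using len unfolding dist_real_def by linarith
        qed
        then have "dist (f (i / ?m)) (f x) < e / 2"
          by (intro d(2)[OF mem(2,1)] le_less_trans[OF _ md])
        then show "norm (f (i / ?m) - f x) \<le> e / 2" by (simp add: dist_norm)
      qed
      moreover have "integral ?J (\<lambda>x. f (i / ?m) - f x) = f (i / ?m) / ?m - integral ?J f"
        using int[OF sub[OF i]] le
        by (subst integral_diff) (auto simp: content_real diff_divide_distrib[symmetric])
      ultimately show ?thesis by (simp add: diff_divide_distrib[symmetric])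
    qed
    have "(\<Sum>i<Suc n. f (i / ?m) / ?m) - integral {0..1} f
        = (\<Sum>i<Suc n. f (i / ?m) / ?m - integral {i / ?m..(i + 1) / ?m} f)"
      using split[of "Suc n"] by (simp only: sum_subtractf) simp
    also have "norm \<dots> \<le> (\<Sum>i<Suc n. (e / 2) / ?m)"
      by (rule sum_norm_le) (use piece in auto)
    also have "\<dots> = ?m * ((e / 2) / ?m)" by (simp only: sum_constant card_lessThan)
    also have "\<dots> = e / 2"
    proof -
      have cancel: "x * (y / x) = y" if "x \<noteq> 0" for x y :: real using that by simp
      show ?thesis by (rule cancel) simp
    qed
    finally show ?thesis using e by simp
  qed
  then show "\<exists>no. \<forall>n\<ge>no. norm ((\<Sum>i<Suc n. f (i / Suc n) / Suc n) - integral {0..1} f) < e" by blast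
qed

text \<open>Needed where the source chart changes from point to point and each chart yields the
  claim only on an open piece.\<close>

lemma C_nat_on_local:
  assumes "\<And>x. x \<in> S \<Longrightarrow> \<exists>T. open T \<and> x \<in> T \<and> C_nat_on n T f"
  shows "C_nat_on n S f"
  using assms
proof (induction n arbitrary: f)
  case 0
  show ?case
    unfolding C_nat_on.simps
  proof (rule continuous_at_imp_continuous_on, rule ballI)
    fix x assume "x \<in> S"
    then obtain T where "open T" "x \<in> T" "C_nat_on 0 T f" using 0 by blast
    then show "isCont f x" by (simp add: continuous_on_eq_continuous_at)
  qed
next
  case (Suc n)
  have "f differentiable (at x)" if "x \<in> S" for x using Suc.prems[OF that] by auto
  moreover have "C_nat_on n S (\<lambda>x. frechet_derivative f (at x) v)" for v
  proof (rule Suc.IH)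
    fix x assume "x \<in> S"
    from Suc.prems[OF this] show "\<exists>T. open T \<and> x \<in> T \<and> C_nat_on n T (\<lambda>x. frechet_derivative f (at x) v)" by auto
  qed
  ultimately show ?case by simp
qed

context riemannian
begin

text \<open>The parameters are cut into the open pieces \<open>T c d\<close>, on which the curve and
  its image stay in one chart each, so that the Euclidean chain rule applies. The second claim
  connects the derivative flow with velocities of transported curves.\<close>

lemma
  fixes \<sigma> :: "'a::euclidean_space \<Rightarrow> 'm"
  assumes \<sigma>: "C1m U \<sigma>" and \<Phi>: "Ck_map 1 \<A> \<A> D \<Phi>" "open D"
  shows C1m_compose: "C1m (U \<inter> \<sigma> -` D) (\<lambda>s. \<Phi> (\<sigma> s))"
    and tangent_map_pushf: "s \<in> U \<Longrightarrow> \<sigma> s \<in> D \<Longrightarrow>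
      tangent_map \<A> \<Phi> (\<sigma> s) (pushf \<sigma> s a) = pushf (\<lambda>s. \<Phi> (\<sigma> s)) s a"
proof -
  have c\<Phi>: "continuous_on D \<Phi>" using \<Phi> by (simp add: Ck_map_def)
  have oU: "open (U \<inter> \<sigma> -` D)" by (rule C1m_open_preimage[OF \<sigma> \<Phi>(2)])
  define T where "T c d = U \<inter> \<sigma> -` (cdom c \<inter> (D \<inter> \<Phi> -` cdom d))" for c d :: "('m, 'e) chart"
  have oT: "open (T c d)" if "c \<in> \<A>" "d \<in> \<A>" for c d
    unfolding T_def
    by (intro C1m_open_preimage[OF \<sigma>] open_Int open_cdom that continuous_open_preimage[OF c\<Phi> \<Phi>(2)])
  have sm: "C_nat_on (Suc 0) (cmap c ` (D \<inter> cdom c \<inter> \<Phi> -` cdom d)) (cmap d \<circ> \<Phi> \<circ> cinv c)"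
    if "c \<in> \<A>" "d \<in> \<A>" for c d
  proof -
    have "Ck_on 1 (cmap c ` (D \<inter> cdom c \<inter> \<Phi> -` cdom d)) (cmap d \<circ> \<Phi> \<circ> cinv c)"
      using \<Phi>(1) that unfolding Ck_map_def by blast
    then show ?thesis by (rule Ck_on_imp_C_nat_on) (simp add: one_enat_def)
  qed
  have s1: "C_nat_on (Suc 0) (T c d) (cmap c \<circ> \<sigma>)" if "c \<in> \<A>" for c d
  proof -
    have "C_nat_on (Suc 0) (U \<inter> \<sigma> -` cdom c) (cmap c \<circ> \<sigma>)" using \<sigma> that by (simp add: C1m_def)
    then show ?thesis by (rule C_nat_on_subset) (auto simp: T_def)
  qed
  have im: "(cmap c \<circ> \<sigma>) ` T c d \<subseteq> cmap c ` (D \<inter> cdom c \<inter> \<Phi> -` cdom d)" for c d :: "('m, 'e) chart"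
    by (auto simp: T_def)
  have eq: "(cmap d \<circ> \<Phi> \<circ> cinv c) ((cmap c \<circ> \<sigma>) s) = (cmap d \<circ> (\<lambda>s. \<Phi> (\<sigma> s))) s"
    if "c \<in> \<A>" "s \<in> T c d" for c d s
    using that by (simp add: T_def cinv_cmap)
  show "C1m (U \<inter> \<sigma> -` D) (\<lambda>s. \<Phi> (\<sigma> s))"
    unfolding C1m_def
  proof (intro conjI oU ballI)
    show "continuous_on (U \<inter> \<sigma> -` D) (\<lambda>s. \<Phi> (\<sigma> s))"
      using \<sigma> by (intro continuous_on_compose2[OF c\<Phi>]) (auto simp: C1m_def intro: continuous_on_subset)
    fix d assume d: "d \<in> \<A>"
    show "C_nat_on (Suc 0) (U \<inter> \<sigma> -` D \<inter> (\<lambda>s. \<Phi> (\<sigma> s)) -` cdom d) (cmap d \<circ> (\<lambda>s. \<Phi> (\<sigma> s)))"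
    proof (rule C_nat_on_local)
      fix s assume s: "s \<in> U \<inter> \<sigma> -` D \<inter> (\<lambda>s. \<Phi> (\<sigma> s)) -` cdom d"
      obtain c where c: "c \<in> \<A>" "\<sigma> s \<in> cdom c" using chart_ex by blast
      have "C_nat_on (Suc 0) (T c d) (\<lambda>s. (cmap d \<circ> \<Phi> \<circ> cinv c) ((cmap c \<circ> \<sigma>) s))"
        by (rule C1_compose[OF s1[OF c(1)] sm[OF c(1) d] im])
      then have "C_nat_on (Suc 0) (T c d) (cmap d \<circ> (\<lambda>s. \<Phi> (\<sigma> s)))"
        by (rule C_nat_on_cong[OF oT[OF c(1) d], rotated]) (rule eq[OF c(1)])
      then show "\<exists>T. open T \<and> s \<in> T \<and> C_nat_on (Suc 0) T (cmap d \<circ> (\<lambda>s. \<Phi> (\<sigma> s)))"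
        using oT[OF c(1) d] s c by (intro exI[of _ "T c d"]) (auto simp: T_def)
    qed
  qed
  assume s: "s \<in> U" "\<sigma> s \<in> D"
  \<comment> \<open>The chart has to be the one that \<open>tangent_map\<close> itself
    chooses.\<close>
  let ?c = "chart_at \<A> (\<sigma> s)"
  note c = chart_at[of "\<sigma> s"]
  show "tangent_map \<A> \<Phi> (\<sigma> s) (pushf \<sigma> s a) = pushf (\<lambda>s. \<Phi> (\<sigma> s)) s a"
  proof
    fix d
    show "tangent_map \<A> \<Phi> (\<sigma> s) (pushf \<sigma> s a) d = pushf (\<lambda>s. \<Phi> (\<sigma> s)) s a d"
    proof (cases "d \<in> \<A> \<and> \<Phi> (\<sigma> s) \<in> cdom d")
      case True
      then have d: "d \<in> \<A>" and sT: "s \<in> T ?c d" using s c by (auto simp: T_def)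
      have "((\<lambda>s. (cmap d \<circ> \<Phi> \<circ> cinv ?c) ((cmap ?c \<circ> \<sigma>) s)) has_derivative
        (\<lambda>v. frechet_derivative (cmap d \<circ> \<Phi> \<circ> cinv ?c) (at ((cmap ?c \<circ> \<sigma>) s)) (frechet_derivative (cmap ?c \<circ> \<sigma>) (at s) v))) (at s)"
        by (rule C1_compose_frechet_derivative[OF s1[OF c(1)] sm[OF c(1) d] _ sT]) (use im sT in blast)
      then have "((cmap d \<circ> (\<lambda>s. \<Phi> (\<sigma> s))) has_derivative
        (\<lambda>v. frechet_derivative (cmap d \<circ> \<Phi> \<circ> cinv ?c) (at ((cmap ?c \<circ> \<sigma>) s)) (frechet_derivative (cmap ?c \<circ> \<sigma>) (at s) v))) (at s)"
        by (rule has_derivative_transform_within_open[OF _ oT[OF c(1) d] sT eq[OF c(1)]])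
      from pushf_component[OF this d]
      have "pushf (\<lambda>s. \<Phi> (\<sigma> s)) s a d = frechet_derivative (cmap d \<circ> \<Phi> \<circ> cinv ?c) (at ((cmap ?c \<circ> \<sigma>) s)) (frechet_derivative (cmap ?c \<circ> \<sigma>) (at s) a)"
        using True by simp
      then show ?thesis using True c by (simp add: tangent_map_def Let_def pushf_def)
    next
      case False
      then show ?thesis by (auto simp: tangent_map_def Let_def pushf_def)
    qed
  qed
qed

text \<open>Dividing by the bound \<open>C\<close> instead of by the speed itself avoids a case distinction at zero speed.\<close>

lemma speed_le_tangent_op_norm:
  fixes \<sigma> :: "real \<Rightarrow> 'm"
  assumes \<sigma>: "C1m U \<sigma>" and \<Phi>: "Ck_map 1 \<A> \<A> D \<Phi>" "open D" and s: "s \<in> U" "\<sigma> s \<in> D"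
    and C: "0 < C" "speed \<sigma> s \<le> C"
  shows "ennreal (speed (\<lambda>s. \<Phi> (\<sigma> s)) s / C) \<le> tangent_op_norm \<A> g (\<sigma> s) (\<Phi> (\<sigma> s)) (tangent_map \<A> \<Phi> (\<sigma> s))"
proof -
  let ?\<gamma> = "\<lambda>s. \<Phi> (\<sigma> s)"
  let ?v = "pushf \<sigma> s (1 / C)"
  have m: "mdiff \<sigma> s" by (rule C1m_mdiff[OF \<sigma> s(1)])
  have m2: "mdiff ?\<gamma> s" by (rule C1m_mdiff[OF C1m_compose[OF \<sigma> \<Phi>]]) (use s in simp)
  have scale: "sqrt (g (f s) (pushf f s (1 / C)) (pushf f s (1 / C))) = speed f s / C" if f: "mdiff f s" for f :: "real \<Rightarrow> 'm"
  proof -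
    obtain c where c: "c \<in> \<A>" "f s \<in> cdom c" using chart_ex by blast
    interpret coord_metric "cran c" "mc c" by (rule coord_metric[OF c(1)])
    have y: "(cmap c \<circ> f) s \<in> cran c" using c by auto
    have "linear (\<lambda>a. pushf f s a c)"
      using has_derivative_bounded_linear[OF mdiff_chart[OF f c]] by (rule bounded_linear.linear)
    from linear_scale[OF this, of "1 / C" 1] have e: "pushf f s (1 / C) c = (1 / C) *\<^sub>R pushf f s 1 c" by simp
    show ?thesis
      using C(1) unfolding speed_def metric_pushf[OF f c] e G_scale_left[OF y] G_scale_right[OF y]
      by (simp add: real_sqrt_mult real_sqrt_divide)
  qed
  have "?v \<in> {v \<in> tangent_space \<A> (\<sigma> s). sqrt (g (\<sigma> s) v v) \<le> 1}"
  proof -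
    have "sqrt (g (\<sigma> s) ?v ?v) \<le> 1" unfolding scale[OF m] using C by simp
    then show ?thesis using pushf_in[OF m] by blast
  qed
  moreover have "ennreal (sqrt (g (\<Phi> (\<sigma> s)) (tangent_map \<A> \<Phi> (\<sigma> s) ?v) (tangent_map \<A> \<Phi> (\<sigma> s) ?v)))
     = ennreal (speed ?\<gamma> s / C)"
    unfolding tangent_map_pushf[OF \<sigma> \<Phi> s] using scale[OF m2] by simp
  ultimately show ?thesis
    unfolding tangent_op_norm_def by (metis (no_types, lifting) SUP_upper)
qed

end

section \<open>Paths transported by the flow\<close>

locale flow = riemannian \<A> g + prob_space P
  for \<A> :: "('m::{t2_space,second_countable_topology}, 'e::euclidean_space) chart set" and g
    and P :: "'w measure" +
  fixes F :: "real \<Rightarrow> 'm \<Rightarrow> 'w \<Rightarrow> 'm" and \<xi> :: "'m \<Rightarrow> 'w \<Rightarrow> ereal"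
  assumes F_measurable: "\<And>t x U. 0 \<le> t \<Longrightarrow> open U \<Longrightarrow> {\<omega> \<in> space P. ereal t < \<xi> x \<omega> \<and> F t x \<omega> \<in> U} \<in> sets P"
    and F_C1_flow: "partial_C1_flow \<A> P F \<xi>"
    and complete_1: "strongly_1_complete \<A> P \<xi>"
    and decay: "\<And>K. compact K \<Longrightarrow>
      ((\<lambda>t. SUP x\<in>K. expected_derivative_norm \<A> g P F \<xi> t x) \<longlongrightarrow> 0) at_top"
begin

text \<open>Bundles pathwise properties that hold for almost every sample point, so that the
  geometric arguments can be carried out for one fixed \<omega>.\<close>

definition regular :: "'w \<Rightarrow> bool" where
  "regular \<omega> \<longleftrightarrow> (\<forall>x. 0 < \<xi> x \<omega> \<and> F 0 x \<omega> = x) \<and>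
     (\<forall>t\<ge>0. Ck_diffeo_onto_open_image 1 \<A> \<A> {x. ereal t < \<xi> x \<omega>} (\<lambda>x. F t x \<omega>)) \<and>
     continuous_on {(s, x). 0 \<le> s \<and> ereal s < \<xi> x \<omega>} (\<lambda>(s, x). F s x \<omega>)"

lemma AE_regular: "AE \<omega> in P. regular \<omega>"
  using F_C1_flow unfolding partial_C1_flow_def regular_def by eventually_elim blast

definition smooth_path :: "(real \<Rightarrow> 'm) \<Rightarrow> real set \<Rightarrow> bool" where
  "smooth_path \<sigma> U \<longleftrightarrow> open U \<and> {0..1} \<subseteq> U \<and> Ck_map \<infinity> euclidean_atlas \<A> U \<sigma>"

lemma smooth_path_C1m: "smooth_path \<sigma> U \<Longrightarrow> C1m U \<sigma>"
  unfolding smooth_path_def by (rule C1m_Ck_map) auto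

text \<open>Strong 1-completeness concerns the infimum over the whole segment, so one null set
  serves all parameters at once.\<close>

lemma AE_no_explosion:
  assumes "smooth_path \<sigma> U" shows "AE \<omega> in P. \<forall>s\<in>{0..1}. \<xi> (\<sigma> s) \<omega> = \<infinity>"
proof -
  have "smooth_1_simplex_image \<A> (\<sigma> ` {0..1})"
    using assms unfolding smooth_path_def smooth_1_simplex_image_def by blast
  then have "AE \<omega> in P. (INF x\<in>\<sigma> ` {0..1}. \<xi> x \<omega>) = \<infinity>"
    using complete_1 by (simp add: strongly_1_complete_def)
  then show ?thesis
  proof eventually_elim
    case (elim \<omega>)
    show ?case
    proof
      fix s :: real assume "s \<in> {0..1}"
      then have "(INF x\<in>\<sigma> ` {0..1}. \<xi> x \<omega>) \<le> \<xi> (\<sigma> s) \<omega>" by (intro INF_lower) auto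
      then show "\<xi> (\<sigma> s) \<omega> = \<infinity>" using elim by simp
    qed
  qed
qed

lemma regular_C1:
  assumes "regular \<omega>" "0 \<le> t"
  shows "Ck_map 1 \<A> \<A> {x. ereal t < \<xi> x \<omega>} (\<lambda>x. F t x \<omega>)" "open {x. ereal t < \<xi> x \<omega>}"
  using assms unfolding regular_def Ck_diffeo_onto_open_image_def by blast+

abbreviation moved :: "real \<Rightarrow> (real \<Rightarrow> 'm) \<Rightarrow> 'w \<Rightarrow> real \<Rightarrow> 'm" where
  "moved t \<sigma> \<omega> s \<equiv> F t (\<sigma> s) \<omega>"

text \<open>For regular \<omega> this is an open set, and it contains the unit interval when no
  point of the path explodes; hence transported paths have two-sided derivatives at 0 and 1 as
  well.\<close>

definition alive :: "real \<Rightarrow> (real \<Rightarrow> 'm) \<Rightarrow> real set \<Rightarrow> 'w \<Rightarrow> real set" where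
  "alive t \<sigma> U \<omega> = U \<inter> \<sigma> -` {x. ereal t < \<xi> x \<omega>}"

lemma moved_C1m:
  assumes "smooth_path \<sigma> U" "regular \<omega>" "0 \<le> t"
  shows "C1m (alive t \<sigma> U \<omega>) (moved t \<sigma> \<omega>)"
  unfolding alive_def by (rule C1m_compose[OF smooth_path_C1m[OF assms(1)] regular_C1[OF assms(2,3)]])

lemma alive_interval:
  assumes "smooth_path \<sigma> U" "\<forall>s\<in>{0..1}. \<xi> (\<sigma> s) \<omega> = \<infinity>"
  shows "{0..1} \<subseteq> alive t \<sigma> U \<omega>"
  using assms by (auto simp: alive_def smooth_path_def)

text \<open>Measurability is available for events that the moving point lies in an open set. Cutting
  f off to the open set S reduces preimages to such events, and the default 0 only adds a
  complement.\<close>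

lemma measurable_moved:
  fixes f :: "'m \<Rightarrow> real"
  assumes t: "0 \<le> t" and c: "open S" "continuous_on S f"
  shows "(\<lambda>\<omega>. if ereal t < \<xi> x \<omega> \<and> F t x \<omega> \<in> S then f (F t x \<omega>) else 0) \<in> borel_measurable P"
proof (rule borel_measurableI)
  fix V :: "real set" assume V: "open V"
  let ?A = "{\<omega> \<in> space P. ereal t < \<xi> x \<omega> \<and> F t x \<omega> \<in> S}"
  have "open (S \<inter> f -` V)" by (rule continuous_open_preimage[OF c(2,1) V])
  then have 1: "{\<omega> \<in> space P. ereal t < \<xi> x \<omega> \<and> F t x \<omega> \<in> S \<inter> f -` V} \<in> sets P" by (rule F_measurable[OF t])
  have 2: "?A \<in> sets P" by (rule F_measurable[OF t c(1)])
  have eq: "(\<lambda>\<omega>. if ereal t < \<xi> x \<omega> \<and> F t x \<omega> \<in> S then f (F t x \<omega>) else 0) -` V \<inter> space P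
     = {\<omega> \<in> space P. ereal t < \<xi> x \<omega> \<and> F t x \<omega> \<in> S \<inter> f -` V} \<union> (if 0 \<in> V then space P - ?A else {})"
    by (auto split: if_splits)
  show "(\<lambda>\<omega>. if ereal t < \<xi> x \<omega> \<and> F t x \<omega> \<in> S then f (F t x \<omega>) else 0) -` V \<inter> space P \<in> sets P"
    unfolding eq using 1 sets.compl_sets[OF 2]
    by (cases "0 \<in> V") (simp_all only: if_True if_False Un_empty_right sets.Un simp_thms)
qed

text \<open>Second countability provides a countable subatlas, so that a chart around a random point
  can be selected measurably by its least index.\<close>

lemma countable_charts:
  obtains c :: "nat \<Rightarrow> ('m, 'e) chart" where "\<And>n. c n \<in> \<A>" "\<And>x. \<exists>n. x \<in> cdom (c n)"
proof -
  obtain \<D> where \<D>: "\<D> \<subseteq> cdom ` \<A>" "countable \<D>" "\<Union>\<D> = \<Union>(cdom ` \<A>)"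
    using Lindelof[of "cdom ` \<A>"] open_cdom by blast
  have U: "\<Union>(cdom ` \<A>) = UNIV" using chart_ex by blast
  then have ne: "\<D> \<noteq> {}" using \<D>(3) by auto
  have "\<forall>n. \<exists>c. c \<in> \<A> \<and> from_nat_into \<D> n = cdom c"
    using subsetD[OF \<D>(1) from_nat_into[OF ne]] by blast
  from choice[OF this] obtain c where c: "\<And>n. c n \<in> \<A>" "\<And>n. from_nat_into \<D> n = cdom (c n)" by blast
  have "\<exists>n. x \<in> cdom (c n)" for x
  proof -
    obtain D where "D \<in> \<D>" "x \<in> D" using U \<D>(3) by blast
    then obtain n where "from_nat_into \<D> n = D" using from_nat_into_surj[OF \<D>(2)] by blast
    then show ?thesis using \<open>x \<in> D\<close> c(2)[of n] by auto
  qed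
  then show ?thesis by (rule that[OF c(1)])
qed

text \<open>
  The derivative in \<open>s\<close> is a limit of difference quotients of random variables, in countably many charts.
\<close>

lemma measurable_speed:
  assumes \<sigma>: "smooth_path \<sigma> U" and s: "s \<in> {0..1}" and t: "0 \<le> t"
  shows "\<exists>h \<in> borel_measurable P. AE \<omega> in P. h \<omega> = speed (moved t \<sigma> \<omega>) s"
proof -
  obtain c :: "nat \<Rightarrow> ('m, 'e) chart" where c: "\<And>n. c n \<in> \<A>" "\<And>x. \<exists>n. x \<in> cdom (c n)"
    by (rule countable_charts) (rule that)
  define al where "al n r \<omega> \<longleftrightarrow> ereal t < \<xi> (\<sigma> r) \<omega> \<and> moved t \<sigma> \<omega> r \<in> cdom (c n)" for n r \<omega>
  define \<phi> where "\<phi> n i r \<omega> = (if al n r \<omega> then cmap (c n) (moved t \<sigma> \<omega> r) \<bullet> i else 0)" for n i r \<omega>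
  \<comment> \<open>For n = \<open>idx \<omega>\<close> and almost every \<omega> this is a
    component of the velocity. The operator \<open>lim\<close> yields a measurable function even
    where the quotients diverge.\<close>
  define D where "D n i \<omega> = lim (\<lambda>k. (\<phi> n i (s + 1 / Suc k) \<omega> - \<phi> n i s \<omega>) * Suc k)" for n i \<omega>
  define G where "G n i j \<omega> = (if al n s \<omega> then mc (c n) (cmap (c n) (moved t \<sigma> \<omega> s)) i j else 0)" for n i j \<omega>
  define h where "h n \<omega> = sqrt (\<Sum>i\<in>Basis. \<Sum>j\<in>Basis. D n i \<omega> * D n j \<omega> * G n i j \<omega>)" for n \<omega>
  define idx where "idx \<omega> = (LEAST n. al n s \<omega>)" for \<omega>
  have \<phi>_meas: "\<phi> n i r \<in> borel_measurable P" for n i r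
    unfolding \<phi>_def[abs_def] al_def
    by (rule measurable_moved[OF t open_cdom[OF c(1)], where f = "\<lambda>x. cmap (c n) x \<bullet> i"])
       (intro continuous_on_inner continuous_cmap[OF c(1)] continuous_on_const)
  have G_meas: "G n i j \<in> borel_measurable P" for n i j
  proof -
    interpret coord_metric "cran (c n)" "mc (c n)" by (rule coord_metric[OF c(1)])
    show ?thesis
      unfolding G_def[abs_def] al_def
      by (rule measurable_moved[OF t open_cdom[OF c(1)], where f = "\<lambda>x. mc (c n) (cmap (c n) x) i j"])
         (intro continuous_on_G continuous_on_const continuous_cmap[OF c(1)] order_refl)
  qed
  have D_meas: "D n i \<in> borel_measurable P" for n i
    unfolding D_def[abs_def] by (intro borel_measurable_lim_metric borel_measurable_times borel_measurable_diff \<phi>_meas) simp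
  have h_meas: "h n \<in> borel_measurable P" for n
    unfolding h_def[abs_def]
    by (intro borel_measurable_continuous_on[OF continuous_on_real_sqrt[OF continuous_on_id]]
        borel_measurable_sum borel_measurable_times D_meas G_meas)
  have idx_meas: "idx \<in> measurable P (count_space UNIV)"
    unfolding idx_def[abs_def]
  proof (rule measurable_Least)
    fix n
    have "{\<omega> \<in> space P. al n s \<omega>} \<in> sets P"
      unfolding al_def by (rule F_measurable[OF t open_cdom[OF c(1)]])
    then show "al n s \<in> measurable P (count_space UNIV)" by (simp add: pred_def)
  qed
  have "(\<lambda>\<omega>. h (idx \<omega>) \<omega>) \<in> borel_measurable P"
    by (rule measurable_compose_countable[OF h_meas idx_meas])
  moreover have "AE \<omega> in P. h (idx \<omega>) \<omega> = speed (moved t \<sigma> \<omega>) s"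
    using AE_regular AE_no_explosion[OF \<sigma>]
  proof eventually_elim
    case (elim \<omega>)
    let ?\<gamma> = "moved t \<sigma> \<omega>"
    let ?V = "alive t \<sigma> U \<omega>"
    have \<gamma>: "C1m ?V ?\<gamma>" by (rule moved_C1m[OF \<sigma> elim(1) t])
    have sV: "s \<in> ?V" using alive_interval[OF \<sigma> elim(2)] s by blast
    have ex: "\<exists>n. al n s \<omega>" using c(2)[of "?\<gamma> s"] elim(2) s by (auto simp: al_def)
    define n where "n = idx \<omega>"
    have al: "al n s \<omega>" unfolding n_def idx_def using ex by (rule LeastI_ex)
    let ?d = "c n"
    have d: "?d \<in> \<A>" "?\<gamma> s \<in> cdom ?d" using al c(1) by (auto simp: al_def)
    interpret coord_metric "cran ?d" "mc ?d" by (rule coord_metric[OF d(1)])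
    have m: "mdiff ?\<gamma> s" by (rule C1m_mdiff[OF \<gamma> sV])
    have D: "D n i \<omega> = pushf ?\<gamma> s 1 ?d \<bullet> i" for i
    proof -
      have "((\<lambda>r. (cmap ?d \<circ> ?\<gamma>) r \<bullet> i) has_derivative (\<lambda>a. pushf ?\<gamma> s a ?d \<bullet> i)) (at s)"
        by (rule bounded_linear.has_derivative[OF bounded_linear_inner_left mdiff_chart[OF m d]])
      moreover have lin: "pushf ?\<gamma> s a ?d = a *\<^sub>R pushf ?\<gamma> s 1 ?d" for a
        using linear_scale[OF bounded_linear.linear[OF has_derivative_bounded_linear[OF mdiff_chart[OF m d]]], of a 1]
        by simp
      have "(\<lambda>a. pushf ?\<gamma> s a ?d \<bullet> i) = (\<lambda>a. a *\<^sub>R (pushf ?\<gamma> s 1 ?d \<bullet> i))"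
        by (rule ext) (subst lin, simp only: inner_scaleR_left real_scaleR_def)
      ultimately have "((\<lambda>r. (cmap ?d \<circ> ?\<gamma>) r \<bullet> i) has_real_derivative pushf ?\<gamma> s 1 ?d \<bullet> i) (at s)"
        by (simp add: has_real_derivative_iff_has_vector_derivative has_vector_derivative_def)
      then have lim: "((\<lambda>h. ((cmap ?d \<circ> ?\<gamma>) (s + h) \<bullet> i - (cmap ?d \<circ> ?\<gamma>) s \<bullet> i) / h) \<longlongrightarrow> pushf ?\<gamma> s 1 ?d \<bullet> i) (at 0)"
        by (simp add: DERIV_def)
      have seq: "filterlim (\<lambda>k. 1 / real (Suc k)) (at 0) sequentially"
        unfolding filterlim_at using LIMSEQ_inverse_real_of_nat by (simp add: inverse_eq_divide)
      have "(\<lambda>k. ((cmap ?d \<circ> ?\<gamma>) (s + 1 / Suc k) \<bullet> i - (cmap ?d \<circ> ?\<gamma>) s \<bullet> i) / (1 / Suc k)) \<longlonglongrightarrow> pushf ?\<gamma> s 1 ?d \<bullet> i"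
        by (rule filterlim_compose[OF lim seq])
      moreover have "\<forall>\<^sub>F k in sequentially. ((cmap ?d \<circ> ?\<gamma>) (s + 1 / Suc k) \<bullet> i - (cmap ?d \<circ> ?\<gamma>) s \<bullet> i) / (1 / Suc k)
        = (\<phi> n i (s + 1 / Suc k) \<omega> - \<phi> n i s \<omega>) * Suc k"
      proof -
        \<comment> \<open>The parameters s + 1 / Suc k may lie beyond 1. Eventually they fall into
          this open set, where the path is alive and in the chart and the default value in \<phi>
          does not occur.\<close>
        have "open (?V \<inter> ?\<gamma> -` cdom ?d)" by (rule C1m_open_preimage[OF \<gamma> open_cdom[OF d(1)]])
        moreover have "(\<lambda>k. s + 1 / Suc k) \<longlonglongrightarrow> s + 0"
          by (intro tendsto_intros) (use LIMSEQ_inverse_real_of_nat in \<open>simp add: inverse_eq_divide\<close>)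
        ultimately have "\<forall>\<^sub>F k in sequentially. s + 1 / Suc k \<in> ?V \<inter> ?\<gamma> -` cdom ?d"
          using sV d(2) by (intro topological_tendstoD) auto
        then show ?thesis
        proof eventually_elim
          case (elim k)
          then have "al n (s + 1 / Suc k) \<omega>" by (simp add: al_def alive_def)
          then show ?case using al by (simp add: \<phi>_def)
        qed
      qed
      ultimately have "(\<lambda>k. (\<phi> n i (s + 1 / Suc k) \<omega> - \<phi> n i s \<omega>) * Suc k) \<longlonglongrightarrow> pushf ?\<gamma> s 1 ?d \<bullet> i"
        by (rule Lim_transform_eventually)
      then show ?thesis unfolding D_def by (rule limI)
    qed
    have "speed ?\<gamma> s = sqrt (mc ?d (cmap ?d (?\<gamma> s)) (pushf ?\<gamma> s 1 ?d) (pushf ?\<gamma> s 1 ?d))"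
      unfolding speed_def metric_pushf[OF m d] by simp
    also have "mc ?d (cmap ?d (?\<gamma> s)) (pushf ?\<gamma> s 1 ?d) (pushf ?\<gamma> s 1 ?d)
       = (\<Sum>i\<in>Basis. \<Sum>j\<in>Basis. D n i \<omega> * D n j \<omega> * G n i j \<omega>)"
      using G_expand[of "cmap ?d (?\<gamma> s)" "pushf ?\<gamma> s 1 ?d" "pushf ?\<gamma> s 1 ?d"] d(2) al by (simp add: D G_def)
    finally show ?case unfolding h_def n_def ..
  qed
  ultimately show ?thesis by (intro bexI[of _ "\<lambda>\<omega>. h (idx \<omega>) \<omega>"])
qed

end

section \<open>Expected length and confinement of transported paths\<close>

context flow
begin

text \<open>The bound \<Lambda> is a lower limit of Riemann sums, and Fatou's lemma estimates its
  mean by that of the sums. Each summand is controlled by the expected derivative norm at one point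
  of the path, with C bounding the speed of \<sigma>.\<close>

lemma length_process:
  assumes \<sigma>: "smooth_path \<sigma> U"
  shows "\<exists>C>0. \<forall>t\<ge>0. \<exists>\<Lambda>\<in>borel_measurable P.
     (AE \<omega> in P. ennreal (integral {0..1} (speed (moved t \<sigma> \<omega>))) \<le> \<Lambda> \<omega>) \<and>
     (\<integral>\<^sup>+\<omega>. \<Lambda> \<omega> \<partial>P) \<le> ennreal C * (SUP x\<in>\<sigma> ` {0..1}. expected_derivative_norm \<A> g P F \<xi> t x)"
proof -
  have \<sigma>1: "C1m U \<sigma>" by (rule smooth_path_C1m[OF \<sigma>])
  have sub: "{0..1} \<subseteq> U" using \<sigma> by (simp add: smooth_path_def)
  have "compact (speed \<sigma> ` {0..1})"
    by (rule compact_continuous_image[OF continuous_speed[OF \<sigma>1 sub]]) simp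
  from compact_imp_bounded[OF this] obtain C0 where C0: "\<forall>x\<in>speed \<sigma> ` {0..1}. norm x \<le> C0"
    unfolding bounded_iff by blast
  \<comment> \<open>The summand 1 makes C positive even for a constant path, as the division by C
    requires.\<close>
  define C where "C = \<bar>C0\<bar> + 1"
  have C1: "0 < C" by (simp add: C_def)
  have C2: "speed \<sigma> s \<le> C" if "s \<in> {0..1}" for s
    using bspec[OF C0 imageI[OF that]] by (simp add: C_def)
  note C = C1 C2
  have "\<exists>\<Lambda>\<in>borel_measurable P.
     (AE \<omega> in P. ennreal (integral {0..1} (speed (moved t \<sigma> \<omega>))) \<le> \<Lambda> \<omega>) \<and>
     (\<integral>\<^sup>+\<omega>. \<Lambda> \<omega> \<partial>P) \<le> ennreal C * (SUP x\<in>\<sigma> ` {0..1}. expected_derivative_norm \<A> g P F \<xi> t x)"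
    if t: "0 \<le> t" for t
  proof -
    let ?S = "SUP x\<in>\<sigma> ` {0..1}. expected_derivative_norm \<A> g P F \<xi> t x"
    have "\<forall>s. \<exists>h. s \<in> {0..1} \<longrightarrow> h \<in> borel_measurable P \<and> (AE \<omega> in P. h \<omega> = speed (moved t \<sigma> \<omega>) s)"
      using measurable_speed[OF \<sigma> _ t] by blast
    from choice[OF this] obtain h where
      h: "\<And>s. s \<in> {0..1} \<Longrightarrow> h s \<in> borel_measurable P" "\<And>s. s \<in> {0..1} \<Longrightarrow> AE \<omega> in P. h s \<omega> = speed (moved t \<sigma> \<omega>) s"
      by blast
    define pt where "pt n i = real i / real (Suc n)" for n i
    have pt: "pt n i \<in> {0..1}" if "i < Suc n" for n i using that by (simp add: pt_def)
    define R where "R n \<omega> = (\<Sum>i<Suc n. ennreal (h (pt n i) \<omega> / real (Suc n)))" for n \<omega>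
    define \<Lambda> where "\<Lambda> \<omega> = liminf (\<lambda>n. R n \<omega>)" for \<omega>
    have hm: "(\<lambda>\<omega>. ennreal (h s \<omega> / k)) \<in> borel_measurable P" if "s \<in> {0..1}" for s k
      using h(1)[OF that] by simp
    have R_meas: "R n \<in> borel_measurable P" for n
      unfolding R_def[abs_def] by (intro borel_measurable_sum hm pt) simp
    then have \<Lambda>_meas: "\<Lambda> \<in> borel_measurable P"
      unfolding \<Lambda>_def[abs_def] by (rule borel_measurable_liminf)
    \<comment> \<open>Only countably many parameters occur in the Riemann sums, so the exceptional
      sets unite to a null set.\<close>
    have "AE \<omega> in P. \<forall>n. \<forall>i. i < Suc n \<longrightarrow> h (pt n i) \<omega> = speed (moved t \<sigma> \<omega>) (pt n i)"
      unfolding AE_all_countable using h(2)[OF pt] by (auto intro: AE_impI)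
    with AE_regular AE_no_explosion[OF \<sigma>]
    have "AE \<omega> in P. ennreal (integral {0..1} (speed (moved t \<sigma> \<omega>))) \<le> \<Lambda> \<omega>"
    proof eventually_elim
      case (elim \<omega>)
      let ?\<gamma> = "moved t \<sigma> \<omega>"
      have \<gamma>: "C1m (alive t \<sigma> U \<omega>) ?\<gamma>" by (rule moved_C1m[OF \<sigma> elim(1) t])
      have sub': "{0..1} \<subseteq> alive t \<sigma> U \<omega>" by (rule alive_interval[OF \<sigma> elim(2)])
      have nn: "0 \<le> speed ?\<gamma> s" if "s \<in> {0..1}" for s
        by (rule speed_nonneg[OF \<gamma>]) (use sub' that in blast)
      have "R n \<omega> = ennreal (\<Sum>i<Suc n. speed ?\<gamma> (pt n i) / real (Suc n))" for n
      proof -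
        have "R n \<omega> = (\<Sum>i<Suc n. ennreal (speed ?\<gamma> (pt n i) / real (Suc n)))"
          unfolding R_def by (intro sum.cong refl) (use elim(3) in simp)
        also have "\<dots> = ennreal (\<Sum>i<Suc n. speed ?\<gamma> (pt n i) / real (Suc n))"
          by (intro sum_ennreal divide_nonneg_nonneg nn pt) auto
        finally show ?thesis .
      qed
      moreover have "(\<lambda>n. ennreal (\<Sum>i<Suc n. speed ?\<gamma> (pt n i) / real (Suc n))) \<longlonglongrightarrow> ennreal (integral {0..1} (speed ?\<gamma>))"
        unfolding pt_def
        by (intro tendsto_ennrealI continuous_Riemann_sums continuous_speed[OF \<gamma> sub'])
      ultimately have "(\<lambda>n. R n \<omega>) \<longlonglongrightarrow> ennreal (integral {0..1} (speed ?\<gamma>))" by simp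
      from lim_imp_Liminf[OF _ this] show ?case by (simp add: \<Lambda>_def)
    qed
    moreover have "(\<integral>\<^sup>+\<omega>. \<Lambda> \<omega> \<partial>P) \<le> ennreal C * ?S"
    proof -
      have one: "(\<integral>\<^sup>+\<omega>. ennreal (h s \<omega> / k) \<partial>P) \<le> ennreal (C / k) * ?S" if s: "s \<in> {0..1}" and k: "0 < k" for s k
      proof -
        have "(\<integral>\<^sup>+\<omega>. ennreal (h s \<omega> / k) \<partial>P) = (\<integral>\<^sup>+\<omega>. ennreal (C / k) * ennreal (h s \<omega> / C) \<partial>P)"
          using C(1) k by (intro nn_integral_cong) (simp add: ennreal_mult'[symmetric])
        also have "\<dots> = ennreal (C / k) * (\<integral>\<^sup>+\<omega>. ennreal (h s \<omega> / C) \<partial>P)"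
          by (rule nn_integral_cmult[OF hm[OF s]])
        also have "(\<integral>\<^sup>+\<omega>. ennreal (h s \<omega> / C) \<partial>P) \<le> expected_derivative_norm \<A> g P F \<xi> t (\<sigma> s)"
          unfolding expected_derivative_norm_def
        proof (rule nn_integral_mono_AE)
          show "AE \<omega> in P. ennreal (h s \<omega> / C) \<le> (if ereal t < \<xi> (\<sigma> s) \<omega>
              then tangent_op_norm \<A> g (\<sigma> s) (F t (\<sigma> s) \<omega>) (tangent_map \<A> (\<lambda>z. F t z \<omega>) (\<sigma> s)) else 0)"
            using AE_regular AE_no_explosion[OF \<sigma>] h(2)[OF s]
          proof eventually_elim
            case (elim \<omega>)
            have "\<xi> (\<sigma> s) \<omega> = \<infinity>" using elim(2) s by blast
            moreover have "ennreal (speed (\<lambda>s. F t (\<sigma> s) \<omega>) s / C)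
               \<le> tangent_op_norm \<A> g (\<sigma> s) (F t (\<sigma> s) \<omega>) (tangent_map \<A> (\<lambda>z. F t z \<omega>) (\<sigma> s))"
              by (rule speed_le_tangent_op_norm[OF \<sigma>1 regular_C1[OF elim(1) t] _ _ C(1) C(2)[OF s]])
                 (use s sub calculation in auto)
            ultimately show ?case using elim(3) by simp
          qed
        qed
        also have "expected_derivative_norm \<A> g P F \<xi> t (\<sigma> s) \<le> ?S"
          by (rule SUP_upper) (use s in blast)
        finally show ?thesis by (simp add: mult_left_mono)
      qed
      have "(\<integral>\<^sup>+\<omega>. R n \<omega> \<partial>P) \<le> ennreal C * ?S" for n
      proof -
        have "(\<integral>\<^sup>+\<omega>. R n \<omega> \<partial>P) = (\<Sum>i<Suc n. \<integral>\<^sup>+\<omega>. ennreal (h (pt n i) \<omega> / real (Suc n)) \<partial>P)"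
          unfolding R_def by (intro nn_integral_sum hm pt) simp
        also have "\<dots> \<le> (\<Sum>i<Suc n. ennreal (C / real (Suc n)) * ?S)"
          by (intro sum_mono one pt) auto
        also have "\<dots> = (of_nat (Suc n) * ennreal (C / real (Suc n))) * ?S"
          by (simp only: sum_constant card_lessThan mult.assoc)
        also have "of_nat (Suc n) * ennreal (C / real (Suc n)) = ennreal (real (Suc n) * (C / real (Suc n)))"
          unfolding ennreal_of_nat_eq_real_of_nat using C(1) by (intro ennreal_mult[symmetric]) auto
        also have "real (Suc n) * (C / real (Suc n)) = C" by simp
        finally show ?thesis .
      qed
      then have "liminf (\<lambda>n. \<integral>\<^sup>+\<omega>. R n \<omega> \<partial>P) \<le> liminf (\<lambda>n. ennreal C * ?S)"
        by (intro Liminf_mono always_eventually allI)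
      then have "liminf (\<lambda>n. \<integral>\<^sup>+\<omega>. R n \<omega> \<partial>P) \<le> ennreal C * ?S"
        by (simp add: Liminf_const)
      then show ?thesis
        unfolding \<Lambda>_def by (rule order_trans[OF nn_integral_liminf[OF R_meas]])
    qed
    ultimately show ?thesis using \<Lambda>_meas by blast
  qed
  then show ?thesis using C(1) by blast
qed

text \<open>The exponential image of the closed ball of radius a. Radii are extended nonnegative
  reals because the random length bounds are.\<close>

definition reach :: "'m \<Rightarrow> ('m, 'e) chart \<Rightarrow> ennreal \<Rightarrow> 'm \<Rightarrow> bool" where
  "reach p c0 a y \<longleftrightarrow> (\<exists>u. y = exp_map \<A> g p (tvec_of \<A> c0 p u) \<and>
     ennreal (sqrt (mc c0 (cmap c0 p) u u)) \<le> a)"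

lemma reach_mono: "reach p c0 a y \<Longrightarrow> a \<le> b \<Longrightarrow> reach p c0 b y"
  unfolding reach_def using order_trans by blast

text \<open>Nothing is asked at the junctions; strong 1-completeness and the length estimate are
  applied to each smooth piece separately.\<close>

inductive pw_smooth :: "(real \<Rightarrow> 'm) \<Rightarrow> bool" where
  single: "smooth_path \<sigma> U \<Longrightarrow> pw_smooth \<sigma>"
| join: "pw_smooth p \<Longrightarrow> pw_smooth q \<Longrightarrow> pathfinish p = pathstart q \<Longrightarrow> pw_smooth (p +++ q)"

text \<open>Centre and initial distance a are arbitrary, not just the starting point and 0: in a
  concatenation the second piece begins where the first has already used up part of the
  radius.\<close>

definition confined :: "(real \<Rightarrow> 'm) \<Rightarrow> ennreal \<Rightarrow> bool" where
  "confined \<gamma> l \<longleftrightarrow> (\<forall>p c0 r a. normal_ball \<A> g p c0 r \<longrightarrow> reach p c0 a (\<gamma> 0) \<longrightarrow> a + l < ennreal r \<longrightarrow>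
     (\<forall>s\<in>{0..1}. reach p c0 (a + l) (\<gamma> s)))"

lemma confinedD:
  "confined \<gamma> l \<Longrightarrow> normal_ball \<A> g p c0 r \<Longrightarrow> reach p c0 a (\<gamma> 0) \<Longrightarrow> a + l < ennreal r \<Longrightarrow>
    s \<in> {0..1} \<Longrightarrow> reach p c0 (a + l) (\<gamma> s)"
  unfolding confined_def by blast

text \<open>
  \<open>\<Lambda> t\<close> bounds the length of the path transported by the flow up to time \<open>t\<close>; lengths enter only through
  the fact that a curve does not leave a normal ball whose radius exceeds its length.
\<close>

definition controls :: "(real \<Rightarrow> 'm) \<Rightarrow> (real \<Rightarrow> 'w \<Rightarrow> ennreal) \<Rightarrow> bool" where
  "controls q \<Lambda> \<longleftrightarrow> (\<forall>t\<ge>0. \<Lambda> t \<in> borel_measurable P) \<and> ((\<lambda>t. \<integral>\<^sup>+\<omega>. \<Lambda> t \<omega> \<partial>P) \<longlongrightarrow> 0) at_top \<and>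
     (\<forall>t\<ge>0. AE \<omega> in P. confined (moved t q \<omega>) (\<Lambda> t \<omega>))"

lemma smooth_path_confined:
  assumes \<sigma>: "smooth_path \<sigma> U" and t: "0 \<le> t" and \<omega>: "regular \<omega>" "\<forall>s\<in>{0..1}. \<xi> (\<sigma> s) \<omega> = \<infinity>"
    and L: "ennreal (integral {0..1} (speed (moved t \<sigma> \<omega>))) \<le> l"
  shows "confined (moved t \<sigma> \<omega>) l"
  unfolding confined_def
proof (intro allI impI ballI)
  fix p c0 r a s
  assume ball: "normal_ball \<A> g p c0 r" and start: "reach p c0 a (moved t \<sigma> \<omega> 0)"
    and small: "a + l < ennreal r" and s: "s \<in> {0..1::real}"
  interpret normal_ball \<A> g p c0 r by (rule ball)
  let ?\<gamma> = "moved t \<sigma> \<omega>"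
  let ?L = "integral {0..1} (speed ?\<gamma>)"
  have \<gamma>: "C1m (alive t \<sigma> U \<omega>) ?\<gamma>" by (rule moved_C1m[OF \<sigma> \<omega>(1) t])
  have sub: "{0..1} \<subseteq> alive t \<sigma> U \<omega>" by (rule alive_interval[OF \<sigma> \<omega>(2)])
  have L0: "0 \<le> ?L"
    by (rule integral_nonneg[OF integrable_continuous_real[OF continuous_speed[OF \<gamma> sub]]])
       (use speed_nonneg[OF \<gamma>] sub in blast)
  obtain u where u: "?\<gamma> 0 = E u" "ennreal (nrm u) \<le> a"
    using start unfolding reach_def E_def N_def by blast
  have le: "ennreal (nrm u + ?L) \<le> a + l"
    unfolding ennreal_plus[OF real_sqrt_ge_zero[OF N_nonneg] L0] by (rule add_mono[OF u(2) L])
  also note small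
  finally have lt: "nrm u + ?L < r" using L0 N_nonneg by (subst (asm) ennreal_less_iff) auto
  then have "u \<in> B" using L0 by (simp add: B_def)
  from short_curve_in_ball[OF \<gamma> sub u(1) this lt s]
  obtain v where v: "v \<in> B" "?\<gamma> s = E v" "nrm v \<le> nrm u + ?L" by blast
  have "ennreal (nrm v) \<le> a + l" by (rule order_trans[OF ennreal_leI[OF v(3)] le])
  then show "reach p c0 (a + l) (moved t \<sigma> \<omega> s)" using v(2) unfolding reach_def E_def N_def by blast
qed

lemma pw_smooth_path: "pw_smooth q \<Longrightarrow> path q"
proof (induction rule: pw_smooth.induct)
  case (single \<sigma> U)
  then show ?case
    using smooth_path_C1m[OF single] unfolding path_def smooth_path_def C1m_def
    by (blast intro: continuous_on_subset)
qed simp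

lemma pw_smooth_no_explosion: "pw_smooth q \<Longrightarrow> AE \<omega> in P. \<forall>s\<in>{0..1}. \<xi> (q s) \<omega> = \<infinity>"
proof (induction rule: pw_smooth.induct)
  case (single \<sigma> U)
  then show ?case by (rule AE_no_explosion)
next
  case (join p q)
  from join.IH show ?case by eventually_elim (auto simp: joinpaths_def)
qed

text \<open>For a smooth path the bound comes from \<open>length_process\<close> and the decay on
  the compact image; for a concatenation the two bounds are added.\<close>

lemma pw_smooth_controls: "pw_smooth q \<Longrightarrow> \<exists>\<Lambda>. controls q \<Lambda>"
proof (induction rule: pw_smooth.induct)
  case (single \<sigma> U)
  let ?S = "\<lambda>t. SUP x\<in>\<sigma> ` {0..1}. expected_derivative_norm \<A> g P F \<xi> t x"
  obtain C where C: "0 < C" "\<And>t. 0 \<le> t \<Longrightarrow> \<exists>\<Lambda>\<in>borel_measurable P.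
     (AE \<omega> in P. ennreal (integral {0..1} (speed (moved t \<sigma> \<omega>))) \<le> \<Lambda> \<omega>) \<and>
     (\<integral>\<^sup>+\<omega>. \<Lambda> \<omega> \<partial>P) \<le> ennreal C * ?S t"
    using length_process[OF single] by blast
  have "\<forall>t. \<exists>\<Lambda>. 0 \<le> t \<longrightarrow> \<Lambda> \<in> borel_measurable P \<and>
     (AE \<omega> in P. ennreal (integral {0..1} (speed (moved t \<sigma> \<omega>))) \<le> \<Lambda> \<omega>) \<and>
     (\<integral>\<^sup>+\<omega>. \<Lambda> \<omega> \<partial>P) \<le> ennreal C * ?S t"
    using C(2) by blast
  from choice[OF this] obtain \<Lambda> where \<Lambda>: "\<And>t. 0 \<le> t \<Longrightarrow> \<Lambda> t \<in> borel_measurable P"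
     "\<And>t. 0 \<le> t \<Longrightarrow> AE \<omega> in P. ennreal (integral {0..1} (speed (moved t \<sigma> \<omega>))) \<le> \<Lambda> t \<omega>"
     "\<And>t. 0 \<le> t \<Longrightarrow> (\<integral>\<^sup>+\<omega>. \<Lambda> t \<omega> \<partial>P) \<le> ennreal C * ?S t"
    by blast
  have "compact (\<sigma> ` {0..1})"
    using pw_smooth_path[OF pw_smooth.single[OF single]] by (simp add: path_def compact_continuous_image)
  from ennreal_tendsto_cmult[OF _ decay[OF this], of "ennreal C"]
  have lim: "((\<lambda>t. ennreal C * ?S t) \<longlongrightarrow> 0) at_top" by simp
  have "((\<lambda>t. \<integral>\<^sup>+\<omega>. \<Lambda> t \<omega> \<partial>P) \<longlongrightarrow> 0) at_top"
  proof (rule tendsto_sandwich[OF _ _ tendsto_const lim])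
    show "\<forall>\<^sub>F t in at_top. (\<integral>\<^sup>+\<omega>. \<Lambda> t \<omega> \<partial>P) \<le> ennreal C * ?S t"
      using eventually_ge_at_top[of 0] by eventually_elim (rule \<Lambda>(3))
  qed simp
  moreover have "AE \<omega> in P. confined (moved t \<sigma> \<omega>) (\<Lambda> t \<omega>)" if t: "0 \<le> t" for t
    using AE_regular AE_no_explosion[OF single] \<Lambda>(2)[OF t]
    by eventually_elim (rule smooth_path_confined[OF single t])
  ultimately show ?case using \<Lambda>(1) unfolding controls_def by blast
next
  case (join p q)
  then obtain \<Lambda> \<Lambda>' where p: "controls p \<Lambda>" and q: "controls q \<Lambda>'" by blast
  let ?M = "\<lambda>t \<omega>. \<Lambda> t \<omega> + \<Lambda>' t \<omega>"
  have "controls (p +++ q) ?M"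
    unfolding controls_def
  proof (intro conjI allI impI)
    show "?M t \<in> borel_measurable P" if "0 \<le> t" for t
      using p q that unfolding controls_def by (intro borel_measurable_add) blast+
    have "((\<lambda>t. (\<integral>\<^sup>+\<omega>. \<Lambda> t \<omega> \<partial>P) + (\<integral>\<^sup>+\<omega>. \<Lambda>' t \<omega> \<partial>P)) \<longlongrightarrow> 0 + 0) at_top"
      using p q by (intro tendsto_add) (auto simp: controls_def)
    moreover have "\<forall>\<^sub>F t in at_top. (\<integral>\<^sup>+\<omega>. \<Lambda> t \<omega> \<partial>P) + (\<integral>\<^sup>+\<omega>. \<Lambda>' t \<omega> \<partial>P) = (\<integral>\<^sup>+\<omega>. ?M t \<omega> \<partial>P)"
      using eventually_ge_at_top[of 0]
      by eventually_elim (use p q in \<open>simp add: controls_def nn_integral_add\<close>)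
    ultimately show "((\<lambda>t. \<integral>\<^sup>+\<omega>. ?M t \<omega> \<partial>P) \<longlongrightarrow> 0) at_top"
      by (auto elim: Lim_transform_eventually)
    fix t :: real assume t: "0 \<le> t"
    have "AE \<omega> in P. confined (moved t p \<omega>) (\<Lambda> t \<omega>)" "AE \<omega> in P. confined (moved t q \<omega>) (\<Lambda>' t \<omega>)"
      using p q t by (auto simp: controls_def)
    then show "AE \<omega> in P. confined (moved t (p +++ q) \<omega>) (?M t \<omega>)"
    proof eventually_elim
      case (elim \<omega>)
      show ?case
        unfolding confined_def
      proof (intro allI impI ballI)
        fix x c0 r a s
        assume ball: "normal_ball \<A> g x c0 r" and start: "reach x c0 a (moved t (p +++ q) \<omega> 0)"
          and small: "a + ?M t \<omega> < ennreal r" and s: "s \<in> {0..1::real}"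
        have start': "reach x c0 a (moved t p \<omega> 0)" using start by (simp add: joinpaths_def)
        have le: "a + \<Lambda> t \<omega> \<le> a + ?M t \<omega>" by (simp add: add.assoc[symmetric])
        note P1 = confinedD[OF elim(1) ball start' le_less_trans[OF le small]]
        have "reach x c0 (a + \<Lambda> t \<omega>) (moved t p \<omega> 1)" by (rule P1) simp
        \<comment> \<open>The second piece starts at the end of the first, at a distance from the
          centre enlarged by the first bound.\<close>
        then have mid: "reach x c0 (a + \<Lambda> t \<omega>) (moved t q \<omega> 0)"
          using join.hyps(3) by (simp add: pathfinish_def pathstart_def)
        have "a + \<Lambda> t \<omega> + \<Lambda>' t \<omega> < ennreal r" using small by (simp add: add.assoc)
        note P2 = confinedD[OF elim(2) ball mid this]
        show "reach x c0 (a + ?M t \<omega>) (moved t (p +++ q) \<omega> s)"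
        proof (cases "s \<le> 1 / 2")
          case True
          then have "reach x c0 (a + \<Lambda> t \<omega>) (moved t p \<omega> (2 * s))" using s by (intro P1) auto
          then show ?thesis using True le by (auto simp: joinpaths_def intro: reach_mono)
        next
          case False
          then have "reach x c0 (a + \<Lambda> t \<omega> + \<Lambda>' t \<omega>) (moved t q \<omega> (2 * s - 1))" using s by (intro P2) auto
          then show ?thesis using False by (simp add: joinpaths_def add.assoc)
        qed
      qed
    qed
  qed
  then show ?case by blast
qed

end

section \<open>Contracting loops\<close>

text \<open>
  Pulling the loop back to the boundary of the square, which is simply connected, replaces it by a
  path running back and forth.
\<close>

lemma homotopic_loops_const_imp_homotopic_paths:
  fixes q :: "real \<Rightarrow> 'm::topological_space"
  assumes "homotopic_loops UNIV q (\<lambda>_. a)"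
  shows "homotopic_paths UNIV q (\<lambda>_. q 0)"
proof -
  let ?I = "{0..1::real}"
  let ?S = "?I \<times> ?I"
  obtain h where h: "continuous_on ?S h" "\<And>x. x \<in> ?I \<Longrightarrow> h (0, x) = q x"
    "\<And>x. x \<in> ?I \<Longrightarrow> h (1, x) = a"
    and ends: "\<forall>t\<in>?I. pathfinish (h \<circ> Pair t) = pathstart (h \<circ> Pair t)"
    using assms unfolding homotopic_loops by auto
  have ends': "h (t, 1) = h (t, 0)" if "t \<in> ?I" for t
    using bspec[OF ends that] by (simp add: pathfinish_def pathstart_def)
  \<comment> \<open>The side of the square with first coordinate 0 carries q, the opposite one the
    constant a. Here p1 is the side of q, and p2 joins the same corners along the other three
    sides.\<close>
  define p1 where "p1 = linepath (0::real, 0::real) (0, 1)"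
  define p2 where "p2 = linepath (0::real, 0::real) (1, 0) +++ (linepath (1, 0) (1, 1) +++ linepath (1, 1) (0, 1))"
  \<comment> \<open>The first coordinate of p2: out, waiting at 1, and back. The map \<alpha> below
    is the trace of the base point under the homotopy.\<close>
  define \<psi> where "\<psi> = linepath (0::real) 1 +++ (linepath 1 1 +++ linepath 1 0)"
  define \<alpha> where "\<alpha> x = h (x, 0)" for x
  have convS: "convex ?S" by (intro convex_Times) auto
  have im1: "path_image p1 \<subseteq> ?S"
    unfolding p1_def path_image_linepath by (rule closed_segment_subset[OF _ _ convS]) auto
  have im2: "path_image p2 \<subseteq> ?S"
    unfolding p2_def
    by (intro subset_path_image_join; unfold path_image_linepath; rule closed_segment_subset[OF _ _ convS]) auto
  have "homotopic_paths ?S p1 p2"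
    using convex_imp_simply_connected[OF convS] im1 im2 unfolding simply_connected_eq_homotopic_paths
    by (simp add: p1_def p2_def)
  from homotopic_paths_continuous_image[OF this h(1), of UNIV]
  have 1: "homotopic_paths UNIV (h \<circ> p1) (h \<circ> p2)" by simp
  have q: "homotopic_paths UNIV q (h \<circ> p1)"
  proof (rule homotopic_paths_eq)
    show "path q" using homotopic_loops_imp_path[OF assms] by blast
    show "q t = (h \<circ> p1) t" if "t \<in> ?I" for t
      using h(2)[OF that] by (simp add: p1_def linepath_def)
  qed simp
  have im\<psi>: "path_image \<psi> \<subseteq> ?I"
    unfolding \<psi>_def
    by (intro subset_path_image_join; unfold path_image_linepath; rule closed_segment_subset) auto
  have "homotopic_paths ?I \<psi> (linepath 0 0)"
    using convex_imp_simply_connected[of ?I] im\<psi> unfolding simply_connected_eq_homotopic_paths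
    by (simp add: \<psi>_def)
  moreover have c\<alpha>: "continuous_on ?I \<alpha>"
    unfolding \<alpha>_def by (rule continuous_on_compose2[OF h(1)]) (auto intro!: continuous_intros)
  ultimately have 2: "homotopic_paths UNIV (\<alpha> \<circ> \<psi>) (\<alpha> \<circ> linepath 0 0)"
    by (rule homotopic_paths_continuous_image) simp
  have eq: "(h \<circ> p2) t = (\<alpha> \<circ> \<psi>) t" if t: "t \<in> ?I" for t
  proof -
    consider "t \<le> 1/2" | "1/2 < t" "2 * t - 1 \<le> 1/2" | "1/2 < t" "1/2 < 2 * t - 1" by linarith
    then show ?thesis
    proof cases
      case 1
      then show ?thesis by (simp add: p2_def \<psi>_def \<alpha>_def joinpaths_def linepath_def)
    next
      case 2
      then show ?thesis
        using h(3)[of "2 * (2 * t - 1)"] h(3)[of 0] by (simp add: p2_def \<psi>_def \<alpha>_def joinpaths_def linepath_def)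
    next
      case 3
      \<comment> \<open>On the last leg the loop condition replaces \<open>h (1 - v, 1)\<close> by
        \<open>h (1 - v, 0)\<close>, the trace of the base point run backwards.\<close>
      define v where "v = 2 * (2 * t - 1) - 1"
      have "1 - v \<in> ?I" using 3 t by (simp add: v_def)
      from ends'[OF this] show ?thesis
        using 3 by (simp add: p2_def \<psi>_def \<alpha>_def joinpaths_def linepath_def v_def)
    qed
  qed
  have "homotopic_paths UNIV (h \<circ> p2) (\<alpha> \<circ> \<psi>)"
    by (rule homotopic_paths_eq) (use homotopic_paths_imp_path[OF 1] eq in auto)
  moreover have "\<alpha> \<circ> linepath 0 0 = (\<lambda>_. q 0)"
    using h(2)[of 0] by (auto simp: \<alpha>_def linepath_def)
  ultimately show ?thesis using q 1 2 homotopic_paths_trans by metis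
qed

section \<open>Smoothing of paths and contraction of loops\<close>

context flow
begin

text \<open>The segment can be prolonged as long as it stays in the coordinate ball; this gives the
  open neighbourhood demanded of a smooth simplex.\<close>

lemma smooth_chart_segment:
  assumes c: "c \<in> \<A>" and seg: "ball y e \<subseteq> cran c" and ab: "a \<in> ball y e" "b \<in> ball y e"
  shows "smooth_path (\<lambda>s. cinv c (linepath a b s)) ((\<lambda>s. linepath a b s) -` ball y e)"
proof -
  let ?l = "\<lambda>s::real. s *\<^sub>R (b - a) + a"
  have l: "linepath a b s = ?l s" for s by (simp add: linepath_def algebra_simps)
  let ?U = "?l -` ball y e"
  let ?\<sigma> = "\<lambda>s. cinv c (?l s)"
  have cl: "continuous_on UNIV ?l" by (intro continuous_intros)
  have oU: "open ?U" by (rule open_vimage[OF open_ball cl])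
  have "{0..1} \<subseteq> ?U"
  proof
    fix s :: real assume "s \<in> {0..1}"
    then have "linepath a b s \<in> closed_segment a b" by (auto simp: linepath_in_path)
    then show "s \<in> ?U" using closed_segment_subset[OF ab convex_ball] l by auto
  qed
  moreover have "Ck_map \<infinity> euclidean_atlas \<A> ?U ?\<sigma>"
    unfolding Ck_map_def
  proof (intro conjI ballI)
    show "continuous_on ?U ?\<sigma>"
      by (rule continuous_on_compose2[OF continuous_cinv[OF c]]) (use seg in \<open>auto intro!: continuous_intros\<close>)
    fix c' :: "(real, real) chart" and d assume c': "c' \<in> euclidean_atlas" and d: "d \<in> \<A>"
    have c'': "c' = (UNIV, id)" using c' by (simp add: euclidean_atlas_def)
    let ?S = "cmap c ` (cdom c \<inter> cdom d)"
    have "Ck_on \<infinity> (?U \<inter> ?\<sigma> -` cdom d) (cmap d \<circ> ?\<sigma>)"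
      unfolding Ck_on_def
    proof (intro allI impI)
      fix n :: nat
      have "C_nat_on n ?S (cmap d \<circ> cinv c)"
        by (rule Ck_on_imp_C_nat_on[OF transition_smooth[OF c d]]) simp
      from C_nat_on_compose_affine[OF open_overlap[OF c open_cdom[OF d]] bounded_linear_scaleR_left this, of "b - a" a]
      have "C_nat_on n (?l -` ?S) (\<lambda>s. (cmap d \<circ> cinv c) (?l s))" .
      moreover have "?U \<inter> ?\<sigma> -` cdom d \<subseteq> ?l -` ?S"
        using seg unfolding overlap_eq[OF c] by auto
      ultimately show "C_nat_on n (?U \<inter> ?\<sigma> -` cdom d) (cmap d \<circ> ?\<sigma>)"
        by (auto intro: C_nat_on_subset simp: o_def)
    qed
    then show "Ck_on \<infinity> (cmap c' ` (?U \<inter> cdom c' \<inter> ?\<sigma> -` cdom d)) (cmap d \<circ> ?\<sigma> \<circ> cinv c')"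
      by (simp add: c'')
  qed
  ultimately show ?thesis using oU unfolding smooth_path_def l by blast
qed

text \<open>Only the given path is localised in V; the homotopy and the smoothed path may leave
  it.\<close>

definition smoothable :: "'m set \<Rightarrow> bool" where
  "smoothable V \<longleftrightarrow> (\<forall>p. path p \<and> path_image p \<subseteq> V \<longrightarrow> (\<exists>q. pw_smooth q \<and> homotopic_paths UNIV p q))"

text \<open>A coordinate ball is convex, so a path in it is homotopic, with fixed ends, to the
  coordinate segment between its end points.\<close>

lemma local_smoothing:
  "\<exists>V. open V \<and> x \<in> V \<and> smoothable V"
proof -
  obtain c where c: "c \<in> \<A>" "x \<in> cdom c" using chart_ex by blast
  let ?y = "cmap c x"
  have "?y \<in> cran c" using c by blast
  then obtain e where e: "0 < e" "ball ?y e \<subseteq> cran c" using open_cran[OF c(1)] open_contains_ball by blast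
  define V where "V = cdom c \<inter> cmap c -` ball ?y e"
  have "open V"
    unfolding V_def by (rule continuous_open_preimage[OF continuous_cmap[OF c(1)] open_cdom[OF c(1)] open_ball])
  moreover have "x \<in> V" using c e by (simp add: V_def)
  moreover have "\<exists>q. pw_smooth q \<and> homotopic_paths UNIV p q" if p: "path p" "path_image p \<subseteq> V" for p
  proof -
    let ?r = "cmap c \<circ> p"
    have pV: "p t \<in> V" if "t \<in> {0..1}" for t using p(2) that by (auto simp: path_image_def)
    have r: "path ?r"
      by (rule path_continuous_image[OF p(1)])
         (rule continuous_on_subset[OF continuous_cmap[OF c(1)]], use p(2) in \<open>auto simp: V_def\<close>)
    have r_im: "path_image ?r \<subseteq> ball ?y e"
      using pV by (auto simp: path_image_def V_def)
    define a where "a = pathstart ?r"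
    define b where "b = pathfinish ?r"
    have ab: "a \<in> ball ?y e" "b \<in> ball ?y e"
      using r_im pathstart_in_path_image pathfinish_in_path_image unfolding a_def b_def by blast+
    have l_im: "path_image (linepath a b) \<subseteq> ball ?y e"
      unfolding path_image_linepath by (rule closed_segment_subset[OF ab convex_ball])
    have "homotopic_paths (ball ?y e) ?r (linepath a b)"
      using convex_imp_simply_connected[OF convex_ball, of ?y e] r r_im l_im
      unfolding simply_connected_eq_homotopic_paths by (simp add: a_def b_def)
    from homotopic_paths_continuous_image[OF this continuous_on_subset[OF continuous_cinv[OF c(1)] e(2)], of UNIV]
    have "homotopic_paths UNIV (cinv c \<circ> ?r) (cinv c \<circ> linepath a b)" by simp
    moreover have "homotopic_paths UNIV p (cinv c \<circ> ?r)"
      by (rule homotopic_paths_eq[OF p(1)]) (use pV in \<open>auto simp: V_def cinv_cmap[OF c(1)]\<close>)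
    ultimately have "homotopic_paths UNIV p (\<lambda>s. cinv c (linepath a b s))"
      using homotopic_paths_trans by (auto simp: o_def)
    moreover have "pw_smooth (\<lambda>s. cinv c (linepath a b s))"
      by (rule pw_smooth.single[OF smooth_chart_segment[OF c(1) e(2) ab]])
    ultimately show ?thesis by blast
  qed
  ultimately show ?thesis unfolding smoothable_def by blast
qed

text \<open>Induction along the parameter interval takes the place of a subdivision by a Lebesgue
  number: a smoothed initial piece is prolonged across one smoothable neighbourhood at a
  time.\<close>

lemma path_homotopic_pw_smooth:
  assumes p: "path p"
  shows "\<exists>q. pw_smooth q \<and> homotopic_paths UNIV p q"
proof -
  let ?sub = "\<lambda>s t. p \<circ> linepath s t"
  let ?P = "\<lambda>s. \<exists>q. pw_smooth q \<and> homotopic_paths UNIV (?sub 0 s) q"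
  have cp: "continuous_on {0..1} p" using p by (simp add: path_def)
  have seg: "path_image (linepath s t) \<subseteq> {0..1}" if "s \<in> {0..1}" "t \<in> {0..1}" for s t :: real
    unfolding path_image_linepath by (rule closed_segment_subset[OF that]) simp
  have path_sub: "path (?sub s t)" if "s \<in> {0..1}" "t \<in> {0..1}" for s t
    by (rule path_continuous_image[OF path_linepath continuous_on_subset[OF cp seg[OF that]]])
  have im_sub: "path_image (?sub s t) = p ` {s..t}" if "s \<le> t" for s t
    using that by (simp add: path_image_compose closed_segment_eq_real_ivl)
  have nbhd: "\<exists>V e. 0 < e \<and> (\<forall>t\<in>{0..1}. dist t s < e \<longrightarrow> p t \<in> V) \<and>
      smoothable V" if s: "s \<in> {0..1}" for s
  proof -
    obtain V where V: "open V" "p s \<in> V"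
      "smoothable V"
      using local_smoothing by blast
    have "\<forall>\<^sub>F t in at s within {0..1}. p t \<in> V" by (rule continuous_within_eventually[OF cp s V(1,2)])
    then obtain e where "0 < e" "\<And>t. t \<in> {0..1} \<Longrightarrow> t \<noteq> s \<Longrightarrow> dist t s < e \<Longrightarrow> p t \<in> V"
      unfolding eventually_at by auto
    then have "0 < e \<and> (\<forall>t\<in>{0..1}. dist t s < e \<longrightarrow> p t \<in> V)" using V(2) by metis
    then show ?thesis using V(3) by blast
  qed
  have extend: "?P t" if st: "s \<in> {0..1}" "t \<in> {0..1}" "s \<le> t" and Ps: "?P s"
    and V: "\<And>u. u \<in> {s..t} \<Longrightarrow> p u \<in> V" "smoothable V"
    for s t V
  proof -
    obtain q where q: "pw_smooth q" "homotopic_paths UNIV (?sub 0 s) q" using Ps by blast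
    have "path_image (?sub s t) \<subseteq> V" using V(1) by (auto simp: im_sub[OF st(3)])
    with path_sub[OF st(1,2)] obtain q' where q': "pw_smooth q'" "homotopic_paths UNIV (?sub s t) q'"
      using V(2) unfolding smoothable_def by blast
    have e: "pathfinish q = pathstart q'"
      using homotopic_paths_imp_pathfinish[OF q(2)] homotopic_paths_imp_pathstart[OF q'(2)]
      by (simp add: pathfinish_compose pathstart_compose)
    have "homotopic_paths UNIV (?sub 0 s +++ ?sub s t) (q +++ q')"
      by (rule homotopic_paths_join[OF q(2) q'(2)]) (simp add: pathfinish_compose pathstart_compose)
    \<comment> \<open>Both sides are images under p of paths in an interval, which is simply
      connected, with the same ends.\<close>
    moreover have "homotopic_paths UNIV (?sub 0 s +++ ?sub s t) (?sub 0 t)"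
    proof -
      have z: "0 \<in> {0..1::real}" by simp
      have "homotopic_paths {0..1} (linepath 0 s +++ linepath s t) (linepath 0 t)"
        using convex_imp_simply_connected[of "{0..1::real}"] subset_path_image_join[OF seg[OF z st(1)] seg[OF st(1,2)]]
          seg[OF z st(2)] unfolding simply_connected_eq_homotopic_paths by simp
      from homotopic_paths_continuous_image[OF this cp, of UNIV]
      show ?thesis by (simp add: path_compose_join)
    qed
    ultimately have "homotopic_paths UNIV (?sub 0 t) (q +++ q')"
      by (blast intro: homotopic_paths_trans homotopic_paths_sym)
    then show ?thesis using pw_smooth.join[OF q(1) q'(1) e] by blast
  qed
  have "?P 1"
  proof (rule real_interval_induct[of ?P])
    fix s :: real assume s: "0 \<le> s" "s \<le> 1" "\<And>r. 0 \<le> r \<Longrightarrow> r < s \<Longrightarrow> ?P r"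
    have sI: "s \<in> {0..1}" using s by auto
    obtain V e where V: "0 < e" "\<forall>t\<in>{0..1}. dist t s < e \<longrightarrow> p t \<in> V"
      "smoothable V"
      using nbhd[OF sI] by (elim exE conjE) (rule that)
    show "?P s"
    proof (cases "s = 0")
      case True
      have "path (?sub 0 s)" by (rule path_sub) (use s in auto)
      moreover have "path_image (?sub 0 s) \<subseteq> V"
        using V(1,2) True by (auto simp: im_sub)
      ultimately show ?thesis using V(3) unfolding smoothable_def by blast
    next
      case False
      \<comment> \<open>A parameter strictly below s from which the rest of the way to s stays in V;
        the maximum keeps it in the unit interval.\<close>
      define r where "r = max 0 (s - e / 2)"
      have r: "0 \<le> r" "r < s" "s - e < r" using s False V(1) by (auto simp: r_def)
      show ?thesis
      proof (rule extend[of r s V, OF _ sI _ s(3)[OF r(1,2)] _ V(3)])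
        show "p u \<in> V" if "u \<in> {r..s}" for u
        proof -
          have "u \<in> {0..1}" "dist u s < e" using that r s by (auto simp: dist_real_def)
          then show ?thesis using V(2) by blast
        qed
      qed (use r s in auto)
    qed
  next
    fix s :: real assume s: "0 \<le> s" "s < 1" "?P s"
    have sI: "s \<in> {0..1}" using s by auto
    obtain V e where V: "0 < e" "\<forall>t\<in>{0..1}. dist t s < e \<longrightarrow> p t \<in> V"
      "smoothable V"
      using nbhd[OF sI] by (elim exE conjE) (rule that)
    have "?P r" if r: "s \<le> r" "r < s + e" "r \<le> 1" for r
    proof (rule extend[of s r V, OF sI _ r(1) s(3) _ V(3)])
      show "p u \<in> V" if "u \<in> {s..r}" for u
      proof -
        have "u \<in> {0..1}" "dist u s < e" using that r s by (auto simp: dist_real_def)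
        then show ?thesis using V(2) by blast
      qed
    qed (use r s in auto)
    then show "\<exists>s'>s. \<forall>r. s \<le> r \<and> r < s' \<and> r \<le> 1 \<longrightarrow> ?P r"
      using V(1) by (intro exI[of _ "s + e"]) auto
  qed auto
  moreover have "?sub 0 1 = p" by (rule ext) (simp add: linepath_def)
  ultimately show ?thesis by simp
qed

text \<open>The radius r depends on p, but every such radius exceeds c. This uniformity is needed
  because the centre will be a random point of M.\<close>

lemma injectivity_radius_normal_ball:
  assumes "ereal c < injectivity_radius \<A> g"
  shows "\<exists>r>c. normal_ball \<A> g p (chart_at \<A> p) r"
proof -
  have "ereal c < injectivity_radius_at \<A> g p"
    using assms unfolding injectivity_radius_def by (rule less_INF_D) simp
  then obtain r where r: "ereal c < ereal r" "0 < r"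
     "{v \<in> tangent_space \<A> p. sqrt (g p v v) < r} \<subseteq> exp_domain \<A> g p"
     "\<forall>c\<in>\<A>. p \<in> cdom c \<longrightarrow>
        Ck_diffeo_onto_open_image \<infinity> euclidean_atlas \<A>
          {u. sqrt (g p (tvec_of \<A> c p u) (tvec_of \<A> c p u)) < r}
          (\<lambda>u. exp_map \<A> g p (tvec_of \<A> c p u))"
    unfolding injectivity_radius_at_def less_Sup_iff by blast
  have "normal_ball \<A> g p (chart_at \<A> p) r"
    by unfold_locales (use r chart_at in auto)
  then show ?thesis using r(1) by auto
qed

lemma pw_smooth_loop_contractible:
  assumes q: "pw_smooth q" "pathfinish q = pathstart q" and c: "0 < c" "ereal c < injectivity_radius \<A> g"
  shows "\<exists>a. homotopic_loops UNIV q (\<lambda>_. a)"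
proof -
  obtain \<Lambda> where \<Lambda>: "controls q \<Lambda>" using pw_smooth_controls[OF q(1)] by blast
  then have lim: "((\<lambda>t. \<integral>\<^sup>+\<omega>. \<Lambda> t \<omega> \<partial>P) \<longlongrightarrow> 0) at_top" by (simp add: controls_def)
  have "\<forall>\<^sub>F t in at_top. (\<integral>\<^sup>+\<omega>. \<Lambda> t \<omega> \<partial>P) < ennreal c \<and> 0 \<le> t"
    by (intro eventually_conj order_tendstoD(2)[OF lim] eventually_ge_at_top) (use c in simp)
  then obtain t where t: "(\<integral>\<^sup>+\<omega>. \<Lambda> t \<omega> \<partial>P) < ennreal c" "0 \<le> t"
    using eventually_happens[of _ "at_top :: real filter"] by auto
  have AE1: "AE \<omega> in P. regular \<omega> \<and> (\<forall>s\<in>{0..1}. \<xi> (q s) \<omega> = \<infinity>) \<and>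
     confined (moved t q \<omega>) (\<Lambda> t \<omega>)" (is "AE \<omega> in P. ?A \<omega>")
    using AE_regular pw_smooth_no_explosion[OF q(1)] \<Lambda> t(2) by (simp add: controls_def)
  \<comment> \<open>Otherwise the bound would be at least c almost everywhere, and so would its
    mean, as P has total mass 1.\<close>
  have "\<exists>\<omega>. ?A \<omega> \<and> \<Lambda> t \<omega> < ennreal c"
  proof (rule ccontr)
    assume none: "\<not> (\<exists>\<omega>. ?A \<omega> \<and> \<Lambda> t \<omega> < ennreal c)"
    have "AE \<omega> in P. ennreal c \<le> \<Lambda> t \<omega>"
      using AE1 by eventually_elim (use none in \<open>auto simp: not_less\<close>)
    then have "(\<integral>\<^sup>+\<omega>. ennreal c \<partial>P) \<le> (\<integral>\<^sup>+\<omega>. \<Lambda> t \<omega> \<partial>P)" by (rule nn_integral_mono_AE)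
    then show False using t(1) by (simp add: emeasure_space_1)
  qed
  then obtain \<omega> where A: "?A \<omega>" and small: "\<Lambda> t \<omega> < ennreal c" by blast
  let ?\<gamma> = "moved t q \<omega>"
  let ?p = "?\<gamma> 0"
  obtain r where cr: "c < r" and ball: "normal_ball \<A> g ?p (chart_at \<A> ?p) r"
    using injectivity_radius_normal_ball[OF c(2)] by blast
  interpret normal_ball \<A> g ?p "chart_at \<A> ?p" r by (rule ball)
  have lt: "\<Lambda> t \<omega> < ennreal r" using cr by (intro less_le_trans[OF small] ennreal_leI) simp
  \<comment> \<open>The centre is the starting point of the transported loop, so the initial
    distance is 0 and the whole radius is available.\<close>
  have "reach ?p (chart_at \<A> ?p) 0 ?p"
    unfolding reach_def using E_zero N_zero unfolding E_def N_def by (intro exI[of _ 0]) simp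
  then have near: "\<forall>s\<in>{0..1}. reach ?p (chart_at \<A> ?p) (\<Lambda> t \<omega>) (?\<gamma> s)"
    using confinedD[of ?\<gamma> "\<Lambda> t \<omega>" ?p "chart_at \<A> ?p" r 0] A ball lt by simp
  have in_ball: "?\<gamma> s \<in> E ` B" if s: "s \<in> {0..1}" for s
  proof -
    obtain u where u: "?\<gamma> s = E u" "ennreal (nrm u) \<le> \<Lambda> t \<omega>"
      using bspec[OF near s] unfolding reach_def E_def N_def by blast
    have "ennreal (nrm u) < ennreal r" using u(2) lt by (rule le_less_trans)
    then have "u \<in> B" using N_nonneg by (simp add: ennreal_less_iff B_def)
    then show ?thesis using u(1) by blast
  qed
  have pathq: "continuous_on {0..1} q" using pw_smooth_path[OF q(1)] by (simp add: path_def)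
  have q01: "q 1 = q 0" using q(2) by (simp add: pathfinish_def pathstart_def)
  let ?I = "{0..1::real}"
  \<comment> \<open>The factor t rescales time to the unit interval; joint continuity of the flow in
    time and space makes this a homotopy.\<close>
  let ?h = "\<lambda>z. F (t * fst z) (q (snd z)) \<omega>"
  have ch: "continuous_on (?I \<times> ?I) ?h"
  proof -
    have "continuous_on {(s, x). 0 \<le> s \<and> ereal s < \<xi> x \<omega>} (\<lambda>(s, x). F s x \<omega>)"
      using A by (simp add: regular_def)
    then have "continuous_on (?I \<times> ?I) (\<lambda>z. (\<lambda>(s, x). F s x \<omega>) (t * fst z, q (snd z)))"
      by (rule continuous_on_compose2)
         (use A t(2) in \<open>auto intro!: continuous_intros continuous_on_compose2[OF pathq]\<close>)
    then show ?thesis by simp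
  qed
  have "homotopic_loops UNIV q ?\<gamma>"
    unfolding homotopic_loops
  proof (intro exI[of _ ?h] conjI ballI ch)
    show "?h (0, x) = q x" for x using A by (simp add: regular_def)
  qed (auto simp: pathfinish_def pathstart_def q01)
  moreover have "homotopic_loops UNIV ?\<gamma> (\<lambda>_. ?p)"
  proof -
    \<comment> \<open>Scaling by one minus the homotopy parameter draws every point along its ray to
      \<open>E 0\<close>, the centre.\<close>
    let ?k = "\<lambda>z. E ((1 - fst z) *\<^sub>R Einv (?\<gamma> (snd z)))"
    have c\<gamma>: "continuous_on ?I ?\<gamma>"
    proof -
      have "continuous_on ?I (\<lambda>s. ?h (1, s))"
        by (rule continuous_on_compose2[OF ch]) (auto intro!: continuous_intros)
      then show ?thesis by simp
    qed
    have cw: "continuous_on ?I (\<lambda>s. Einv (?\<gamma> s))"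
      using E_inv_smooth in_ball by (intro continuous_on_compose2[OF _ c\<gamma>, of "E ` B"]) (auto simp: Ck_map_def)
    have cE: "continuous_on B E" using E_C1m by (simp add: C1m_def)
    have ck: "continuous_on (?I \<times> ?I) ?k"
    proof (rule continuous_on_compose2[OF cE])
      show "continuous_on (?I \<times> ?I) (\<lambda>z. (1 - fst z) *\<^sub>R Einv (?\<gamma> (snd z)))"
        by (intro continuous_intros continuous_on_compose2[OF cw]) auto
      show "(\<lambda>z. (1 - fst z) *\<^sub>R Einv (?\<gamma> (snd z))) ` (?I \<times> ?I) \<subseteq> B"
        using in_ball by (auto intro!: B_star Einv_in)
    qed
    show ?thesis
      unfolding homotopic_loops
    proof (intro exI[of _ ?k] conjI ballI ck)
      show "?k (0, s) = ?\<gamma> s" if "s \<in> ?I" for s using E_Einv[OF in_ball[OF that]] by simp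
      show "?k (1, s) = ?p" for s by (simp add: E_zero)
    qed (auto simp: pathfinish_def pathstart_def q01)
  qed
  ultimately show ?thesis using homotopic_loops_trans by blast
qed

lemma loop_contractible:
  fixes p :: "real \<Rightarrow> 'm"
  assumes p: "path p" "pathstart p = x" "pathfinish p = x" and c: "0 < c" "ereal c < injectivity_radius \<A> g"
  shows "homotopic_paths UNIV p (\<lambda>_. x)"
proof -
  obtain q where q: "pw_smooth q" "homotopic_paths UNIV p q" using path_homotopic_pw_smooth[OF p(1)] by blast
  have ends: "pathstart q = x" "pathfinish q = x"
    using homotopic_paths_imp_pathstart[OF q(2)] homotopic_paths_imp_pathfinish[OF q(2)] p by auto
  obtain a where "homotopic_loops UNIV q (\<lambda>_. a)"
    using pw_smooth_loop_contractible[OF q(1) _ c] ends by auto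
  from homotopic_loops_const_imp_homotopic_paths[OF this]
  have "homotopic_paths UNIV q (\<lambda>_. x)" using ends by (simp add: pathstart_def)
  with q(2) show ?thesis by (rule homotopic_paths_trans)
qed

end

section \<open>Passage to the fundamental group\<close>

lemma trivial_fundamental_group:
  fixes x :: "'m::topological_space"
  assumes null: "\<And>p. path p \<Longrightarrow> pathstart p = x \<Longrightarrow> pathfinish p = x \<Longrightarrow> homotopic_paths UNIV p (\<lambda>_. x)"
  shows "trivial_group (fundamental_group x)"
proof -
  let ?k = "\<lambda>_::real. x"
  let ?e = "loop_homotopy `` {?k}"
  have k: "path ?k" "pathstart ?k = x" "pathfinish ?k = x"
    by (simp_all add: path_def pathstart_def pathfinish_def)
  \<comment> \<open>Since every loop at x is homotopic to the constant one, the class of the latter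
    consists of all loops at x.\<close>
  have mem: "q \<in> ?e \<longleftrightarrow> path q \<and> pathstart q = x \<and> pathfinish q = x" for q
  proof
    assume "q \<in> ?e"
    then have h: "homotopic_paths UNIV ?k q" by (simp add: loop_homotopy_def)
    show "path q \<and> pathstart q = x \<and> pathfinish q = x"
      using homotopic_paths_imp_path[OF h] homotopic_paths_imp_pathstart[OF h] homotopic_paths_imp_pathfinish[OF h] k
      by auto
  next
    assume "path q \<and> pathstart q = x \<and> pathfinish q = x"
    then have "homotopic_paths UNIV ?k q" using null homotopic_paths_sym by blast
    then show "q \<in> ?e" by (simp add: loop_homotopy_def)
  qed
  have cls: "loop_homotopy `` {p} = ?e" if "path p" "pathstart p = x" "pathfinish p = x" for p
  proof -
    have h: "homotopic_paths UNIV p ?k" by (rule null[OF that])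
    have "homotopic_paths UNIV p q \<longleftrightarrow> homotopic_paths UNIV ?k q" for q
      using h homotopic_paths_trans homotopic_paths_sym by blast
    then show ?thesis by (simp add: loop_homotopy_def Image_def)
  qed
  have carrier: "carrier (fundamental_group x) = {?e}"
  proof -
    let ?L = "{p. path p \<and> pathstart p = x \<and> pathfinish p = x}"
    have "?L // loop_homotopy = {?e}"
    proof (intro equalityI subsetI)
      fix z assume "z \<in> ?L // loop_homotopy"
      then show "z \<in> {?e}" by (rule quotientE) (simp add: cls)
    next
      fix z assume "z \<in> {?e}"
      then show "z \<in> ?L // loop_homotopy" using quotientI[of ?k ?L loop_homotopy] k by simp
    qed
    then show ?thesis by (simp add: fundamental_group_def)
  qed
  have one: "\<one>\<^bsub>fundamental_group x\<^esub> = ?e" by (simp add: fundamental_group_def)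
  have mult: "?e \<otimes>\<^bsub>fundamental_group x\<^esub> ?e = ?e"
  proof -
    have "loop_homotopy `` {p +++ q | p q. p \<in> ?e \<and> q \<in> ?e} = (\<Union>r\<in>{p +++ q | p q. p \<in> ?e \<and> q \<in> ?e}. loop_homotopy `` {r})"
      by blast
    also have "\<dots> = (\<Union>r\<in>{p +++ q | p q. p \<in> ?e \<and> q \<in> ?e}. ?e)"
    proof (rule SUP_cong[OF refl])
      fix r assume "r \<in> {p +++ q | p q. p \<in> ?e \<and> q \<in> ?e}"
      then obtain p q where "r = p +++ q" "p \<in> ?e" "q \<in> ?e" by blast
      then show "loop_homotopy `` {r} = ?e" unfolding mem by (intro cls) auto
    qed
    \<comment> \<open>A union of copies of one set is that set only for a nonempty index set; here
      the constant loop joined with itself is an index.\<close>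
    also have "\<dots> = ?e" using mem k by blast
    finally show ?thesis by (simp add: fundamental_group_def)
  qed
  have "group (fundamental_group x)"
    by (rule groupI) (auto simp: carrier one mult)
  then show ?thesis by (simp add: trivial_group_def carrier one)
qed

theorem theorem7p3p1:
  fixes \<A> :: "('m::{t2_space,second_countable_topology}, 'e::euclidean_space) chart set"
    and g :: "'m \<Rightarrow> ('m, 'e) tvec \<Rightarrow> ('m, 'e) tvec \<Rightarrow> real"
    and c :: real
    and P :: "'w measure"
    and \<F> :: "real \<Rightarrow> 'w measure"
    and B :: "real \<Rightarrow> 'w \<Rightarrow> 'b::euclidean_space"
    and X :: "'m \<Rightarrow> 'b \<Rightarrow> ('m, 'e) tvec"
    and A :: "'m \<Rightarrow> ('m, 'e) tvec"
    and F :: "real \<Rightarrow> 'm \<Rightarrow> 'w \<Rightarrow> 'm"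
    and \<xi> :: "'m \<Rightarrow> 'w \<Rightarrow> ereal"
  assumes "smooth_atlas \<A>" and "riemannian_metric \<A> g"
    and "0 < c" and "ereal c < injectivity_radius \<A> g"
    and "usual_filtration P \<F>" and "brownian_motion P \<F> B"
    and "C2_sds \<A> X A" and "solution_flow \<A> P \<F> B X A F \<xi>"
    and "strongly_1_complete \<A> P \<xi>"
    and "\<And>K. compact K \<Longrightarrow>
           ((\<lambda>t. SUP x\<in>K. expected_derivative_norm \<A> g P F \<xi> t x) \<longlongrightarrow> 0) at_top"
  shows "trivial_group (fundamental_group (x :: 'm))"
proof -
  interpret prob_space P using assms(5) by (simp add: usual_filtration_def)
  \<comment> \<open>Adaptedness gives measurability with respect to the filtration at time t, whose
    sets all belong to P.\<close>
  have sets: "{\<omega> \<in> space P. ereal t < \<xi> y \<omega> \<and> F t y \<omega> \<in> U} \<in> sets P" if "0 \<le> t" "open U" for t y U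
  proof -
    have "maximal_solution \<A> P \<F> B X A y (\<lambda>t. F t y) (\<xi> y)" using assms(8) by (simp add: solution_flow_def)
    then have "{\<omega> \<in> space P. ereal t < \<xi> y \<omega> \<and> F t y \<omega> \<in> U} \<in> sets (\<F> t)"
      unfolding maximal_solution_def using that by blast
    moreover have "sets (\<F> t) \<subseteq> sets P" using assms(5) by (simp add: usual_filtration_def subalgebra_def)
    ultimately show ?thesis by blast
  qed
  interpret flow \<A> g P F \<xi>
    by unfold_locales (use assms sets in \<open>auto simp: solution_flow_def\<close>)
  show ?thesis
    by (rule trivial_fundamental_group) (rule loop_contractible[OF _ _ _ assms(3,4)])
qed

end
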